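(* Let $s\ge0$, $s_1,s_2\ge s$, $s_1+s_2>s+\frac32$ and $\delta_1+\delta_2\ge\delta-\frac32$ with $\delta,\delta_1,\delta_2\in\mathbb R$. Then there is a constant $C$ such that for all $u\in H_{s_1,\delta_1}$, $v\in H_{s_2,\delta_2}$, $$\|uv\|_{H_{s,\delta}}\le C\|u\|_{H_{s_1,\delta_1}}\|v\|_{H_{s_2,\delta_2}}.$$
   Context: Weighted spaces: let $K_0=\{x\in\mathbb R^3:|x|\le4\}$, $K_j=\{2^{j-3}\le|x|\le2^{j+2}\}$ for $j\ge1$. Fix $\psi_j\in C_0^\infty(\mathbb R^3)$ with $\psi_j=1$ on $K_j$, $\operatorname{supp}\psi_j\subset\{2^{j-4}\le|x|\le2^{j+3}\}$ for $j\ge1$, $\operatorname{supp}\psi_0\subset\{|x|\le8\}$, and $|\partial^\beta\psi_j|\le C_\beta2^{-|\beta|j}$ with $C_\beta$ independent of $j$. Write $f_\varepsilon(x)=f(\varepsilon x)$ and let $H^s$ be the Bessel potential space, $\|u\|_{H^s}^2=\int(1+|\xi|^2)^s|\hat u|^2d\xi$. For $s\ge0,\delta\in\mathbb R$, $H_{s,\delta}$ is the space of tempered distributions on $\mathbb R^3$ with finite norm $\|u\|_{H_{s,\delta}}^2=\sum_{j\ge0}2^{(\frac32+\delta)2j}\|(\psi_ju)_{2^j}\|_{H^s}^2$. *)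

theory Defs
  imports "HOL-Analysis.Analysis"
begin

section \<open>Iterated partial derivatives and test functions\<close>

definition partial_deriv :: "3 \<Rightarrow> (real^3 \<Rightarrow> complex) \<Rightarrow> real^3 \<Rightarrow> complex" where
  "partial_deriv i f x = frechet_derivative f (at x) (axis i 1)"

text \<open>A multi-index \<open>\<beta>\<close> is encoded as a list of coordinate directions, so \<open>\<bar>\<beta>\<bar>\<close> is its length.
  For smooth functions the order of the directions is irrelevant.\<close>

primrec iter_deriv :: "3 list \<Rightarrow> (real^3 \<Rightarrow> complex) \<Rightarrow> real^3 \<Rightarrow> complex" where
  "iter_deriv [] f = f"
| "iter_deriv (i # \<beta>) f = partial_deriv i (iter_deriv \<beta> f)"

definition smooth :: "(real^3 \<Rightarrow> complex) \<Rightarrow> bool" where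
  "smooth f \<longleftrightarrow> (\<forall>\<beta> x. iter_deriv \<beta> f differentiable (at x))"

definition supp :: "(real^3 \<Rightarrow> complex) \<Rightarrow> (real^3) set" where
  "supp f = closure {x. f x \<noteq> 0}"

definition schwartz :: "(real^3 \<Rightarrow> complex) set" where
  "schwartz = {\<phi>. smooth \<phi> \<and>
     (\<forall>\<beta> N. bounded (range (\<lambda>x. (1 + norm x) ^ N *\<^sub>R iter_deriv \<beta> \<phi> x)))}"

definition schwartz_norm :: "nat \<Rightarrow> (real^3 \<Rightarrow> complex) \<Rightarrow> real" where
  "schwartz_norm N \<phi> =
     (SUP (\<beta>, x)\<in>{\<beta>. length \<beta> \<le> N} \<times> UNIV. (1 + norm x) ^ N * norm (iter_deriv \<beta> \<phi> x))"


section \<open>Tempered distributions\<close>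

text \<open>Distributions are functionals on all functions; only their values on Schwartz functions
  matter. The pairing is bilinear (no complex conjugation).\<close>

type_synonym functional = "(real^3 \<Rightarrow> complex) \<Rightarrow> complex"

definition tempered :: "functional \<Rightarrow> bool" where
  "tempered u \<longleftrightarrow>
     (\<forall>\<phi>\<in>schwartz. \<forall>\<eta>\<in>schwartz. \<forall>a b. u (\<lambda>x. a * \<phi> x + b * \<eta> x) = a * u \<phi> + b * u \<eta>) \<and>
     (\<exists>N C. \<forall>\<phi>\<in>schwartz. norm (u \<phi>) \<le> C * schwartz_norm N \<phi>)"

definition represented_by :: "functional \<Rightarrow> (real^3 \<Rightarrow> complex) \<Rightarrow> bool" where
  "represented_by u f \<longleftrightarrow> f \<in> borel_measurable borel \<and>
     (\<forall>\<phi>\<in>schwartz. integrable lborel (\<lambda>x. f x * \<phi> x) \<and>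
        u \<phi> = (\<integral>x. f x * \<phi> x \<partial>lborel))"

definition smooth_mult :: "(real^3 \<Rightarrow> complex) \<Rightarrow> functional \<Rightarrow> functional" where
  "smooth_mult \<psi> u = (\<lambda>\<phi>. u (\<lambda>x. \<psi> x * \<phi> x))"

text \<open>The dilation \<open>f\<^sub>\<epsilon>(x) = f(\<epsilon> x)\<close> extended to distributions by the change of variables
  \<open>\<integral> f(\<epsilon> x) \<phi>(x) dx = \<epsilon>\<^sup>-\<^sup>3 \<integral> f(y) \<phi>(y/\<epsilon>) dy\<close>.\<close>

definition dilate :: "real \<Rightarrow> functional \<Rightarrow> functional" where
  "dilate \<epsilon> u = (\<lambda>\<phi>. of_real (1 / \<epsilon> ^ 3) * u (\<lambda>x. \<phi> ((1 / \<epsilon>) *\<^sub>R x)))"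

definition fourier :: "(real^3 \<Rightarrow> complex) \<Rightarrow> real^3 \<Rightarrow> complex" where
  "fourier \<phi> \<xi> = of_real ((2 * pi) powr (- 3 / 2)) * (\<integral>x. cis (- (x \<bullet> \<xi>)) * \<phi> x \<partial>lborel)"

definition fourier_dist :: "functional \<Rightarrow> functional" where
  "fourier_dist u = (\<lambda>\<phi>. u (fourier \<phi>))"

text \<open>For \<open>s \<ge> 0\<close> the elements of the spaces below are functions. The product of two
  distributions given by functions \<open>f\<close> and \<open>g\<close> is the distribution given by the pointwise
  product; \<open>f\<close> and \<open>g\<close> are unique almost everywhere, hence \<open>w\<close> is unique on Schwartz functions.\<close>

definition is_product :: "functional \<Rightarrow> functional \<Rightarrow> functional \<Rightarrow> bool" where
  "is_product u v w \<longleftrightarrow>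
     (\<exists>f g. represented_by u f \<and> represented_by v g \<and> represented_by w (\<lambda>x. f x * g x))"


section \<open>Bessel potential spaces and weighted spaces\<close>

text \<open>The squared norm \<open>\<integral> (1 + \<bar>\<xi>\<bar>\<^sup>2)\<^sup>s \<bar>h(\<xi>)\<bar>\<^sup>2 d\<xi>\<close>, where \<open>h\<close> is the Fourier transform of \<open>u\<close>. As \<open>h\<close> is
  unique almost everywhere, the infimum is over at most one value; it is \<open>\<infinity>\<close> if there is no such \<open>h\<close>.\<close>

definition bessel_norm_sq :: "real \<Rightarrow> functional \<Rightarrow> ennreal" where
  "bessel_norm_sq s u =
     (INF h\<in>{h. represented_by (fourier_dist u) h}.
        \<integral>\<^sup>+\<xi>. ennreal ((1 + (norm \<xi>)\<^sup>2) powr s * (norm (h \<xi>))\<^sup>2) \<partial>lborel)"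

definition dyadic_shell :: "nat \<Rightarrow> (real^3) set" where
  "dyadic_shell j = (if j = 0 then {x. norm x \<le> 4}
     else {x. 2 powr (real j - 3) \<le> norm x \<and> norm x \<le> 2 powr (real j + 2)})"

definition dyadic_cutoffs :: "(nat \<Rightarrow> real^3 \<Rightarrow> complex) \<Rightarrow> bool" where
  "dyadic_cutoffs \<psi> \<longleftrightarrow>
     (\<forall>j. smooth (\<psi> j)) \<and>
     (\<forall>j. \<forall>x\<in>dyadic_shell j. \<psi> j x = 1) \<and>
     supp (\<psi> 0) \<subseteq> {x. norm x \<le> 8} \<and>
     (\<forall>j\<ge>1. supp (\<psi> j) \<subseteq> {x. 2 powr (real j - 4) \<le> norm x \<and> norm x \<le> 2 powr (real j + 3)}) \<and>
     (\<forall>\<beta>. \<exists>C. \<forall>j x. norm (iter_deriv \<beta> (\<psi> j) x) \<le> C * 2 powr (- real (length \<beta>) * real j))"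

definition weighted_norm_sq :: "(nat \<Rightarrow> real^3 \<Rightarrow> complex) \<Rightarrow> real \<Rightarrow> real \<Rightarrow> functional \<Rightarrow> ennreal" where
  "weighted_norm_sq \<psi> s \<delta> u =
     (\<Sum>j. ennreal (2 powr ((3 / 2 + \<delta>) * 2 * real j)) *
           bessel_norm_sq s (dilate (2 ^ j) (smooth_mult (\<psi> j) u)))"

definition weighted_space :: "(nat \<Rightarrow> real^3 \<Rightarrow> complex) \<Rightarrow> real \<Rightarrow> real \<Rightarrow> functional set" where
  "weighted_space \<psi> s \<delta> = {u. tempered u \<and> weighted_norm_sq \<psi> s \<delta> u < \<infinity>}"

definition weighted_norm :: "(nat \<Rightarrow> real^3 \<Rightarrow> complex) \<Rightarrow> real \<Rightarrow> real \<Rightarrow> functional \<Rightarrow> real" where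
  "weighted_norm \<psi> s \<delta> u = sqrt (enn2real (weighted_norm_sq \<psi> s \<delta> u))"

end

theory Submission
  imports Defs "HOL-Probability.Probability"
begin

text \<open>
  On a dyadic shell an element \<open>u\<close> of a weighted space is, after rescaling, a distribution whose Fourier
  transform is some \<open>h\<^sub>j\<close> in weighted \<open>L\<^sup>2\<close>. Truncating \<open>h\<^sub>j\<close> and applying the Plancherel inequality (proved
  with Gaussian weights, without density arguments) gives a function \<open>F\<^sub>j \<in> L\<^sup>2\<close>, and gluing the \<open>F\<^sub>j\<close> with a
  partition of unity built from dilates of \<open>\<psi>\<^sub>0\<close> gives a function representing \<open>u\<close>.

  The rescaled piece \<open>\<psi>\<^sub>j f g\<close> of a product is \<open>\<psi>\<^sub>j f\<close> times the at most ten pieces of \<open>g\<close> from neighbouring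
  shells, each multiplied by one of finitely many fixed test functions. Its Fourier transform is a sum of
  convolutions, and the bound \<open>H^s1 \<cdot> H^s2 \<subseteq> H^s\<close> is the Cauchy-Schwarz inequality together with
  \<open>\<integral> (1 + \<bar>\<xi>\<bar>\<^sup>2)^(s - s1 - s2) d\<xi> < \<infinity>\<close>. Testing \<open>\<psi>\<^sub>j f\<close> directly against band-limited approximations of the
  pieces of \<open>g\<close> makes it unnecessary to know that \<open>F\<^sub>j\<close> and the rescaled \<open>\<psi>\<^sub>j f\<close> agree almost everywhere.
  Since neighbouring shells have comparable weights, the sum over \<open>j\<close> is bounded by the product of the two
  sums.
\<close>

subsection \<open>Calculus of iterated partial derivatives\<close>

text \<open>The norms see only distributions, whereas the product is one of functions. Each factor
  therefore needs a representing function that can be multiplied; square integrability after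
  division by a polynomial suffices, because two such functions have a product that is integrable up
  to a polynomial and hence tempered. The cutoffs \<open>\<psi> j\<close> overlap and do not sum to
  1. A partition of unity that recovers u from its pieces must consist of functions supported where
  \<open>\<psi> l = 1\<close>, since only there does the l-th piece agree with u. Its members are
  dilates of just two profiles. Seen from the scale 2^j, multiplication by one of them is
  convolution with one of finitely many kernels, so uniformity in j is a matter of adding finitely
  many constants. The two factors play different roles: the first keeps its cutoff
  \<open>\<psi> j\<close> and is known only through a weak Fourier identity, which is enough because
  all later statements are tested against Schwartz functions; only the second is split into pieces
  that come with approximations in L^2.\<close>

lemma partial_deriv_eq:
  "(f has_derivative f') (at x) \<Longrightarrow> partial_deriv i f x = f' (axis i 1)"
  unfolding partial_deriv_def by (metis frechet_derivative_at)

lemma iter_deriv_append: "iter_deriv (\<alpha> @ \<beta>) f = iter_deriv \<alpha> (iter_deriv \<beta> f)"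
  by (induction \<alpha>) auto

lemma smooth_differentiable: "smooth f \<Longrightarrow> iter_deriv \<beta> f differentiable (at x)"
  by (auto simp: smooth_def)

lemma smooth_has_derivative:
  "smooth f \<Longrightarrow> (iter_deriv \<beta> f has_derivative frechet_derivative (iter_deriv \<beta> f) (at x)) (at x)"
  using smooth_differentiable frechet_derivative_works by blast

lemma smooth_iter_deriv: "smooth f \<Longrightarrow> smooth (iter_deriv \<beta> f)"
  unfolding smooth_def iter_deriv_append[symmetric] by blast

lemma smooth_partial_deriv: "smooth f \<Longrightarrow> smooth (partial_deriv i f)"
  using smooth_iter_deriv[of f "[i]"] by simp

lemma smooth_continuous: "smooth f \<Longrightarrow> continuous_on A f"
  using smooth_differentiable[of f "[]"]
  by (auto intro!: continuous_at_imp_continuous_on differentiable_imp_continuous_within)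

lemma smooth_measurable [measurable_dest]: "smooth f \<Longrightarrow> f \<in> borel_measurable borel"
  by (intro borel_measurable_continuous_onI smooth_continuous)

lemma iter_deriv_class:
  assumes "P f" "\<And>f i. P f \<Longrightarrow> P (partial_deriv i f)"
  shows "P (iter_deriv \<beta> f)"
  using assms by (induction \<beta>) auto

text \<open>Spares an induction over multi-indices: it suffices to exhibit a family of
  differentiable functions closed under partial derivatives. The families used later are affine
  functions of one coordinate and Fourier transforms of functions with finite moments.\<close>

lemma smooth_class:
  assumes "P f" "\<And>f x. P f \<Longrightarrow> f differentiable (at x)" "\<And>f i. P f \<Longrightarrow> P (partial_deriv i f)"
  shows "smooth f"
  unfolding smooth_def using iter_deriv_class[of P, OF assms(1,3)] assms(2) by blast

lemma has_derivative_sum_list: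
  assumes "\<And>p. p \<in> set ps \<Longrightarrow> (F p has_derivative F' p) (at x)"
  shows "((\<lambda>x. \<Sum>p\<leftarrow>ps. F p x) has_derivative (\<lambda>h. \<Sum>p\<leftarrow>ps. F' p h)) (at x)"
  using assms by (induction ps) (auto intro!: derivative_eq_intros)

text \<open>All ways to distribute the directions of a multi-index over two factors. Listing them
  with repetition keeps the Leibniz rule free of binomial coefficients.\<close>

primrec splits :: "3 list \<Rightarrow> (3 list \<times> 3 list) list" where
  "splits [] = [([], [])]"
| "splits (i # \<beta>) = map (\<lambda>p. (i # fst p, snd p)) (splits \<beta>) @ map (\<lambda>p. (fst p, i # snd p)) (splits \<beta>)"

lemma iter_deriv_mult:
  assumes "smooth f" "smooth g"
  shows "iter_deriv \<beta> (\<lambda>x. f x * g x)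
    = (\<lambda>x. \<Sum>p\<leftarrow>splits \<beta>. iter_deriv (fst p) f x * iter_deriv (snd p) g x)"
proof (induction \<beta>)
  case (Cons i \<beta>)
  define D where "D \<alpha> f x = frechet_derivative (iter_deriv \<alpha> f) (at x)" for \<alpha> x and f :: "real^3 \<Rightarrow> complex"
  have D: "(iter_deriv \<alpha> f has_derivative D \<alpha> f x) (at x)" "(iter_deriv \<alpha> g has_derivative D \<alpha> g x) (at x)" for \<alpha> x
    unfolding D_def using assms smooth_has_derivative by auto
  have "((\<lambda>x. \<Sum>p\<leftarrow>splits \<beta>. iter_deriv (fst p) f x * iter_deriv (snd p) g x) has_derivative
     (\<lambda>h. \<Sum>p\<leftarrow>splits \<beta>. iter_deriv (fst p) f x * D (snd p) g x h + D (fst p) f x h * iter_deriv (snd p) g x)) (at x)" for x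
    by (intro has_derivative_sum_list has_derivative_mult D)
  from partial_deriv_eq[OF this, of i]
  show ?case
    by (simp add: Cons.IH fun_eq_iff o_def sum_list_addf add.commute)
       (simp add: D_def partial_deriv_def)
qed simp

lemma smooth_mult:
  assumes "smooth f" "smooth g"
  shows "smooth (\<lambda>x. f x * g x)"
proof -
  have "iter_deriv \<beta> (\<lambda>x. f x * g x) differentiable (at x)" for \<beta> x
    unfolding iter_deriv_mult[OF assms] differentiable_def
    using has_derivative_sum_list[of "splits \<beta>" "\<lambda>p x. iter_deriv (fst p) f x * iter_deriv (snd p) g x",
        OF has_derivative_mult[OF smooth_has_derivative[OF assms(1)] smooth_has_derivative[OF assms(2)]]]
    by blast
  then show ?thesis
    by (simp add: smooth_def)
qed

lemma iter_deriv_lincomb: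
  assumes "smooth f" "smooth g"
  shows "iter_deriv \<beta> (\<lambda>x. a * f x + b * g x) = (\<lambda>x. a * iter_deriv \<beta> f x + b * iter_deriv \<beta> g x)"
proof (induction \<beta>)
  case (Cons i \<beta>)
  have "((\<lambda>x. a * iter_deriv \<beta> f x + b * iter_deriv \<beta> g x) has_derivative
      (\<lambda>h. a * frechet_derivative (iter_deriv \<beta> f) (at x) h + b * frechet_derivative (iter_deriv \<beta> g) (at x) h)) (at x)" for x
    by (intro has_derivative_add has_derivative_mult_right smooth_has_derivative assms)
  from partial_deriv_eq[OF this, of i] show ?case
    by (simp add: Cons.IH fun_eq_iff) (simp add: partial_deriv_def)
qed simp

lemma smooth_lincomb:
  assumes "smooth f" "smooth g"
  shows "smooth (\<lambda>x. a * f x + b * g x)"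
  unfolding smooth_def iter_deriv_lincomb[OF assms]
  using assms by (auto intro!: differentiable_add differentiable_mult smooth_differentiable)

lemma iter_deriv_dilate:
  assumes "smooth f"
  shows "iter_deriv \<beta> (\<lambda>x. f (r *\<^sub>R x)) = (\<lambda>x. r ^ length \<beta> *\<^sub>R iter_deriv \<beta> f (r *\<^sub>R x))"
proof (induction \<beta>)
  case (Cons i \<beta>)
  let ?D = "\<lambda>x. frechet_derivative (iter_deriv \<beta> f) (at (r *\<^sub>R x))"
  have "((\<lambda>x. r ^ length \<beta> *\<^sub>R iter_deriv \<beta> f (r *\<^sub>R x)) has_derivative
      (\<lambda>h. r ^ length \<beta> *\<^sub>R ?D x (r *\<^sub>R h))) (at x)" for x
    by (intro has_derivative_scaleR_right has_derivative_compose[OF _ smooth_has_derivative[OF assms]])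
       (auto intro!: derivative_eq_intros)
  moreover have "?D x (r *\<^sub>R h) = r *\<^sub>R ?D x h" for x h
    using smooth_has_derivative[OF assms, of \<beta> "r *\<^sub>R x"]
    by (simp add: has_derivative_def bounded_linear.linear linear_scale)
  ultimately have "partial_deriv i (\<lambda>x. r ^ length \<beta> *\<^sub>R iter_deriv \<beta> f (r *\<^sub>R x)) x
      = r ^ length \<beta> *\<^sub>R r *\<^sub>R ?D x (axis i 1)" for x
    by (subst partial_deriv_eq) (auto)
  then show ?case
    by (simp add: Cons.IH fun_eq_iff) (simp add: partial_deriv_def mult.commute)
qed simp

lemma smooth_dilate:
  assumes "smooth f"
  shows "smooth (\<lambda>x. f (r *\<^sub>R x))"
proof -
  have "(\<lambda>x. r ^ length \<beta> *\<^sub>R iter_deriv \<beta> f (r *\<^sub>R x)) differentiable (at x)" for \<beta> x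
    unfolding differentiable_def
    by (rule exI, rule has_derivative_scaleR_right,
        rule has_derivative_compose[OF _ smooth_has_derivative[OF assms]], rule derivative_eq_intros)
       (auto intro!: derivative_eq_intros)
  then show ?thesis
    unfolding smooth_def iter_deriv_dilate[OF assms] by blast
qed

lemma iter_deriv_zero_on_open:
  assumes "open U" "\<And>x. x \<in> U \<Longrightarrow> f x = 0" "x \<in> U"
  shows "iter_deriv \<beta> f x = 0"
  using assms(3)
proof (induction \<beta> arbitrary: x)
  case (Cons i \<beta>)
  have "((\<lambda>_. 0) has_derivative (\<lambda>_. 0)) (at x)" by simp
  then have "(iter_deriv \<beta> f has_derivative (\<lambda>_. 0)) (at x)"
    by (rule has_derivative_transform_within_open[OF _ assms(1) Cons.prems]) (simp add: Cons.IH)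
  from partial_deriv_eq[OF this] show ?case by simp
qed (simp add: assms)


subsection \<open>Schwartz functions\<close>

text \<open>Multipliers of the Schwartz space. The exponent m is the same for all derivatives; m = 0
  means that all derivatives are bounded, and m = 1 serves for the coordinate functions.\<close>

definition moderate :: "nat \<Rightarrow> (real^3 \<Rightarrow> complex) \<Rightarrow> bool" where
  "moderate m f \<longleftrightarrow> smooth f \<and> (\<forall>\<beta>. \<exists>C. \<forall>x. norm (iter_deriv \<beta> f x) \<le> C * (1 + norm x) ^ m)"

lemma schwartz_smooth: "\<phi> \<in> schwartz \<Longrightarrow> smooth \<phi>"
  by (simp add: schwartz_def)

lemma schwartz_measurable [measurable_dest]: "\<phi> \<in> schwartz \<Longrightarrow> \<phi> \<in> borel_measurable borel"
  by (intro smooth_measurable schwartz_smooth)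

lemma schwartz_iff:
  "\<phi> \<in> schwartz \<longleftrightarrow> smooth \<phi> \<and> (\<forall>\<beta> N. \<exists>C. \<forall>x. (1 + norm x) ^ N * norm (iter_deriv \<beta> \<phi> x) \<le> C)"
  unfolding schwartz_def bounded_iff by auto

lemma schwartz_bound:
  assumes "\<phi> \<in> schwartz"
  shows "\<exists>C\<ge>0. \<forall>x. (1 + norm x) ^ N * norm (iter_deriv \<beta> \<phi> x) \<le> C"
proof -
  obtain C where C: "\<forall>x. (1 + norm x) ^ N * norm (iter_deriv \<beta> \<phi> x) \<le> C"
    using assms unfolding schwartz_iff by blast
  have "0 \<le> norm (iter_deriv \<beta> \<phi> 0)"
    by simp
  also have "\<dots> \<le> C"
    using C[rule_format, of 0] by simp
  finally show ?thesis
    using C by blast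
qed

lemma moderate_bound:
  assumes "moderate m f"
  shows "\<exists>C\<ge>0. \<forall>x. norm (iter_deriv \<beta> f x) \<le> C * (1 + norm x) ^ m"
proof -
  obtain C where C: "\<forall>x. norm (iter_deriv \<beta> f x) \<le> C * (1 + norm x) ^ m"
    using assms unfolding moderate_def by blast
  have "0 \<le> norm (iter_deriv \<beta> f 0)"
    by simp
  also have "\<dots> \<le> C"
    using C[rule_format, of 0] by simp
  finally show ?thesis
    using C by blast
qed

lemma schwartz_moderate:
  assumes "\<phi> \<in> schwartz"
  shows "moderate 0 \<phi>"
  unfolding moderate_def
proof (intro conjI allI)
  fix \<beta>
  obtain C where "\<And>x. (1 + norm x) ^ 0 * norm (iter_deriv \<beta> \<phi> x) \<le> C"
    using schwartz_bound[OF assms, of 0 \<beta>] by blast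
  then show "\<exists>C. \<forall>x. norm (iter_deriv \<beta> \<phi> x) \<le> C * (1 + norm x) ^ 0"
    by auto
qed (simp add: assms schwartz_smooth)

text \<open>Estimates a Leibniz sum term by term. The domain of x is left arbitrary, so that a pair
  of an index n and a point can be inserted for x; this yields bounds uniform in n.\<close>

lemma sum_list_norm_bound:
  assumes "\<And>p. p \<in> set ps \<Longrightarrow> \<exists>C. \<forall>x. a x * norm (F p x) \<le> C" "\<And>x. (0::real) \<le> a x"
  shows "\<exists>C. \<forall>x. a x * norm (\<Sum>p\<leftarrow>ps. F p x) \<le> C"
  using assms(1)
proof (induction ps)
  case (Cons p ps)
  then obtain C1 C2 where "\<forall>x. a x * norm (F p x) \<le> C1" "\<forall>x. a x * norm (\<Sum>p\<leftarrow>ps. F p x) \<le> C2"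
    by (metis list.set_intros)
  moreover have "a x * norm (\<Sum>p\<leftarrow>p # ps. F p x) \<le> a x * norm (F p x) + a x * norm (\<Sum>p\<leftarrow>ps. F p x)" for x
    using mult_left_mono[OF norm_triangle_ineq assms(2)[of x], of "F p x" "\<Sum>p\<leftarrow>ps. F p x"]
    by (simp add: distrib_left)
  ultimately have "a x * norm (\<Sum>p\<leftarrow>p # ps. F p x) \<le> C1 + C2" for x
    by (meson add_mono order_trans)
  then show ?case by blast
qed auto

lemma schwartz_mult:
  assumes "moderate m f" "\<phi> \<in> schwartz"
  shows "(\<lambda>x. f x * \<phi> x) \<in> schwartz"
  unfolding schwartz_iff
proof (intro conjI allI)
  have sm: "smooth f" "smooth \<phi>"
    using assms by (auto simp: moderate_def schwartz_smooth)
  then show "smooth (\<lambda>x. f x * \<phi> x)"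
    by (rule smooth_mult)
  fix \<beta> N
  show "\<exists>C. \<forall>x. (1 + norm x) ^ N * norm (iter_deriv \<beta> (\<lambda>x. f x * \<phi> x) x) \<le> C"
    unfolding iter_deriv_mult[OF sm]
  proof (rule sum_list_norm_bound)
    fix p :: "3 list \<times> 3 list"
    obtain C1 where C1: "0 \<le> C1" "\<And>x. norm (iter_deriv (fst p) f x) \<le> C1 * (1 + norm x) ^ m"
      using moderate_bound[OF assms(1), of "fst p"] by blast
    obtain C2 where C2: "0 \<le> C2" "\<And>x. (1 + norm x) ^ (N + m) * norm (iter_deriv (snd p) \<phi> x) \<le> C2"
      using schwartz_bound[OF assms(2), of "N + m" "snd p"] by blast
    have "(1 + norm x) ^ N * norm (iter_deriv (fst p) f x * iter_deriv (snd p) \<phi> x) \<le> C1 * C2" for x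
    proof -
      have "(1 + norm x) ^ N * norm (iter_deriv (fst p) f x * iter_deriv (snd p) \<phi> x)
        \<le> (1 + norm x) ^ N * ((C1 * (1 + norm x) ^ m) * norm (iter_deriv (snd p) \<phi> x))"
        unfolding norm_mult by (intro mult_left_mono mult_right_mono C1) auto
      also have "\<dots> = C1 * ((1 + norm x) ^ (N + m) * norm (iter_deriv (snd p) \<phi> x))"
        by (simp add: power_add mult_ac)
      also have "\<dots> \<le> C1 * C2"
        by (intro mult_left_mono C1 C2)
      finally show ?thesis .
    qed
    then show "\<exists>C. \<forall>x. (1 + norm x) ^ N * norm (iter_deriv (fst p) f x * iter_deriv (snd p) \<phi> x) \<le> C"
      by blast
  qed simp
qed

lemma schwartz_lincomb:
  assumes "\<phi> \<in> schwartz" "\<eta> \<in> schwartz"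
  shows "(\<lambda>x. a * \<phi> x + b * \<eta> x) \<in> schwartz"
  unfolding schwartz_iff
proof (intro conjI allI)
  have sm: "smooth \<phi>" "smooth \<eta>"
    using assms by (auto simp: schwartz_smooth)
  then show "smooth (\<lambda>x. a * \<phi> x + b * \<eta> x)"
    by (rule smooth_lincomb)
  fix \<beta> N
  obtain C1 C2 where C: "\<And>x. (1 + norm x) ^ N * norm (iter_deriv \<beta> \<phi> x) \<le> C1"
    "\<And>x. (1 + norm x) ^ N * norm (iter_deriv \<beta> \<eta> x) \<le> C2"
    using schwartz_bound[OF assms(1), of N \<beta>] schwartz_bound[OF assms(2), of N \<beta>] by blast
  have "(1 + norm x) ^ N * norm (iter_deriv \<beta> (\<lambda>x. a * \<phi> x + b * \<eta> x) x) \<le> norm a * C1 + norm b * C2" for x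
  proof -
    have "(1 + norm x) ^ N * norm (iter_deriv \<beta> (\<lambda>x. a * \<phi> x + b * \<eta> x) x)
      \<le> (1 + norm x) ^ N * (norm a * norm (iter_deriv \<beta> \<phi> x) + norm b * norm (iter_deriv \<beta> \<eta> x))"
      unfolding iter_deriv_lincomb[OF sm]
      by (intro mult_left_mono order_trans[OF norm_triangle_ineq]) (auto simp: norm_mult)
    also have "\<dots> = norm a * ((1 + norm x) ^ N * norm (iter_deriv \<beta> \<phi> x))
        + norm b * ((1 + norm x) ^ N * norm (iter_deriv \<beta> \<eta> x))"
      by (simp add: algebra_simps)
    also have "\<dots> \<le> norm a * C1 + norm b * C2"
      by (intro add_mono mult_left_mono C) auto
    finally show ?thesis .
  qed
  then show "\<exists>C. \<forall>x. (1 + norm x) ^ N * norm (iter_deriv \<beta> (\<lambda>x. a * \<phi> x + b * \<eta> x) x) \<le> C"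
    by blast
qed

lemma schwartz_cmult: "\<phi> \<in> schwartz \<Longrightarrow> (\<lambda>x. a * \<phi> x) \<in> schwartz"
  using schwartz_lincomb[of \<phi> \<phi> a 0] by simp

lemma schwartz_diff: "\<phi> \<in> schwartz \<Longrightarrow> \<eta> \<in> schwartz \<Longrightarrow> (\<lambda>x. \<phi> x - \<eta> x) \<in> schwartz"
  using schwartz_lincomb[of \<phi> \<eta> 1 "-1"] by simp

lemma schwartz_partial_deriv: "\<phi> \<in> schwartz \<Longrightarrow> partial_deriv i \<phi> \<in> schwartz"
  unfolding schwartz_iff using iter_deriv_append[of _ "[i]" \<phi>]
  by (auto simp: smooth_partial_deriv intro: smooth_partial_deriv) metis

lemma schwartz_dilate:
  assumes "\<phi> \<in> schwartz" "r \<noteq> 0"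
  shows "(\<lambda>x. \<phi> (r *\<^sub>R x)) \<in> schwartz"
  unfolding schwartz_iff
proof (intro conjI allI)
  have sm: "smooth \<phi>"
    using assms by (auto simp: schwartz_smooth)
  then show "smooth (\<lambda>x. \<phi> (r *\<^sub>R x))"
    by (rule smooth_dilate)
  fix \<beta> N
  obtain C where C: "\<And>x. (1 + norm x) ^ N * norm (iter_deriv \<beta> \<phi> x) \<le> C"
    using schwartz_bound[OF assms(1), of N \<beta>] by blast
  define q where "q = 1 + 1 / \<bar>r\<bar>"
  have "(1 + norm x) ^ N * norm (iter_deriv \<beta> (\<lambda>x. \<phi> (r *\<^sub>R x)) x) \<le> q ^ N * \<bar>r\<bar> ^ length \<beta> * C" for x
  proof -
    have "1 + norm x \<le> q * (1 + norm (r *\<^sub>R x))"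
      using assms(2) by (simp add: q_def field_simps)
    then have "(1 + norm x) ^ N \<le> q ^ N * (1 + norm (r *\<^sub>R x)) ^ N"
      by (metis power_mono power_mult_distrib add_nonneg_nonneg norm_ge_zero zero_le_one)
    then have "(1 + norm x) ^ N * norm (iter_deriv \<beta> (\<lambda>x. \<phi> (r *\<^sub>R x)) x)
      \<le> (q ^ N * (1 + norm (r *\<^sub>R x)) ^ N) * (\<bar>r\<bar> ^ length \<beta> * norm (iter_deriv \<beta> \<phi> (r *\<^sub>R x)))"
      unfolding iter_deriv_dilate[OF sm] by (simp add: mult_right_mono power_abs)
    also have "\<dots> = q ^ N * \<bar>r\<bar> ^ length \<beta> * ((1 + norm (r *\<^sub>R x)) ^ N * norm (iter_deriv \<beta> \<phi> (r *\<^sub>R x)))"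
      by (simp add: mult_ac)
    also have "\<dots> \<le> q ^ N * \<bar>r\<bar> ^ length \<beta> * C"
      by (intro mult_left_mono C) (auto simp: q_def)
    finally show ?thesis .
  qed
  then show "\<exists>C. \<forall>x. (1 + norm x) ^ N * norm (iter_deriv \<beta> (\<lambda>x. \<phi> (r *\<^sub>R x)) x) \<le> C"
    by blast
qed

lemma schwartz_reflect: "\<phi> \<in> schwartz \<Longrightarrow> (\<lambda>x. \<phi> (- x)) \<in> schwartz"
  using schwartz_dilate[of \<phi> "-1"] by simp

lemma moderate_dilate:
  assumes "moderate 0 f"
  shows "moderate 0 (\<lambda>x. f (r *\<^sub>R x))"
  unfolding moderate_def
proof (intro conjI allI)
  have sm: "smooth f"
    using assms by (auto simp: moderate_def)
  then show "smooth (\<lambda>x. f (r *\<^sub>R x))"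
    by (rule smooth_dilate)
  fix \<beta>
  obtain C where C: "\<And>x. norm (iter_deriv \<beta> f x) \<le> C * (1 + norm x) ^ 0"
    using moderate_bound[OF assms, of \<beta>] by blast
  have "norm (iter_deriv \<beta> (\<lambda>x. f (r *\<^sub>R x)) x) \<le> \<bar>r\<bar> ^ length \<beta> * C * (1 + norm x) ^ 0" for x
    unfolding iter_deriv_dilate[OF sm] using C[of "r *\<^sub>R x"] by (simp add: power_abs mult_left_mono)
  then show "\<exists>C. \<forall>x. norm (iter_deriv \<beta> (\<lambda>x. f (r *\<^sub>R x)) x) \<le> C * (1 + norm x) ^ 0"
    by blast
qed

lemma schwartz_compact_support:
  assumes "moderate 0 f" "\<And>x. R < norm x \<Longrightarrow> f x = 0"
  shows "f \<in> schwartz"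
  unfolding schwartz_iff
proof (intro conjI allI)
  show "smooth f" using assms by (simp add: moderate_def)
  fix \<beta> N
  obtain C where C: "0 \<le> C" "\<And>x. norm (iter_deriv \<beta> f x) \<le> C * (1 + norm x) ^ 0"
    using moderate_bound[OF assms(1), of \<beta>] by blast
  have "open {x::real^3. R < norm x}"
    by (intro open_Collect_less) (auto intro: continuous_intros)
  then have z: "R < norm x \<Longrightarrow> iter_deriv \<beta> f x = 0" for x
    using iter_deriv_zero_on_open assms(2) by blast
  have "(1 + norm x) ^ N * norm (iter_deriv \<beta> f x) \<le> (1 + \<bar>R\<bar>) ^ N * C" for x
  proof (cases "R < norm x")
    case False
    then show ?thesis
      using C by (intro mult_mono power_mono) auto
  qed (use C(1) in \<open>simp add: z\<close>)
  then show "\<exists>C. \<forall>x. (1 + norm x) ^ N * norm (iter_deriv \<beta> f x) \<le> C"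
    by blast
qed

lemma moderate_coordinate: "moderate 1 (\<lambda>x. of_real (x $ i))"
proof -
  \<comment> \<open>With both coefficients bounded by 1 the class is closed under partial
    derivatives and admits the common bound \<open>1 + norm x\<close>.\<close>
  define P where "P f \<longleftrightarrow> (\<exists>a b. f = (\<lambda>x::real^3. complex_of_real (a * (x $ i) + b)) \<and> \<bar>a\<bar> \<le> 1 \<and> \<bar>b\<bar> \<le> 1)" for f
  have d: "((\<lambda>x::real^3. complex_of_real (a * (x $ i) + b)) has_derivative (\<lambda>h. complex_of_real (a * (h $ i)))) (at x)" for a b x
    by (auto intro!: derivative_eq_intros bounded_linear_imp_has_derivative bounded_linear_vec_nth)
  have P1: "P (partial_deriv j f)" if "P f" for f j
  proof -
    from that obtain a b where ab: "f = (\<lambda>x::real^3. complex_of_real (a * (x $ i) + b))" "\<bar>a\<bar> \<le> 1" "\<bar>b\<bar> \<le> 1"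
      unfolding P_def by blast
    have "partial_deriv j f = (\<lambda>x. complex_of_real (0 * (x $ i) + a * (axis j 1 $ i)))"
      using partial_deriv_eq[OF d, of j a b] by (simp add: ab(1) fun_eq_iff)
    then show ?thesis
      unfolding P_def using ab(2) by (intro exI[of _ 0] exI[of _ "a * (axis j 1 $ i)"]) (auto simp: axis_def)
  qed
  have P2: "f differentiable (at x)" if "P f" for f x
    using that d unfolding P_def differentiable_def by blast
  have P0: "P (\<lambda>x. of_real (x $ i))"
    unfolding P_def by (intro exI[of _ 1] exI[of _ 0]) auto
  have "norm (f x) \<le> 1 * (1 + norm x) ^ 1" if "P f" for f x
  proof -
    from that obtain a b where ab: "f = (\<lambda>x::real^3. complex_of_real (a * (x $ i) + b))" "\<bar>a\<bar> \<le> 1" "\<bar>b\<bar> \<le> 1"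
      unfolding P_def by blast
    have "\<bar>a * (x $ i)\<bar> \<le> 1 * norm x"
      unfolding abs_mult by (intro mult_mono ab component_le_norm_cart) auto
    then show ?thesis using ab by (simp add: ab(1) del: of_real_add of_real_mult)
  qed
  then have "norm (iter_deriv \<beta> (\<lambda>x. of_real (x $ i)) x) \<le> 1 * (1 + norm x) ^ 1" for \<beta> x
    using iter_deriv_class[of P, OF P0 P1] by blast
  then show ?thesis
    unfolding moderate_def using smooth_class[of P, OF P0 P2 P1] by blast
qed

section \<open>Schwartz norms and truncation of test functions\<close>

lemma schwartz_norm_le:
  assumes "\<And>\<beta> x. length \<beta> \<le> N \<Longrightarrow> (1 + norm x) ^ N * norm (iter_deriv \<beta> \<phi> x) \<le> B"
  shows "schwartz_norm N \<phi> \<le> B"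
  unfolding schwartz_norm_def
proof (rule cSUP_least)
  show "{\<beta> :: 3 list. length \<beta> \<le> N} \<times> (UNIV :: (real^3) set) \<noteq> {}"
    by (auto intro: exI[of _ "[]"])
qed (auto intro!: assms)

lemma finite_multi_indices: "finite {\<beta> :: 3 list. length \<beta> \<le> N}"
  using finite_lists_length_le[of "UNIV :: 3 set" N] by simp

text \<open>A real supremum dominates its members only if the family is bounded above. This holds
  because there are finitely many multi-indices of length at most N, each with its own bound in
  x.\<close>

lemma schwartz_norm_ge:
  assumes "\<phi> \<in> schwartz"
  shows "(1 + norm x) ^ N * norm (\<phi> x) \<le> schwartz_norm N \<phi>"
proof -
  have "\<exists>C. \<forall>x. (1 + norm x) ^ N * norm (iter_deriv \<beta> \<phi> x) \<le> C" for \<beta>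
    using assms by (auto simp: schwartz_iff)
  then obtain C where C: "\<And>\<beta> x. (1 + norm x) ^ N * norm (iter_deriv \<beta> \<phi> x) \<le> C \<beta>"
    by metis
  have "C \<beta> \<le> Max (C ` {\<beta> :: 3 list. length \<beta> \<le> N})" if "length \<beta> \<le> N" for \<beta>
    using that finite_multi_indices by (intro Max_ge) auto
  then have "bdd_above ((\<lambda>(\<beta>, x). (1 + norm x) ^ N * norm (iter_deriv \<beta> \<phi> x)) ` ({\<beta>. length \<beta> \<le> N} \<times> UNIV))"
    using C by (intro bdd_aboveI[of _ "Max (C ` {\<beta> :: 3 list. length \<beta> \<le> N})"]) (auto intro: order_trans)
  from cSUP_upper[OF _ this, of "([], x)"] show ?thesis
    by (simp add: schwartz_norm_def)
qed

text \<open>The factor \<open>1 - f (x / 2 ^ n)\<close> and all its derivatives are of size (1 +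
  |x|) / 2^n: the function itself because it vanishes for |x| <= 2^n and is bounded elsewhere, its
  derivatives because each differentiation brings out a factor 2^-n. The extra power of 1 + |x| is
  paid for by the decay of \<phi>, and the norm is of order 2^-n.\<close>

lemma schwartz_norm_truncation:
  assumes "moderate 0 f" "\<And>x. norm x \<le> 1 \<Longrightarrow> f x = 1" "\<phi> \<in> schwartz"
  shows "(\<lambda>n. schwartz_norm N (\<lambda>x. \<phi> x - f ((1 / 2 ^ n) *\<^sub>R x) * \<phi> x)) \<longlonglongrightarrow> 0"
proof -
  have smf: "smooth f" and sm\<phi>: "smooth \<phi>"
    using assms by (auto simp: moderate_def schwartz_smooth)
  define g where "g = (\<lambda>n x. 1 - f ((1 / 2 ^ n) *\<^sub>R x))"
  have one: "iter_deriv \<beta> (\<lambda>_. 1) = (\<lambda>_. if \<beta> = [] then 1 else 0)" for \<beta>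
    by (induction \<beta>) (auto simp: partial_deriv_def)
  have sm1: "smooth (\<lambda>_. 1)"
    unfolding smooth_def one by simp
  have g_eq: "g n = (\<lambda>x. 1 * 1 + (-1) * f ((1 / 2 ^ n) *\<^sub>R x))" for n
    by (simp add: g_def)
  have smg: "smooth (g n)" for n
    unfolding g_eq by (intro smooth_lincomb sm1 smooth_dilate smf)
  have bound_g: "\<exists>C\<ge>0. \<forall>n x. norm (iter_deriv \<alpha> (g n) x) \<le> C * (1 + norm x) / 2 ^ n" for \<alpha>
  proof (cases "\<alpha> = []")
    case True
    obtain C where C: "0 \<le> C" "\<And>x. norm (iter_deriv [] f x) \<le> C * (1 + norm x) ^ 0"
      using moderate_bound[OF assms(1), of "[]"] by blast
    have "norm (g n x) \<le> (1 + C) * (1 + norm x) / 2 ^ n" for n x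
    proof (cases "norm x \<le> 2 ^ n")
      case True
      then show ?thesis using assms(2)[of "(1 / 2 ^ n) *\<^sub>R x"] C(1)
        by (simp add: g_def divide_simps)
    next
      case False
      have "norm (g n x) \<le> 1 + C"
        using C(2)[of "(1 / 2 ^ n) *\<^sub>R x"] norm_triangle_ineq4[of 1 "f ((1 / 2 ^ n) *\<^sub>R x)"] by (simp add: g_def)
      also have "\<dots> \<le> (1 + C) * ((1 + norm x) / 2 ^ n)"
        using False C(1) mult_left_mono[of 1 "(1 + norm x) / 2 ^ n" "1 + C"] by (simp add: field_simps)
      finally show ?thesis by simp
    qed
    then show ?thesis using C(1) True by (intro exI[of _ "1 + C"]) auto
  next
    case False
    obtain C where C: "0 \<le> C" "\<And>x. norm (iter_deriv \<alpha> f x) \<le> C * (1 + norm x) ^ 0"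
      using moderate_bound[OF assms(1), of \<alpha>] by blast
    have "norm (iter_deriv \<alpha> (g n) x) \<le> C * (1 + norm x) / 2 ^ n" for n x
    proof -
      have "iter_deriv \<alpha> (g n) x = - ((1 / 2 ^ n) ^ length \<alpha> *\<^sub>R iter_deriv \<alpha> f ((1 / 2 ^ n) *\<^sub>R x))"
        unfolding g_eq iter_deriv_lincomb[OF sm1 smooth_dilate[OF smf]] one iter_deriv_dilate[OF smf]
        using False by simp
      then have "norm (iter_deriv \<alpha> (g n) x) = (1 / 2 ^ n) ^ length \<alpha> * norm (iter_deriv \<alpha> f ((1 / 2 ^ n) *\<^sub>R x))"
        by simp
      also have "\<dots> \<le> (1 / 2 ^ n) ^ 1 * C"
        using C(2)[of "(1 / 2 ^ n) *\<^sub>R x"] False C(1)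
        by (intro mult_mono power_decreasing) (auto simp: Suc_le_eq)
      also have "\<dots> \<le> C * (1 + norm x) / 2 ^ n"
        using C(1) by (simp add: field_simps)
      finally show ?thesis .
    qed
    then show ?thesis using C(1) by blast
  qed
  have "\<exists>C. \<forall>n x. (1 + norm x) ^ N * norm (iter_deriv \<beta> (\<lambda>x. g n x * \<phi> x) x) \<le> C / 2 ^ n" for \<beta>
  proof -
    have "\<exists>C. \<forall>nx. (2 ^ fst nx * (1 + norm (snd nx)) ^ N)
       * norm (\<Sum>p\<leftarrow>splits \<beta>. iter_deriv (fst p) (g (fst nx)) (snd nx) * iter_deriv (snd p) \<phi> (snd nx)) \<le> C"
    proof (rule sum_list_norm_bound)
      fix p :: "3 list \<times> 3 list"
      obtain C1 where C1: "0 \<le> C1" "\<And>n x. norm (iter_deriv (fst p) (g n) x) \<le> C1 * (1 + norm x) / 2 ^ n"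
        using bound_g by blast
      obtain C2 where C2: "0 \<le> C2" "\<And>x. (1 + norm x) ^ (N + 1) * norm (iter_deriv (snd p) \<phi> x) \<le> C2"
        using schwartz_bound[OF assms(3), of "N + 1" "snd p"] by blast
      have "(2 ^ n * (1 + norm x) ^ N) * norm (iter_deriv (fst p) (g n) x * iter_deriv (snd p) \<phi> x) \<le> C1 * C2" for n x
      proof -
        have "(2 ^ n * (1 + norm x) ^ N) * norm (iter_deriv (fst p) (g n) x * iter_deriv (snd p) \<phi> x)
          \<le> (2 ^ n * (1 + norm x) ^ N) * ((C1 * (1 + norm x) / 2 ^ n) * norm (iter_deriv (snd p) \<phi> x))"
          unfolding norm_mult by (intro mult_left_mono mult_right_mono C1) auto
        also have "\<dots> = C1 * ((1 + norm x) ^ (N + 1) * norm (iter_deriv (snd p) \<phi> x))"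
          by simp
        also have "\<dots> \<le> C1 * C2"
          by (intro mult_left_mono C1 C2)
        finally show ?thesis .
      qed
      then show "\<exists>C. \<forall>nx. (2 ^ fst nx * (1 + norm (snd nx)) ^ N)
         * norm (iter_deriv (fst p) (g (fst nx)) (snd nx) * iter_deriv (snd p) \<phi> (snd nx)) \<le> C"
        by blast
    qed simp
    then show ?thesis
      unfolding iter_deriv_mult[OF smg sm\<phi>] by (fastforce simp: field_simps)
  qed
  then obtain C where C: "\<And>\<beta> n x. (1 + norm x) ^ N * norm (iter_deriv \<beta> (\<lambda>x. g n x * \<phi> x) x) \<le> C \<beta> / 2 ^ n"
    by metis
  define B where "B = Max (C ` {\<beta> :: 3 list. length \<beta> \<le> N})"
  have "C \<beta> \<le> B" if "length \<beta> \<le> N" for \<beta>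
    unfolding B_def using that finite_multi_indices by (intro Max_ge) auto
  then have "schwartz_norm N (\<lambda>x. g n x * \<phi> x) \<le> B / 2 ^ n" for n
    using C by (intro schwartz_norm_le) (meson divide_right_mono order_trans zero_le_numeral zero_le_power)
  moreover have "0 \<le> schwartz_norm N (\<lambda>x. g n x * \<phi> x)" for n
  proof -
    have "(\<lambda>x. g n x * \<phi> x) \<in> schwartz"
      using schwartz_diff[OF assms(3) schwartz_mult[OF moderate_dilate[OF assms(1)] assms(3)]]
      by (simp add: g_def algebra_simps)
    from schwartz_norm_ge[OF this, of 0 N] show ?thesis
      by (rule order_trans[rotated]) simp
  qed
  moreover have "(\<lambda>n. B / 2 ^ n) \<longlonglongrightarrow> 0"
    by (rule LIMSEQ_divide_realpow_zero) simp
  ultimately have "(\<lambda>n. schwartz_norm N (\<lambda>x. g n x * \<phi> x)) \<longlonglongrightarrow> 0"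
    using tendsto_sandwich[of "\<lambda>_. 0" "\<lambda>n. schwartz_norm N (\<lambda>x. g n x * \<phi> x)" sequentially "\<lambda>n. B / 2 ^ n" 0]
    by simp
  then show ?thesis
    by (simp add: g_def algebra_simps)
qed


subsection \<open>Change of variables and weights\<close>

lemma nn_integral_lborel_affine:
  fixes f :: "'a::euclidean_space \<Rightarrow> ennreal"
  assumes [measurable]: "f \<in> borel_measurable borel" and "c \<noteq> 0"
  shows "(\<integral>\<^sup>+x. f x \<partial>lborel) = ennreal (\<bar>c\<bar> ^ DIM('a)) * (\<integral>\<^sup>+x. f (t + c *\<^sub>R x) \<partial>lborel)"
  by (subst lborel_affine[OF assms(2), of t])
     (simp add: nn_integral_density nn_integral_distr nn_integral_cmult)

lemma integrable_lborel_affine_iff: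
  fixes f :: "'a::euclidean_space \<Rightarrow> 'b::{banach, second_countable_topology}"
  assumes [measurable]: "f \<in> borel_measurable borel" and "c \<noteq> 0"
  shows "integrable lborel (\<lambda>x. f (t + c *\<^sub>R x)) \<longleftrightarrow> integrable lborel f"
proof -
  have "integrable lborel f \<longleftrightarrow> integrable (density (distr lborel borel (\<lambda>x. t + c *\<^sub>R x)) (\<lambda>_. ennreal (\<bar>c\<bar> ^ DIM('a)))) f"
    using lborel_affine[OF assms(2), of t] by simp
  also have "\<dots> \<longleftrightarrow> integrable lborel (\<lambda>x. \<bar>c\<bar> ^ DIM('a) *\<^sub>R f (t + c *\<^sub>R x))"
    by (subst integrable_density) (auto simp: integrable_distr_eq)
  also have "\<dots> \<longleftrightarrow> integrable lborel (\<lambda>x. f (t + c *\<^sub>R x))"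
    using assms(2) integrable_scaleR_right[of "inverse (\<bar>c\<bar> ^ DIM('a))" lborel "\<lambda>x. \<bar>c\<bar> ^ DIM('a) *\<^sub>R f (t + c *\<^sub>R x)"]
    by (auto intro: integrable_scaleR_right)
  finally show ?thesis by simp
qed

lemma integral_lborel_affine:
  fixes f :: "'a::euclidean_space \<Rightarrow> 'b::{banach, second_countable_topology}"
  assumes [measurable]: "f \<in> borel_measurable borel" and "c \<noteq> 0"
  shows "(\<integral>x. f x \<partial>lborel) = \<bar>c\<bar> ^ DIM('a) *\<^sub>R (\<integral>x. f (t + c *\<^sub>R x) \<partial>lborel)"
  by (subst lborel_affine[OF assms(2), of t])
     (simp add: integral_density integral_distr)

lemma nn_integral_lborel_translate:
  fixes f :: "'a::euclidean_space \<Rightarrow> ennreal"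
  assumes "f \<in> borel_measurable borel"
  shows "(\<integral>\<^sup>+x. f (t + x) \<partial>lborel) = (\<integral>\<^sup>+x. f x \<partial>lborel)" "(\<integral>\<^sup>+x. f (x + t) \<partial>lborel) = (\<integral>\<^sup>+x. f x \<partial>lborel)"
  using nn_integral_lborel_affine[OF assms, of 1 t] by (simp_all add: add.commute)

lemma nn_integral_lborel_reflect:
  fixes f :: "'a::euclidean_space \<Rightarrow> ennreal"
  assumes "f \<in> borel_measurable borel"
  shows "(\<integral>\<^sup>+x. f (t - x) \<partial>lborel) = (\<integral>\<^sup>+x. f x \<partial>lborel)"
  using nn_integral_lborel_affine[OF assms, of "-1" t] by simp

section \<open>Polynomial weights and their integrability\<close>

definition weight :: "real \<Rightarrow> real^3 \<Rightarrow> real" where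
  "weight s x = (1 + (norm x)\<^sup>2) powr s"

lemma weight_base_pos: "0 < 1 + (norm (x :: real^3))\<^sup>2"
  by (simp add: add_pos_nonneg)

lemma weight_pos: "0 < weight s x"
  using weight_base_pos[of x] by (simp add: weight_def)

lemma weight_nonneg [simp]: "0 \<le> weight s x"
  by (simp add: weight_def)

lemma weight_ge_1: "0 \<le> s \<Longrightarrow> 1 \<le> weight s x"
  by (simp add: weight_def ge_one_powr_ge_zero)

lemma weight_measurable [measurable]: "weight s \<in> borel_measurable borel"
  unfolding weight_def by measurable

lemma weight_add: "weight (s + t) x = weight s x * weight t x"
  by (simp add: weight_def powr_add)

lemma weight_minus: "weight (- s) x = inverse (weight s x)"
  by (simp add: weight_def powr_minus)

text \<open>Peetre's inequality. In a convolution it distributes the weight at the output frequency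
  over the two input frequencies, with x and y the arguments of the two factors.\<close>

lemma weight_Peetre:
  assumes "0 \<le> s"
  shows "weight s (x + y) \<le> 2 powr s * weight s x * weight s y"
proof -
  have "(norm (x + y))\<^sup>2 \<le> (norm x + norm y)\<^sup>2"
    by (intro power_mono norm_triangle_ineq) auto
  also have "\<dots> \<le> 2 * (norm x)\<^sup>2 + 2 * (norm y)\<^sup>2"
    using sum_squares_bound[of "norm x" "norm y"] by (simp add: power2_sum)
  finally have "(norm (x + y))\<^sup>2 \<le> 2 * (norm x)\<^sup>2 + 2 * (norm y)\<^sup>2" .
  then have "1 + (norm (x + y))\<^sup>2 \<le> 2 * (1 + (norm x)\<^sup>2) * (1 + (norm y)\<^sup>2)"
  proof -
    have "0 \<le> (norm x)\<^sup>2 * (norm y)\<^sup>2" by simp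
    moreover have "2 * (1 + (norm x)\<^sup>2) * (1 + (norm y)\<^sup>2)
        = 2 + 2 * (norm x)\<^sup>2 + 2 * (norm y)\<^sup>2 + 2 * ((norm x)\<^sup>2 * (norm y)\<^sup>2)"
      by (simp add: algebra_simps)
    ultimately show ?thesis
      using \<open>(norm (x + y))\<^sup>2 \<le> 2 * (norm x)\<^sup>2 + 2 * (norm y)\<^sup>2\<close> by linarith
  qed
  then have "weight s (x + y) \<le> (2 * (1 + (norm x)\<^sup>2) * (1 + (norm y)\<^sup>2)) powr s"
    unfolding weight_def using assms by (intro powr_mono2) auto
  also have "\<dots> = (2 * (1 + (norm x)\<^sup>2)) powr s * (1 + (norm y)\<^sup>2) powr s"
    by (rule powr_mult)
  also have "(2 * (1 + (norm x)\<^sup>2)) powr s = 2 powr s * (1 + (norm x)\<^sup>2) powr s"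
    by (rule powr_mult)
  finally show ?thesis
    by (simp only: weight_def)
qed

lemma ennreal_le_suminf: "f j \<le> (\<Sum>j. f j)" for f :: "nat \<Rightarrow> ennreal"
  using sum_le_suminf[of f "{j}"] by simp

text \<open>Comparison with a geometric series. If j is least with |x| < 2^j, then 2^j is at most 2
  sqrt(1 + |x|^2), so the weight at x is at most a constant times 2^(-2tj), while the ball of radius
  2^j has volume of order 2^(3j). The ratio \<open>q = 2 powr (3 - 2 * t)\<close> is below 1 because
  t > 3/2.\<close>

lemma nn_integral_weight_finite:
  assumes "3 / 2 < t"
  shows "(\<integral>\<^sup>+x. ennreal (weight (- t) x) \<partial>lborel) < \<infinity>"
proof -
  define q where "q = 2 powr (3 - 2 * t)"
  define V where "V = unit_ball_vol 3"
  have V0: "0 \<le> V" by (simp add: V_def)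
  have q: "0 \<le> q" "q < 1"
    using assms by (auto simp: q_def powr_less_one)
  have shell: "\<exists>j. norm x < 2 ^ j \<and> weight (- t) x \<le> 4 powr t * (2 powr (- 2 * t)) ^ j" for x :: "real^3"
  proof -
    define j where "j = (LEAST j::nat. norm x < 2 ^ j)"
    have ex: "\<exists>j::nat. norm x < 2 ^ j"
      using real_arch_pow[of 2 "norm x"] by simp
    then have j: "norm x < 2 ^ j"
      unfolding j_def by (rule LeastI_ex)
    have "2 ^ j \<le> 2 * sqrt (1 + (norm x)\<^sup>2)"
    proof (cases j)
      case 0
      then show ?thesis
        using real_sqrt_ge_1_iff[of "1 + (norm x)\<^sup>2"] by (smt (verit) power_0 zero_le_power2)
    next
      case (Suc i)
      then have "\<not> norm x < 2 ^ i"
        using not_less_Least[of i "\<lambda>j. norm x < 2 ^ j"] by (simp add: j_def)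
      moreover have "norm x \<le> sqrt (1 + (norm x)\<^sup>2)"
        by (intro real_le_rsqrt) simp
      ultimately show ?thesis
        by (simp add: Suc)
    qed
    then have "(2 ^ j)\<^sup>2 \<le> (2 * sqrt (1 + (norm x)\<^sup>2))\<^sup>2"
      by (intro power_mono) auto
    then have "(2 ^ j)\<^sup>2 \<le> 4 * (1 + (norm x)\<^sup>2)"
      using weight_base_pos[of x] by (simp add: power_mult_distrib)
    then have "(4 * (1 + (norm x)\<^sup>2)) powr (- t) \<le> ((2 ^ j)\<^sup>2) powr (- t)"
      using assms by (intro powr_mono2') auto
    also have "((2 ^ j)\<^sup>2) powr (- t) = (2 powr (- 2 * t)) ^ j"
    proof -
      have "((2::real) ^ j)\<^sup>2 = 2 powr real (2 * j)"
        by (subst powr_realpow) (simp_all add: power_even_eq)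
      then have "((2::real) ^ j)\<^sup>2 powr (- t) = 2 powr ((- 2 * t) * real j)"
        by (simp add: powr_powr mult_ac)
      also have "\<dots> = (2 powr (- 2 * t)) ^ j"
        by (subst powr_powr[symmetric]) (simp add: powr_realpow)
      finally show ?thesis .
    qed
    finally have "4 powr (- t) * weight (- t) x \<le> (2 powr (- 2 * t)) ^ j"
      by (simp only: weight_def powr_mult)
    then have "weight (- t) x \<le> 4 powr t * (2 powr (- 2 * t)) ^ j"
      by (simp add: powr_minus field_simps)
    with j show ?thesis by blast
  qed
  have "(\<integral>\<^sup>+x. ennreal (weight (- t) x) \<partial>lborel)
     \<le> (\<integral>\<^sup>+x. (\<Sum>j. ennreal (4 powr t * (2 powr (- 2 * t)) ^ j) * indicator (ball (0 :: real^3) (2 ^ j)) x) \<partial>lborel)"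
  proof (rule nn_integral_mono)
    fix x :: "real^3"
    obtain j where j: "norm x < 2 ^ j" "weight (- t) x \<le> 4 powr t * (2 powr (- 2 * t)) ^ j"
      using shell by blast
    let ?f = "\<lambda>j. ennreal (4 powr t * (2 powr (- 2 * t)) ^ j) * indicator (ball (0 :: real^3) (2 ^ j)) x"
    have "ennreal (weight (- t) x) \<le> ?f j"
      using j by (simp add: ennreal_leI)
    also have "\<dots> \<le> (\<Sum>j. ?f j)"
      by (rule ennreal_le_suminf)
    finally show "ennreal (weight (- t) x) \<le> (\<Sum>j. ?f j)" .
  qed
  also have "\<dots> = (\<Sum>j. ennreal (4 powr t * (2 powr (- 2 * t)) ^ j) * emeasure lborel (ball (0 :: real^3) (2 ^ j)))"
  proof -
    have *: "(\<integral>\<^sup>+x. (\<Sum>j. c j * indicator (B j) x) \<partial>lborel) = (\<Sum>j. c j * emeasure lborel (B j))"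
      if "\<And>j. B j \<in> sets borel" for c :: "nat \<Rightarrow> ennreal" and B :: "nat \<Rightarrow> (real^3) set"
      using that by (simp add: nn_integral_suminf nn_integral_cmult_indicator)
    show ?thesis
      by (rule *, rule borel_open, rule open_ball)
  qed
  also have "\<dots> = (\<Sum>j. ennreal (4 powr t * V * q ^ j))"
  proof (rule arg_cong[where f = suminf], rule ext)
    fix j
    have "((2::real) ^ j) ^ 3 = (2 ^ 3) ^ j"
      by (metis power_mult mult.commute)
    then have "(2 powr (- 2 * t)) ^ j * (2 ^ j) ^ 3 = (2 powr (- 2 * t) * 2 ^ 3) ^ j"
      by (simp only: power_mult_distrib)
    also have "2 powr (- 2 * t) * 2 ^ 3 = q"
      by (simp add: q_def powr_diff powr_minus divide_inverse)
    finally have "4 powr t * (2 powr (- 2 * t)) ^ j * (V * (2 ^ j) ^ 3) = 4 powr t * V * q ^ j"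
      by (metis mult.assoc mult.commute)
    moreover have "emeasure lborel (ball (0 :: real^3) (2 ^ j)) = ennreal (V * (2 ^ j) ^ 3)"
      by (subst emeasure_ball) (simp_all add: V_def)
    ultimately show "ennreal (4 powr t * (2 powr (- 2 * t)) ^ j) * emeasure lborel (ball (0 :: real^3) (2 ^ j)) = ennreal (4 powr t * V * q ^ j)"
      using V0 by (simp only: ennreal_mult[symmetric] mult_nonneg_nonneg powr_ge_zero zero_le_power zero_le_numeral)
  qed
  also have "\<dots> < \<infinity>"
  proof -
    have "(\<lambda>j. 4 powr t * V * q ^ j) sums (4 powr t * V * (1 / (1 - q)))"
      using q by (intro sums_mult geometric_sums) simp
    then have "(\<Sum>j. ennreal (4 powr t * V * q ^ j)) = ennreal (4 powr t * V * (1 / (1 - q)))"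
      using q V0 by (intro suminf_ennreal_eq) simp_all
    then show ?thesis by simp
  qed
  finally show ?thesis .
qed

lemma integrable_weight: "3 / 2 < t \<Longrightarrow> integrable lborel (weight (- t))"
  using nn_integral_weight_finite[of t] by (intro integrableI_nonneg) auto


subsection \<open>Functions with finite moments\<close>

text \<open>The decay that makes a Fourier transform smooth with bounded derivatives. It asks for no
  regularity of k, so it covers Schwartz functions as well as truncations of square integrable
  functions to balls.\<close>

definition moments :: "(real^3 \<Rightarrow> complex) \<Rightarrow> bool" where
  "moments k \<longleftrightarrow> k \<in> borel_measurable borel \<and> (\<forall>N. integrable lborel (\<lambda>x. (1 + norm x) ^ N * norm (k x)))"

lemma moments_measurable [measurable_dest]: "moments k \<Longrightarrow> k \<in> borel_measurable borel"
  by (simp add: moments_def)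

lemma schwartz_moments:
  assumes "\<phi> \<in> schwartz"
  shows "moments \<phi>"
  unfolding moments_def
proof (intro conjI allI)
  show [measurable]: "\<phi> \<in> borel_measurable borel"
    using assms by (rule schwartz_measurable)
  fix N
  \<comment> \<open>Four additional powers of \<open>1 + norm x\<close> dominate
    \<open>weight 2\<close>, and \<open>weight (- 2)\<close> is integrable because 2 > 3/2.\<close>
  obtain C where C: "0 \<le> C" "\<And>x. (1 + norm x) ^ (N + 4) * norm (iter_deriv [] \<phi> x) \<le> C"
    using schwartz_bound[OF assms, of "N + 4" "[]"] by blast
  show "integrable lborel (\<lambda>x. (1 + norm x) ^ N * norm (\<phi> x))"
  proof (rule Bochner_Integration.integrable_bound[OF integrable_mult_right[OF integrable_weight[of 2]]])
    have "(1 + norm x) ^ N * norm (\<phi> x) \<le> C * weight (- 2) x" for x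
    proof -
      have "weight 2 x = (1 + (norm x)\<^sup>2)\<^sup>2"
        using weight_base_pos[of x] by (simp add: weight_def)
      also have "\<dots> \<le> ((1 + norm x)\<^sup>2)\<^sup>2"
        by (intro power_mono) (auto simp: power2_sum)
      finally have "weight 2 x \<le> (1 + norm x) ^ 4" by simp
      then have "(1 + norm x) ^ N * norm (\<phi> x) * weight 2 x \<le> (1 + norm x) ^ N * norm (\<phi> x) * (1 + norm x) ^ 4"
        by (intro mult_left_mono) auto
      also have "\<dots> \<le> C"
        using C(2)[of x] by (simp add: power_add mult_ac)
      finally show ?thesis
        using weight_pos[of 2 x] by (simp add: weight_minus field_simps)
    qed
    then show "AE x in lborel. norm ((1 + norm x) ^ N * norm (\<phi> x)) \<le> norm (C * weight (- 2) x)"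
      using C(1) by (intro always_eventually) simp
  qed auto
qed

lemma moments_integrable: "moments k \<Longrightarrow> integrable lborel k"
  unfolding moments_def by (rule integrable_norm_cancel, drule conjunct2, drule spec[of _ 0]) auto

lemma moments_mult:
  assumes "moments k" "g \<in> borel_measurable borel" "\<And>x. norm (g x) \<le> (1 + norm x) ^ m"
  shows "moments (\<lambda>x. g x * k x)"
  unfolding moments_def
proof (intro conjI allI)
  note [measurable] = assms(2) moments_measurable[OF assms(1)]
  show "(\<lambda>x. g x * k x) \<in> borel_measurable borel" by measurable
  fix N
  have "integrable lborel (\<lambda>x. (1 + norm x) ^ (N + m) * norm (k x))"
    using assms(1) by (simp add: moments_def)
  then show "integrable lborel (\<lambda>x. (1 + norm x) ^ N * norm (g x * k x))"
  proof (rule Bochner_Integration.integrable_bound)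
    show "AE x in lborel. norm ((1 + norm x) ^ N * norm (g x * k x)) \<le> norm ((1 + norm x) ^ (N + m) * norm (k x))"
      using assms(3) by (intro always_eventually allI)
        (simp add: norm_mult power_add mult_left_mono mult_right_mono flip: mult.assoc)
  qed measurable
qed


subsection \<open>The Fourier transform on Schwartz functions\<close>

definition fourier_const :: real where
  "fourier_const = (2 * pi) powr (- 3 / 2)"

lemma fourier_const_pos: "0 < fourier_const"
  by (simp add: fourier_const_def)

lemma fourier_alt: "fourier \<phi> \<xi> = fourier_const * (\<integral>x. cis (- (x \<bullet> \<xi>)) * \<phi> x \<partial>lborel)"
  by (simp add: fourier_def fourier_const_def)

lemma cis_measurable [measurable]: "cis \<in> borel_measurable borel"
  by (intro borel_measurable_continuous_onI continuous_intros)

lemma integrable_cis_mult: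
  fixes k :: "real^3 \<Rightarrow> complex"
  assumes "integrable lborel k" "\<theta> \<in> borel_measurable borel"
  shows "integrable lborel (\<lambda>x. cis (\<theta> x) * k x)"
proof (rule Bochner_Integration.integrable_bound[OF assms(1)])
  note [measurable] = borel_measurable_integrable[OF assms(1)] assms(2)
  show "(\<lambda>x. cis (\<theta> x) * k x) \<in> borel_measurable lborel" by simp
qed (simp add: norm_mult)

lemma norm_fourier_le:
  assumes "integrable lborel k"
  shows "norm (fourier k \<xi>) \<le> fourier_const * (\<integral>x. norm (k x) \<partial>lborel)"
proof -
  have "norm (\<integral>x. cis (- (x \<bullet> \<xi>)) * k x \<partial>lborel) \<le> (\<integral>x. norm (cis (- (x \<bullet> \<xi>)) * k x) \<partial>lborel)"
    by (rule integral_norm_bound)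
  then show ?thesis
    using fourier_const_pos by (simp add: fourier_alt norm_mult)
qed

lemma cis_remainder: "norm (cis t - 1 - \<i> * t) \<le> t\<^sup>2"
proof -
  have "norm (cis t - 1 - \<i> * t) \<le> \<bar>t\<bar> ^ Suc 1 / fact (Suc 1)"
    using iexp_approx1[of t 1] by (simp add: cis_conv_exp algebra_simps)
  also have "\<dots> \<le> t\<^sup>2" by (simp add: power2_eq_square)
  finally show ?thesis .
qed

text \<open>The remainder estimate |e^(it) - 1 - it| <= t^2 with t = -x.h, integrated against |k|,
  gives an error at most a multiple of |h|^2 times the second moment M. This proves
  differentiability at once, without a separate exchange of limit and integral.\<close>

lemma fourier_differentiable:
  assumes "moments k"
  shows "(fourier k has_derivative (\<lambda>h. \<Sum>i\<in>UNIV. of_real (h $ i) * fourier (\<lambda>x. (- \<i> * of_real (x $ i)) * k x) \<xi>)) (at \<xi>)"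
proof -
  note [measurable] = moments_measurable[OF assms]
  have mi: "moments (\<lambda>x. (- \<i> * of_real (x $ i)) * k x)" for i
  proof (rule moments_mult[OF assms, of _ 1])
    show "norm (- \<i> * complex_of_real (x $ i)) \<le> (1 + norm x) ^ 1" for x
      using component_le_norm_cart[of x i] by (simp add: norm_mult)
  qed measurable
  have int1: "integrable lborel (\<lambda>x. cis (- (x \<bullet> \<xi>)) * k x)" for \<xi>
    by (intro integrable_cis_mult moments_integrable assms) measurable
  have int2: "integrable lborel (\<lambda>x. cis (- (x \<bullet> \<xi>)) * ((- \<i> * of_real (x $ i)) * k x))" for i
    by (intro integrable_cis_mult moments_integrable mi) measurable
  let ?D = "\<lambda>h. \<Sum>i\<in>UNIV. of_real (h $ i) * fourier (\<lambda>x. (- \<i> * of_real (x $ i)) * k x) \<xi>"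
  define M where "M = (\<integral>x. (1 + norm x) ^ 2 * norm (k x) \<partial>lborel)"
  have Mi: "integrable lborel (\<lambda>x. (1 + norm x) ^ 2 * norm (k x))"
    using assms by (simp add: moments_def)
  have bound: "norm ((fourier k y - fourier k \<xi>) - ?D (y - \<xi>)) \<le> fourier_const * M * (norm (y - \<xi>))\<^sup>2" for y
  proof -
    define h where "h = y - \<xi>"
    let ?R = "\<lambda>x. cis (- (x \<bullet> y)) * k x - cis (- (x \<bullet> \<xi>)) * k x
       - (\<Sum>i\<in>UNIV. of_real (h $ i) * (cis (- (x \<bullet> \<xi>)) * ((- \<i> * of_real (x $ i)) * k x)))"
    have Dh: "?D h = fourier_const * (\<integral>x. (\<Sum>i\<in>UNIV. of_real (h $ i) * (cis (- (x \<bullet> \<xi>)) * ((- \<i> * of_real (x $ i)) * k x))) \<partial>lborel)"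
      unfolding fourier_alt
      by (subst Bochner_Integration.integral_sum, intro integrable_mult_right int2)
         (simp only: integral_mult_right_zero sum_distrib_left mult.left_commute)
    have Ri: "integrable lborel ?R"
      by (intro Bochner_Integration.integrable_diff Bochner_Integration.integrable_sum integrable_mult_right int1 int2)
    have "(fourier k y - fourier k \<xi>) - ?D h = fourier_const * (\<integral>x. ?R x \<partial>lborel)"
      unfolding Dh unfolding fourier_alt
      by (subst Bochner_Integration.integral_diff, intro Bochner_Integration.integrable_diff int1,
          intro Bochner_Integration.integrable_sum integrable_mult_right int2,
          subst Bochner_Integration.integral_diff, rule int1, rule int1) (simp add: right_diff_distrib)
    moreover have "norm (\<integral>x. ?R x \<partial>lborel) \<le> (\<integral>x. (norm h)\<^sup>2 * ((1 + norm x) ^ 2 * norm (k x)) \<partial>lborel)"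
    proof (rule order_trans[OF integral_norm_bound], intro integral_mono)
      fix x
      have *: "(\<Sum>i\<in>UNIV. h $ i * x $ i) = x \<bullet> h"
        by (simp add: inner_vec_def mult.commute)
      have "(\<Sum>i\<in>UNIV. of_real (h $ i) * (cis (- (x \<bullet> \<xi>)) * ((- \<i> * of_real (x $ i)) * k x)))
          = cis (- (x \<bullet> \<xi>)) * (\<i> * of_real (- (x \<bullet> h))) * k x"
        unfolding *[symmetric] of_real_minus of_real_sum sum_negf[symmetric] sum_distrib_left sum_distrib_right
        by (intro sum.cong) (auto simp: mult_ac)
      moreover have "cis (- (x \<bullet> y)) = cis (- (x \<bullet> \<xi>)) * cis (- (x \<bullet> h))"
        by (simp add: cis_mult h_def inner_diff_right)
      ultimately have "?R x = cis (- (x \<bullet> \<xi>)) * (cis (- (x \<bullet> h)) - 1 - \<i> * of_real (- (x \<bullet> h))) * k x"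
        by (simp add: algebra_simps)
      then have "norm (?R x) = norm (cis (- (x \<bullet> h)) - 1 - \<i> * of_real (- (x \<bullet> h))) * norm (k x)"
        by (simp add: norm_mult)
      also have "\<dots> \<le> (- (x \<bullet> h))\<^sup>2 * norm (k x)"
        by (intro mult_right_mono cis_remainder) auto
      also have "\<dots> \<le> ((1 + norm x) * norm h)\<^sup>2 * norm (k x)"
      proof (intro mult_right_mono power2_le_iff_abs_le[THEN iffD2])
        have "\<bar>- (x \<bullet> h)\<bar> \<le> norm x * norm h"
          using Cauchy_Schwarz_ineq2[of x h] by simp
        also have "\<dots> \<le> (1 + norm x) * norm h"
          by (intro mult_right_mono) auto
        finally show "\<bar>- (x \<bullet> h)\<bar> \<le> (1 + norm x) * norm h" .
      qed auto
      finally show "norm (?R x) \<le> (norm h)\<^sup>2 * ((1 + norm x) ^ 2 * norm (k x))"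
        by (simp add: power_mult_distrib mult_ac)
    qed (use Ri Mi in auto)
    ultimately have "norm ((fourier k y - fourier k \<xi>) - ?D h) \<le> fourier_const * (\<integral>x. (norm h)\<^sup>2 * ((1 + norm x) ^ 2 * norm (k x)) \<partial>lborel)"
      using fourier_const_pos by (simp only: norm_mult norm_of_real abs_of_pos mult_left_mono)
    then show ?thesis
      unfolding integral_mult_right_zero M_def h_def by (simp only: mult.assoc mult.commute mult.left_commute)
  qed
  show ?thesis
  proof (rule has_derivativeI_sandwich[where e = 1 and H = "\<lambda>y. fourier_const * M * norm (y - \<xi>)"])
    show "bounded_linear ?D"
      by (intro bounded_linear_sum bounded_linear_compose[OF bounded_linear_mult_left]
          bounded_linear_compose[OF bounded_linear_of_real bounded_linear_vec_nth])
    show "norm ((fourier k y - fourier k \<xi>) - ?D (y - \<xi>)) / norm (y - \<xi>) \<le> fourier_const * M * norm (y - \<xi>)"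
      if "y \<noteq> \<xi>" for y
      using bound[of y] that by (simp add: divide_le_eq power2_eq_square mult_ac)
    show "((\<lambda>y. fourier_const * M * norm (y - \<xi>)) \<longlongrightarrow> 0) (at \<xi>)"
      by (auto intro!: tendsto_eq_intros)
  qed simp
qed

lemma partial_deriv_fourier:
  assumes "moments k"
  shows "partial_deriv i (fourier k) = fourier (\<lambda>x. (- \<i> * of_real (x $ i)) * k x)"
proof
  fix \<xi>
  show "partial_deriv i (fourier k) \<xi> = fourier (\<lambda>x. (- \<i> * of_real (x $ i)) * k x) \<xi>"
    using partial_deriv_eq[OF fourier_differentiable[OF assms, of \<xi>], of i]
    by (simp add: axis_def if_distrib[of "\<lambda>x. complex_of_real x * _"] cong: if_cong)
qed

text \<open>Differentiating the transform multiplies k by a coordinate, which preserves finite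
  moments; hence every derivative is again such a transform and is bounded by an L^1 norm.\<close>

lemma fourier_moderate:
  assumes "moments k"
  shows "moderate 0 (fourier k)"
proof -
  define P where "P f \<longleftrightarrow> (\<exists>k. moments k \<and> f = fourier k)" for f
  have P0: "P (fourier k)" unfolding P_def using assms by (intro exI[of _ k]) simp
  have P1: "P (partial_deriv i f)" if Pf: "P f" for f i
  proof -
    obtain k where k: "moments k" "f = fourier k" using Pf unfolding P_def by (elim exE conjE)
    have "moments (\<lambda>x. (- \<i> * of_real (x $ i)) * k x)"
    proof (rule moments_mult[OF k(1), of _ 1])
      show "norm (- \<i> * complex_of_real (x $ i)) \<le> (1 + norm x) ^ 1" for x
        using component_le_norm_cart[of x i] by (simp add: norm_mult)
    qed measurable
    then show ?thesis
      unfolding P_def k(2) partial_deriv_fourier[OF k(1)] by (intro exI conjI) (assumption, rule refl)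
  qed
  have P2: "f differentiable (at x)" if Pf: "P f" for f x
    using Pf unfolding P_def differentiable_def by (elim exE conjE) (hypsubst, rule exI, erule fourier_differentiable)
  have "\<exists>C. \<forall>x. norm (f x) \<le> C * (1 + norm x) ^ 0" if Pf: "P f" for f
  proof -
    obtain k where k: "moments k" "f = fourier k" using Pf unfolding P_def by (elim exE conjE)
    show ?thesis
      unfolding k(2) using norm_fourier_le[OF moments_integrable[OF k(1)]] by (intro exI allI) simp
  qed
  then show ?thesis
    unfolding moderate_def using smooth_class[of P, OF P0 P2 P1] iter_deriv_class[of P, OF P0 P1] by (intro conjI allI) simp_all
qed

lemma schwartz_mult_coordinate: "\<phi> \<in> schwartz \<Longrightarrow> (\<lambda>x. (a * of_real (x $ i)) * \<phi> x) \<in> schwartz"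
  using schwartz_mult[OF moderate_coordinate schwartz_cmult[of \<phi> a]] by (simp add: mult_ac)

lemma integral_translate_phase:
  fixes \<phi> :: "real^3 \<Rightarrow> complex"
  assumes "\<phi> \<in> borel_measurable borel"
  shows "(\<integral>x. cis (- (x \<bullet> \<xi>)) * \<phi> (x + a) \<partial>lborel) = cis (a \<bullet> \<xi>) * (\<integral>x. cis (- (x \<bullet> \<xi>)) * \<phi> x \<partial>lborel)"
proof -
  note [measurable] = assms
  have "(\<integral>x. cis (- (x \<bullet> \<xi>)) * \<phi> x \<partial>lborel) = (\<integral>x. cis (- ((a + x) \<bullet> \<xi>)) * \<phi> (a + x) \<partial>lborel)"
    using integral_lborel_affine[of "\<lambda>x. cis (- (x \<bullet> \<xi>)) * \<phi> x" 1 a] by simp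
  also have "\<dots> = (\<integral>x. cis (- (a \<bullet> \<xi>)) * (cis (- (x \<bullet> \<xi>)) * \<phi> (x + a)) \<partial>lborel)"
  proof -
    have "cis (- ((a + x) \<bullet> \<xi>)) = cis (- (a \<bullet> \<xi>)) * cis (- (x \<bullet> \<xi>))" for x
      by (simp add: inner_add_left cis_mult)
    then show ?thesis by (simp add: mult.assoc add.commute)
  qed
  finally have "(\<integral>x. cis (- (x \<bullet> \<xi>)) * \<phi> x \<partial>lborel)
      = cis (- (a \<bullet> \<xi>)) * (\<integral>x. cis (- (x \<bullet> \<xi>)) * \<phi> (x + a) \<partial>lborel)"
    by simp
  then show ?thesis
    by (simp add: cis_mult flip: mult.assoc)
qed


text \<open>Takes the place of an integration by parts. By translation invariance, the transform of
  the difference quotient of \<phi> in direction i with step t is (e^(it \<xi>_i) - 1) / t times the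
  transform of \<phi>. As t tends to 0 the left side converges by dominated convergence and the
  scalar factor tends to i \<xi>_i.\<close>

lemma fourier_partial_deriv:
  assumes "\<phi> \<in> schwartz"
  shows "fourier (partial_deriv i \<phi>) \<xi> = \<i> * of_real (\<xi> $ i) * fourier \<phi> \<xi>"
proof -
  have meas [measurable]: "\<phi> \<in> borel_measurable borel" "partial_deriv i \<phi> \<in> borel_measurable borel"
    using assms by (auto intro: schwartz_measurable schwartz_partial_deriv)
  obtain C where C: "0 \<le> C" "\<And>x. (1 + norm x) ^ 4 * norm (iter_deriv [i] \<phi> x) \<le> C"
    using schwartz_bound[OF assms, of 4 "[i]"] by blast
  define t where "t n = 1 / real (Suc n)" for n
  have t: "0 < t n" "t n \<le> 1" for n by (auto simp: t_def)
  have t0: "t \<longlonglongrightarrow> 0" unfolding t_def by real_asymp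
  have tn0: "t n \<noteq> 0" for n
    using t(1)[of n] by simp
  have t_at: "filterlim t (at 0) sequentially"
    by (simp add: filterlim_at t0 tn0)
  define e :: "real^3" where "e = axis i 1"
  define Q where "Q n x = (\<phi> (x + t n *\<^sub>R e) - \<phi> x) / of_real (t n)" for n x
  have deriv: "((\<lambda>s. \<phi> (x + s *\<^sub>R e)) has_vector_derivative partial_deriv i \<phi> (x + s *\<^sub>R e)) (at s)" for x s
  proof -
    let ?D = "frechet_derivative \<phi> (at (x + s *\<^sub>R e))"
    have D: "(\<phi> has_derivative ?D) (at (x + s *\<^sub>R e))"
      using smooth_has_derivative[OF schwartz_smooth[OF assms], of "[]"] by simp
    have "((\<lambda>s. \<phi> (x + s *\<^sub>R e)) has_derivative (\<lambda>h. ?D (h *\<^sub>R e))) (at s)"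
      by (rule has_derivative_compose[where f = "\<lambda>s. x + s *\<^sub>R e" and g = \<phi>, OF _ D]) (auto intro!: derivative_eq_intros)
    moreover have "?D (h *\<^sub>R e) = h *\<^sub>R ?D e" for h
      using D by (simp add: has_derivative_def bounded_linear.linear linear_scale)
    ultimately show ?thesis
      by (simp add: has_vector_derivative_def partial_deriv_def e_def)
  qed
  have lim: "(\<lambda>n. Q n x) \<longlonglongrightarrow> partial_deriv i \<phi> x" for x
  proof -
    have "((\<lambda>s. (\<phi> (x + s *\<^sub>R e) - \<phi> x) /\<^sub>R s) \<longlongrightarrow> partial_deriv i \<phi> x) (at 0)"
    proof (rule LIM_zero_cancel, rule tendsto_norm_zero_cancel)
      have "((\<lambda>s. norm ((1 / norm (s - 0)) *\<^sub>R (\<phi> (x + s *\<^sub>R e) - (\<phi> (x + 0 *\<^sub>R e) + (s - 0) *\<^sub>R partial_deriv i \<phi> (x + 0 *\<^sub>R e)))))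
          \<longlongrightarrow> 0) (at 0)"
        using deriv[of x 0] unfolding has_vector_derivative_def has_derivative_within
        by (intro tendsto_norm_zero) blast
      then show "((\<lambda>s. norm ((\<phi> (x + s *\<^sub>R e) - \<phi> x) /\<^sub>R s - partial_deriv i \<phi> x)) \<longlongrightarrow> 0) (at 0)"
      proof (rule Lim_transform_eventually)
        have "norm ((1 / norm (s - 0)) *\<^sub>R (\<phi> (x + s *\<^sub>R e) - (\<phi> (x + 0 *\<^sub>R e) + (s - 0) *\<^sub>R partial_deriv i \<phi> (x + 0 *\<^sub>R e))))
          = norm ((\<phi> (x + s *\<^sub>R e) - \<phi> x) /\<^sub>R s - partial_deriv i \<phi> x)" if "s \<noteq> 0" for s
        proof -
          have "(\<phi> (x + s *\<^sub>R e) - \<phi> x) /\<^sub>R s - partial_deriv i \<phi> x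
            = inverse s *\<^sub>R (\<phi> (x + s *\<^sub>R e) - (\<phi> x + s *\<^sub>R partial_deriv i \<phi> x))"
            using that by (simp add: scaleR_diff_right scaleR_add_right)
          then show ?thesis
            by (simp add: divide_inverse)
        qed
        then show "\<forall>\<^sub>F s in at 0. norm ((1 / norm (s - 0)) *\<^sub>R (\<phi> (x + s *\<^sub>R e) - (\<phi> (x + 0 *\<^sub>R e) + (s - 0) *\<^sub>R partial_deriv i \<phi> (x + 0 *\<^sub>R e))))
          = norm ((\<phi> (x + s *\<^sub>R e) - \<phi> x) /\<^sub>R s - partial_deriv i \<phi> x)"
          by (auto simp: eventually_at_filter)
      qed
    qed
    then have "(\<lambda>n. (\<phi> (x + t n *\<^sub>R e) - \<phi> x) /\<^sub>R t n) \<longlonglongrightarrow> partial_deriv i \<phi> x"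
      by (rule filterlim_compose[OF _ t_at])
    then show ?thesis
      by (simp add: Q_def scaleR_conv_of_real divide_inverse mult.commute)
  qed
  \<comment> \<open>The majorant comes from the mean value inequality on a segment of length
    \<open>t n \<le> 1\<close>. Moving by at most 1 changes \<open>1 + norm x\<close> by a factor of
    at most 2, and the fourth power gives 16.\<close>
  have bd: "norm (Q n x) \<le> 16 * C * weight (- 2) x" for n x
  proof -
    have "norm (\<phi> (x + t n *\<^sub>R e) - \<phi> (x + 0 *\<^sub>R e)) \<le> (16 * C * weight (- 2) x) * norm (t n - 0)"
    proof (rule differentiable_bound[where S = "{0..t n}" and f' = "\<lambda>s h. h *\<^sub>R partial_deriv i \<phi> (x + s *\<^sub>R e)"])
      fix s assume s: "s \<in> {0..t n}"
      show "((\<lambda>s. \<phi> (x + s *\<^sub>R e)) has_derivative (\<lambda>h. h *\<^sub>R partial_deriv i \<phi> (x + s *\<^sub>R e))) (at s within {0..t n})"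
        using deriv[of x s] unfolding has_vector_derivative_def by (rule has_derivative_at_withinI)
      have "norm x \<le> norm (x + s *\<^sub>R e) + norm (s *\<^sub>R e)"
        using norm_triangle_ineq4[of "x + s *\<^sub>R e" "s *\<^sub>R e"] by simp
      also have "\<dots> \<le> norm (x + s *\<^sub>R e) + 1"
        using s t(2)[of n] by (simp add: e_def)
      finally have "norm x \<le> norm (x + s *\<^sub>R e) + 1" .
      then have "1 + norm x \<le> 2 * (1 + norm (x + s *\<^sub>R e))"
      proof -
        have *: "1 + a \<le> 2 * (1 + b)" if "a \<le> b + 1" "0 \<le> b" for a b :: real
          using that by simp
        show ?thesis
          using \<open>norm x \<le> norm (x + s *\<^sub>R e) + 1\<close> by (rule *) (rule norm_ge_zero)
      qed
      then have le: "(1 + norm x) ^ 4 \<le> (2 * (1 + norm (x + s *\<^sub>R e))) ^ 4"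
        by (intro power_mono) auto
      have "weight 2 x = (1 + (norm x)\<^sup>2)\<^sup>2"
        using weight_base_pos[of x] by (simp add: weight_def)
      also have "\<dots> \<le> ((1 + norm x)\<^sup>2)\<^sup>2"
        by (intro power_mono) (auto simp: power2_sum)
      also have "((1 + norm x)\<^sup>2)\<^sup>2 = (1 + norm x) ^ 4"
        by simp
      also note le
      also have "(2 * (1 + norm (x + s *\<^sub>R e))) ^ 4 = 16 * (1 + norm (x + s *\<^sub>R e)) ^ 4"
        unfolding power_mult_distrib by simp
      finally have "weight 2 x \<le> 16 * (1 + norm (x + s *\<^sub>R e)) ^ 4" .
      then have "weight 2 x * norm (partial_deriv i \<phi> (x + s *\<^sub>R e))
          \<le> 16 * (1 + norm (x + s *\<^sub>R e)) ^ 4 * norm (partial_deriv i \<phi> (x + s *\<^sub>R e))"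
        by (intro mult_right_mono) auto
      also have "\<dots> \<le> 16 * C"
        using C(2)[of "x + s *\<^sub>R e"] by simp
      finally have "norm (partial_deriv i \<phi> (x + s *\<^sub>R e)) \<le> 16 * C * weight (- 2) x"
        using weight_pos[of 2 x] by (simp add: weight_minus field_simps)
      then show "onorm (\<lambda>h. h *\<^sub>R partial_deriv i \<phi> (x + s *\<^sub>R e)) \<le> 16 * C * weight (- 2) x"
        by (intro onorm_bound) (auto simp: C mult.commute mult_left_mono)
    qed (use t(1)[of n] in auto)
    then show ?thesis
      using t(1)[of n] by (simp add: Q_def norm_divide field_simps)
  qed
  have L1: "(\<lambda>n. \<integral>x. cis (- (x \<bullet> \<xi>)) * Q n x \<partial>lborel) \<longlonglongrightarrow> (\<integral>x. cis (- (x \<bullet> \<xi>)) * partial_deriv i \<phi> x \<partial>lborel)"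
  proof (rule integral_dominated_convergence[where w = "\<lambda>x. 16 * C * weight (- 2) x"])
    show "integrable lborel (\<lambda>x. 16 * C * weight (- 2) x)"
      by (intro integrable_mult_right integrable_weight) simp
    show "AE x in lborel. (\<lambda>n. cis (- (x \<bullet> \<xi>)) * Q n x) \<longlonglongrightarrow> cis (- (x \<bullet> \<xi>)) * partial_deriv i \<phi> x"
      by (intro always_eventually allI tendsto_mult_left lim)
    show "AE x in lborel. norm (cis (- (x \<bullet> \<xi>)) * Q n x) \<le> 16 * C * weight (- 2) x" for n
      using bd by (simp add: norm_mult)
  qed (auto simp: Q_def)
  have E: "(\<integral>x. cis (- (x \<bullet> \<xi>)) * Q n x \<partial>lborel)
      = ((cis (t n * (\<xi> $ i)) - 1) / of_real (t n)) * (\<integral>x. cis (- (x \<bullet> \<xi>)) * \<phi> x \<partial>lborel)" for n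
  proof -
    have i1: "integrable lborel (\<lambda>x. cis (- (x \<bullet> \<xi>)) * \<phi> x)"
      using assms by (intro integrable_cis_mult moments_integrable schwartz_moments) auto
    have "integrable lborel (\<lambda>x. \<phi> (t n *\<^sub>R e + 1 *\<^sub>R x))"
      using assms by (subst integrable_lborel_affine_iff) (auto intro: moments_integrable schwartz_moments)
    then have i2: "integrable lborel (\<lambda>x. cis (- (x \<bullet> \<xi>)) * \<phi> (x + t n *\<^sub>R e))"
      by (intro integrable_cis_mult) (auto simp: add.commute)
    have "(\<integral>x. cis (- (x \<bullet> \<xi>)) * Q n x \<partial>lborel)
      = (\<integral>x. (cis (- (x \<bullet> \<xi>)) * \<phi> (x + t n *\<^sub>R e) - cis (- (x \<bullet> \<xi>)) * \<phi> x) / of_real (t n) \<partial>lborel)"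
      by (simp add: Q_def right_diff_distrib)
    also have "\<dots> = ((\<integral>x. cis (- (x \<bullet> \<xi>)) * \<phi> (x + t n *\<^sub>R e) \<partial>lborel) - (\<integral>x. cis (- (x \<bullet> \<xi>)) * \<phi> x \<partial>lborel)) / of_real (t n)"
      using i1 i2 by simp
    also have "\<dots> = ((cis (t n * (\<xi> $ i)) - 1) / of_real (t n)) * (\<integral>x. cis (- (x \<bullet> \<xi>)) * \<phi> x \<partial>lborel)"
      by (simp add: integral_translate_phase e_def inner_axis' algebra_simps)
    finally show ?thesis .
  qed
  have L2: "(\<lambda>n. (cis (t n * (\<xi> $ i)) - 1) / of_real (t n)) \<longlonglongrightarrow> \<i> * of_real (\<xi> $ i)"
  proof (rule LIM_zero_cancel, rule Lim_null_comparison[where g = "\<lambda>n. t n * (\<xi> $ i)\<^sup>2"])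
    have "norm ((cis (t n * (\<xi> $ i)) - 1) / of_real (t n) - \<i> * of_real (\<xi> $ i)) \<le> t n * (\<xi> $ i)\<^sup>2" for n
    proof -
      have "(cis (t n * (\<xi> $ i)) - 1) / of_real (t n) - \<i> * of_real (\<xi> $ i)
        = (cis (t n * (\<xi> $ i)) - 1 - \<i> * of_real (t n * (\<xi> $ i))) / of_real (t n)"
        using t(1)[of n] by (simp add: field_simps)
      then have "norm ((cis (t n * (\<xi> $ i)) - 1) / of_real (t n) - \<i> * of_real (\<xi> $ i)) \<le> (t n * (\<xi> $ i))\<^sup>2 / t n"
        using cis_remainder[of "t n * (\<xi> $ i)"] t(1)[of n] by (simp add: norm_divide divide_right_mono)
      then show ?thesis
        using t(1)[of n] by (simp add: power2_eq_square mult_ac)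
    qed
    then show "\<forall>\<^sub>F n in sequentially. norm ((cis (t n * (\<xi> $ i)) - 1) / of_real (t n) - \<i> * of_real (\<xi> $ i)) \<le> t n * (\<xi> $ i)\<^sup>2"
      by simp
    show "(\<lambda>n. t n * (\<xi> $ i)\<^sup>2) \<longlonglongrightarrow> 0"
      using tendsto_mult_right[OF t0, of "(\<xi> $ i)\<^sup>2"] by simp
  qed
  have "(\<integral>x. cis (- (x \<bullet> \<xi>)) * partial_deriv i \<phi> x \<partial>lborel)
      = \<i> * of_real (\<xi> $ i) * (\<integral>x. cis (- (x \<bullet> \<xi>)) * \<phi> x \<partial>lborel)"
    by (rule LIMSEQ_unique[OF L1[unfolded E] tendsto_mult_right[OF L2]])
  then show ?thesis
    by (simp add: fourier_alt mult_ac)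
qed

text \<open>Induction on N with \<phi> arbitrary: one factor 1 + |\<xi>| is at most 1 plus the sum
  of the |\<xi>_i|, and each |\<xi>_i| is traded for a derivative of \<phi>, to which the induction
  hypothesis applies.\<close>

lemma fourier_decay:
  assumes "\<phi> \<in> schwartz"
  shows "\<exists>C. \<forall>\<xi>. (1 + norm \<xi>) ^ N * norm (fourier \<phi> \<xi>) \<le> C"
  using assms
proof (induction N arbitrary: \<phi>)
  case 0
  show ?case
    using norm_fourier_le[OF moments_integrable[OF schwartz_moments[OF 0]]] by auto
next
  case (Suc N)
  obtain C0 where C0: "\<And>\<xi>. (1 + norm \<xi>) ^ N * norm (fourier \<phi> \<xi>) \<le> C0"
    using Suc.IH[OF Suc.prems] by blast
  have "\<exists>C. \<forall>\<xi>. (1 + norm \<xi>) ^ N * norm (fourier (partial_deriv i \<phi>) \<xi>) \<le> C" for i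
    by (intro Suc.IH schwartz_partial_deriv Suc.prems)
  then obtain C where C: "\<And>i \<xi>. (1 + norm \<xi>) ^ N * norm (fourier (partial_deriv i \<phi>) \<xi>) \<le> C i"
    by metis
  have "(1 + norm \<xi>) ^ Suc N * norm (fourier \<phi> \<xi>) \<le> C0 + (\<Sum>i\<in>UNIV. C i)" for \<xi>
  proof -
    have "(1 + norm \<xi>) ^ Suc N * norm (fourier \<phi> \<xi>) \<le> (1 + (\<Sum>i\<in>UNIV. \<bar>\<xi> $ i\<bar>)) * ((1 + norm \<xi>) ^ N * norm (fourier \<phi> \<xi>))"
      using norm_le_l1_cart[of \<xi>] by (simp add: mult.assoc mult_right_mono)
    also have "\<dots> = (1 + norm \<xi>) ^ N * norm (fourier \<phi> \<xi>) + (\<Sum>i\<in>UNIV. (1 + norm \<xi>) ^ N * norm (fourier (partial_deriv i \<phi>) \<xi>))"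
      by (simp add: fourier_partial_deriv[OF Suc.prems] norm_mult distrib_right sum_distrib_right) (simp add: mult_ac)
    also have "\<dots> \<le> C0 + (\<Sum>i\<in>UNIV. C i)"
      by (intro add_mono C0 sum_mono C)
    finally show ?thesis .
  qed
  then show ?case by blast
qed

text \<open>Every derivative of the transform is itself the transform of a Schwartz function, so
  decay of the undifferentiated transforms of all Schwartz functions already covers all
  derivatives.\<close>

lemma fourier_schwartz:
  assumes "\<phi> \<in> schwartz"
  shows "fourier \<phi> \<in> schwartz"
proof -
  define P where "P f \<longleftrightarrow> (\<exists>\<phi>\<in>schwartz. f = fourier \<phi>)" for f
  have P0: "P (fourier \<phi>)" unfolding P_def using assms by (rule bexI[rotated]) simp
  have P1: "P (partial_deriv i f)" if Pf: "P f" for f i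
  proof -
    obtain \<phi> where "\<phi> \<in> schwartz" "f = fourier \<phi>" using Pf unfolding P_def by (elim bexE)
    then show ?thesis
      unfolding P_def
      by (intro bexI[OF _ schwartz_mult_coordinate[of _ "- \<i>" i]]) (simp_all add: partial_deriv_fourier schwartz_moments)
  qed
  have "\<exists>C. \<forall>\<xi>. (1 + norm \<xi>) ^ N * norm (f \<xi>) \<le> C" if Pf: "P f" for f N
    using Pf fourier_decay unfolding P_def by (elim bexE) simp
  then show ?thesis
    unfolding schwartz_iff using iter_deriv_class[of P, OF P0 P1] fourier_moderate[OF schwartz_moments[OF assms]]
    by (simp add: moderate_def)
qed


subsection \<open>Gaussians, inversion and the Plancherel inequality\<close>

text \<open>If f is not integrable, its Bochner integral is 0 by convention and the bound is
  trivial.\<close>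

lemma norm_integral_le_nn_integral:
  fixes f :: "'a \<Rightarrow> 'b::{banach, second_countable_topology}"
  shows "ennreal (norm (\<integral>x. f x \<partial>M)) \<le> (\<integral>\<^sup>+x. ennreal (norm (f x)) \<partial>M)"
  by (cases "integrable M f") (auto intro: integral_norm_bound_ennreal simp: not_integrable_integral_eq)

lemma integrable_lborel_pair:
  fixes f :: "'a::euclidean_space \<Rightarrow> 'b::euclidean_space \<Rightarrow> 'c::{banach, second_countable_topology}"
  assumes "(\<lambda>(x, y). f x y) \<in> borel_measurable (borel \<Otimes>\<^sub>M borel)"
    and "(\<integral>\<^sup>+x. \<integral>\<^sup>+y. ennreal (norm (f x y)) \<partial>lborel \<partial>lborel) < \<infinity>"
  shows "integrable (lborel \<Otimes>\<^sub>M lborel) (\<lambda>(x, y). f x y)"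
proof (rule integrableI_bounded)
  have m: "(\<lambda>(x, y). f x y) \<in> borel_measurable (lborel \<Otimes>\<^sub>M lborel)"
    using assms(1) by (simp cong: measurable_cong_sets sets_pair_measure_cong)
  then show "(\<lambda>(x, y). f x y) \<in> borel_measurable (lborel \<Otimes>\<^sub>M lborel)" .
  have "(\<lambda>p. ennreal (norm (case p of (x, y) \<Rightarrow> f x y))) \<in> borel_measurable (lborel \<Otimes>\<^sub>M lborel)"
    using m by measurable
  then have "(\<integral>\<^sup>+p. ennreal (norm (case p of (x, y) \<Rightarrow> f x y)) \<partial>(lborel \<Otimes>\<^sub>M lborel))
      = (\<integral>\<^sup>+x. \<integral>\<^sup>+y. ennreal (norm (case (x, y) of (x, y) \<Rightarrow> f x y)) \<partial>lborel \<partial>lborel)"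
    by (rule lborel.nn_integral_fst[symmetric])
  then show "(\<integral>\<^sup>+p. ennreal (norm (case p of (x, y) \<Rightarrow> f x y)) \<partial>(lborel \<Otimes>\<^sub>M lborel)) < \<infinity>"
    using assms(2) by simp
qed

lemma lborel_Fubini:
  fixes h :: "'a::euclidean_space \<Rightarrow> 'b::euclidean_space \<Rightarrow> complex"
  assumes "(\<lambda>(x, y). h x y) \<in> borel_measurable (borel \<Otimes>\<^sub>M borel)"
    and "(\<integral>\<^sup>+x. \<integral>\<^sup>+y. ennreal (norm (h x y)) \<partial>lborel \<partial>lborel) < \<infinity>"
  shows "(\<integral>x. \<integral>y. h x y \<partial>lborel \<partial>lborel) = (\<integral>y. \<integral>x. h x y \<partial>lborel \<partial>lborel)"
  using lborel_pair.Fubini_integral[OF integrable_lborel_pair[OF assms]] by simp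

lemma nn_integral_product:
  fixes f :: "'a::euclidean_space \<Rightarrow> ennreal" and g :: "'b::euclidean_space \<Rightarrow> ennreal"
  assumes [measurable]: "f \<in> borel_measurable borel" "g \<in> borel_measurable borel"
  shows "(\<integral>\<^sup>+x. \<integral>\<^sup>+y. f x * g y \<partial>lborel \<partial>lborel) = (\<integral>\<^sup>+x. f x \<partial>lborel) * (\<integral>\<^sup>+y. g y \<partial>lborel)"
  by (simp add: nn_integral_cmult nn_integral_multc)

lemma integral_lborel_prod:
  fixes f :: "'a::euclidean_space \<Rightarrow> real \<Rightarrow> complex"
  assumes [measurable]: "\<And>b. f b \<in> borel_measurable borel" and i: "\<And>b. integrable lborel (f b)"
  shows "(\<integral>x. (\<Prod>b\<in>Basis. f b (x \<bullet> b)) \<partial>lborel) = (\<Prod>b\<in>Basis. \<integral>y. f b y \<partial>lborel)"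
proof -
  interpret product_sigma_finite "\<lambda>_::'a. lborel :: real measure" ..
  have "(\<integral>x. (\<Prod>b\<in>Basis. f b (x \<bullet> b)) \<partial>lborel)
    = (\<integral>x. (\<Prod>b\<in>Basis. f b ((\<Sum>b\<in>Basis. x b *\<^sub>R b) \<bullet> b)) \<partial>(\<Pi>\<^sub>M b\<in>(Basis :: 'a set). lborel))"
    by (subst lborel_def[where 'a = 'a], subst integral_distr) (auto simp: lborel_eq_real)
  also have "\<dots> = (\<integral>x. (\<Prod>b\<in>Basis. f b (x b)) \<partial>(\<Pi>\<^sub>M b\<in>(Basis :: 'a set). lborel))"
    by simp
  also have "\<dots> = (\<Prod>b\<in>Basis. \<integral>y. f b y \<partial>lborel)"
    by (rule product_integral_prod) (auto simp: i)
  finally show ?thesis .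
qed

lemma cnj_measurable [measurable]: "cnj \<in> borel_measurable borel"
  by (intro borel_measurable_continuous_onI continuous_intros)

section \<open>The Gaussian and its Fourier transform\<close>

definition gauss :: "real^3 \<Rightarrow> real" where
  "gauss x = exp (- (norm x)\<^sup>2 / 2)"

lemma gauss_nonneg [simp]: "0 \<le> gauss x"
  by (simp add: gauss_def)

lemma gauss_le_1: "gauss x \<le> 1"
  by (simp add: gauss_def)

lemma gauss_uminus [simp]: "gauss (- x) = gauss x"
  by (simp add: gauss_def)

lemma gauss_measurable [measurable]: "gauss \<in> borel_measurable borel"
  unfolding gauss_def by measurable

text \<open>Coordinate by coordinate this is the characteristic function of the standard normal
  distribution; \<open>fourier_const\<close> is precisely the product of the three normalizing
  factors 1 / sqrt(2 pi).\<close>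

lemma gauss_transform: "fourier_const * (\<integral>x. gauss x * cis (x \<bullet> \<xi>) \<partial>lborel) = gauss \<xi>"
proof -
  define f where "f b y = std_normal_density y * cis ((\<xi> \<bullet> b) * y)" for b :: "real^3" and y
  have fm: "f b \<in> borel_measurable borel" for b
    unfolding f_def by measurable
  have fi: "integrable lborel (f b)" for b
    unfolding f_def
    by (rule Bochner_Integration.integrable_bound[OF integrable_normal_density[of 1 0]]) (auto simp: norm_mult)
  have f1: "(\<integral>y. f b y \<partial>lborel) = exp (- (\<xi> \<bullet> b)\<^sup>2 / 2)" for b
  proof -
    have "(\<integral>y. f b y \<partial>lborel) = char std_normal_distribution (\<xi> \<bullet> b)"
      unfolding char_def by (subst integral_density) (auto simp: f_def[abs_def] cis_conv_exp scaleR_conv_of_real)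
    then show ?thesis
      by (simp add: char_std_normal_distribution)
  qed
  have c: "fourier_const = (1 / sqrt (2 * pi)) ^ 3"
  proof -
    have "sqrt (2 * pi) = (2 * pi) powr (1 / 2)"
      by (rule powr_half_sqrt[symmetric]) simp
    then have "1 / sqrt (2 * pi) = (2 * pi) powr (- (1 / 2))"
      by (simp only: powr_minus_divide)
    then have "(1 / sqrt (2 * pi)) ^ 3 = ((2 * pi) powr (- (1 / 2))) ^ 3"
      by (simp only:)
    also have "\<dots> = ((2 * pi) powr (- (1 / 2))) powr (real 3)"
      by (rule powr_realpow[symmetric]) simp
    also have "\<dots> = (2 * pi) powr (- (1 / 2) * real 3)"
      by (rule powr_powr)
    also have "- (1 / 2) * real 3 = - 3 / 2"
      by simp
    finally show ?thesis
      by (simp only: fourier_const_def)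
  qed
  have "(\<Prod>b\<in>Basis. f b (x \<bullet> b)) = fourier_const * (gauss x * cis (x \<bullet> \<xi>))" for x
  proof -
    have "(\<Prod>b\<in>Basis. std_normal_density (x \<bullet> b)) = (\<Prod>b\<in>(Basis::(real^3) set). 1 / sqrt (2 * pi)) * (\<Prod>b\<in>Basis. exp (- (x \<bullet> b)\<^sup>2 / 2))"
      by (simp only: std_normal_density_def prod.distrib)
    also have "(\<Prod>b\<in>(Basis::(real^3) set). 1 / sqrt (2 * pi)) = fourier_const"
      unfolding c by (simp add: prod_constant)
    also have "(\<Prod>b\<in>Basis. exp (- (x \<bullet> b)\<^sup>2 / 2)) = gauss x"
      unfolding gauss_def power2_norm_eq_inner euclidean_inner[of x x]
      by (simp add: exp_sum[symmetric] sum_negf sum_divide_distrib power2_eq_square)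
    finally have 1: "(\<Prod>b\<in>Basis. std_normal_density (x \<bullet> b)) = fourier_const * gauss x" .
    have 2: "(\<Prod>b\<in>Basis. cis ((\<xi> \<bullet> b) * (x \<bullet> b))) = cis (x \<bullet> \<xi>)"
      unfolding euclidean_inner[of x \<xi>] cis_conv_exp
      by (simp add: exp_sum[symmetric] sum_distrib_left mult.commute)
    have "(\<Prod>b\<in>Basis. f b (x \<bullet> b)) = of_real (\<Prod>b\<in>Basis. std_normal_density (x \<bullet> b)) * (\<Prod>b\<in>Basis. cis ((\<xi> \<bullet> b) * (x \<bullet> b)))"
      unfolding f_def by (simp add: prod.distrib)
    then show ?thesis
      unfolding 1 2 by simp
  qed
  then have "fourier_const * (\<integral>x. gauss x * cis (x \<bullet> \<xi>) \<partial>lborel) = (\<integral>x. (\<Prod>b\<in>Basis. f b (x \<bullet> b)) \<partial>lborel)"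
    by simp
  also have "\<dots> = (\<Prod>b\<in>Basis. exp (- (\<xi> \<bullet> b)\<^sup>2 / 2))"
    by (subst integral_lborel_prod[OF fm fi]) (simp add: f1)
  also have "\<dots> = complex_of_real (gauss \<xi>)"
    unfolding gauss_def power2_norm_eq_inner euclidean_inner[of \<xi> \<xi>]
    by (simp add: exp_sum[symmetric] sum_negf sum_divide_distrib power2_eq_square flip: of_real_prod)
  finally show ?thesis .
qed

lemma gauss_integral: "fourier_const * (\<integral>x. gauss x \<partial>lborel) = 1"
proof -
  have "complex_of_real (fourier_const * (\<integral>x. gauss x \<partial>lborel)) = 1"
    using gauss_transform[of 0] by (simp add: gauss_def)
  then show ?thesis
    by (metis of_real_eq_1_iff)
qed

text \<open>A non-integrable function has integral 0 by convention, which
  \<open>gauss_integral\<close> excludes.\<close>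

lemma gauss_integrable: "integrable lborel gauss"
  using gauss_integral not_integrable_integral_eq[of lborel gauss] by force

lemma gauss_integrable_scale: "\<epsilon> \<noteq> 0 \<Longrightarrow> integrable lborel (\<lambda>x. gauss (\<epsilon> *\<^sub>R x))"
  using integrable_lborel_affine_iff[of gauss \<epsilon> 0] gauss_integrable by simp

text \<open>The transform of the Gaussian dilated by \<epsilon>: an approximate identity as
  \<epsilon> tends to 0, of total mass \<open>1 / fourier_const\<close> rather than 1 owing to the
  symmetric normalization of the Fourier transform.\<close>

definition gauss_kernel :: "real \<Rightarrow> real^3 \<Rightarrow> real" where
  "gauss_kernel \<epsilon> x = gauss ((1 / \<epsilon>) *\<^sub>R x) / \<epsilon> ^ 3"

lemma gauss_kernel_nonneg [simp]: "0 < \<epsilon> \<Longrightarrow> 0 \<le> gauss_kernel \<epsilon> x"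
  by (simp add: gauss_kernel_def)

lemma gauss_kernel_measurable [measurable]: "gauss_kernel \<epsilon> \<in> borel_measurable borel"
  unfolding gauss_kernel_def by measurable

lemma gauss_kernel_integral:
  assumes "0 < \<epsilon>"
  shows "(\<integral>\<^sup>+x. gauss_kernel \<epsilon> x \<partial>lborel) = ennreal (1 / fourier_const)"
proof -
  have "(\<integral>\<^sup>+x. gauss_kernel \<epsilon> x \<partial>lborel) = ennreal (\<epsilon> ^ 3) * (\<integral>\<^sup>+x. gauss_kernel \<epsilon> (\<epsilon> *\<^sub>R x) \<partial>lborel)"
    using nn_integral_lborel_affine[of "\<lambda>x. ennreal (gauss_kernel \<epsilon> x)" \<epsilon> 0] assms by simp
  also have "\<dots> = (\<integral>\<^sup>+x. ennreal (\<epsilon> ^ 3) * gauss_kernel \<epsilon> (\<epsilon> *\<^sub>R x) \<partial>lborel)"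
    by (rule nn_integral_cmult[symmetric]) measurable
  also have "\<dots> = (\<integral>\<^sup>+x. ennreal (gauss x) \<partial>lborel)"
    using assms by (intro nn_integral_cong) (simp add: gauss_kernel_def flip: ennreal_mult)
  also have "\<dots> = ennreal (\<integral>x. gauss x \<partial>lborel)"
    by (intro nn_integral_eq_integral gauss_integrable) simp
  also have "(\<integral>x. gauss x \<partial>lborel) = 1 / fourier_const"
    using gauss_integral fourier_const_pos by (simp add: field_simps)
  finally show ?thesis .
qed

lemma gauss_transform_scale:
  assumes "0 < \<epsilon>"
  shows "fourier_const * (\<integral>x. gauss (\<epsilon> *\<^sub>R x) * cis (x \<bullet> \<xi>) \<partial>lborel) = gauss_kernel \<epsilon> \<xi>"
proof -
  have "(\<integral>x. gauss (\<epsilon> *\<^sub>R x) * cis (x \<bullet> \<xi>) \<partial>lborel)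
      = (1 / \<epsilon> ^ 3) *\<^sub>R (\<integral>x. gauss x * cis (x \<bullet> ((1 / \<epsilon>) *\<^sub>R \<xi>)) \<partial>lborel)"
    using integral_lborel_affine[of "\<lambda>x. gauss (\<epsilon> *\<^sub>R x) * cis (x \<bullet> \<xi>)" "1 / \<epsilon>" 0] assms
    by (simp add: power_one_over)
  then show ?thesis
    using gauss_transform[of "(1 / \<epsilon>) *\<^sub>R \<xi>"] by (simp add: gauss_kernel_def scaleR_conv_of_real)
qed

section \<open>Gaussian regularization and Fourier inversion\<close>

lemma fourier_measurable [measurable]:
  assumes [measurable]: "k \<in> borel_measurable borel"
  shows "fourier k \<in> borel_measurable borel"
  unfolding fourier_def by measurable

lemma nn_integral_norm_finite:
  fixes f :: "'a \<Rightarrow> 'b::{banach, second_countable_topology}"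
  shows "integrable M f \<Longrightarrow> (\<integral>\<^sup>+x. ennreal (norm (f x)) \<partial>M) < \<infinity>"
  by (simp add: integrable_iff_bounded)

text \<open>The Gaussian factor makes the double integral of the inversion formula absolutely
  convergent, so the order of integration can be exchanged and the inner integral is the Gaussian
  kernel. Letting \<epsilon> tend to 0 gives inversion in one application and the Plancherel
  inequality in another.\<close>

lemma fourier_gauss_regularization:
  assumes k: "integrable lborel k" and "0 < \<epsilon>"
  shows "(\<integral>y. fourier k y * cis (y \<bullet> x) * gauss (\<epsilon> *\<^sub>R y) \<partial>lborel) = (\<integral>z. k z * gauss_kernel \<epsilon> (x - z) \<partial>lborel)"
proof -
  have [measurable]: "k \<in> borel_measurable borel"
    using k by auto
  define h where "h y z = fourier_const * (cis (- (z \<bullet> y)) * k z) * cis (y \<bullet> x) * gauss (\<epsilon> *\<^sub>R y)" for y z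
  have [measurable]: "(\<lambda>(y, z). h y z) \<in> borel_measurable (borel \<Otimes>\<^sub>M borel)"
    unfolding h_def by measurable
  have nh: "norm (h y z) = (fourier_const * norm (gauss (\<epsilon> *\<^sub>R y))) * norm (k z)" for y z
    using fourier_const_pos by (simp add: h_def norm_mult)
  have "(\<integral>\<^sup>+y. \<integral>\<^sup>+z. ennreal (norm (h y z)) \<partial>lborel \<partial>lborel)
     = (\<integral>\<^sup>+y. \<integral>\<^sup>+z. ennreal (fourier_const * norm (gauss (\<epsilon> *\<^sub>R y))) * ennreal (norm (k z)) \<partial>lborel \<partial>lborel)"
    unfolding nh using fourier_const_pos by (simp add: ennreal_mult)
  also have "\<dots> = (\<integral>\<^sup>+y. ennreal (norm (fourier_const * gauss (\<epsilon> *\<^sub>R y))) \<partial>lborel) * (\<integral>\<^sup>+z. ennreal (norm (k z)) \<partial>lborel)"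
    using fourier_const_pos by (subst nn_integral_product) (auto simp: abs_mult)
  also have "\<dots> < \<infinity>"
    using nn_integral_norm_finite[OF k] nn_integral_norm_finite[OF integrable_mult_right[OF gauss_integrable_scale[of \<epsilon>], of fourier_const]] assms(2)
    by (simp add: ennreal_mult_less_top)
  finally have fin: "(\<integral>\<^sup>+y. \<integral>\<^sup>+z. ennreal (norm (h y z)) \<partial>lborel \<partial>lborel) < \<infinity>" .
  have "(\<integral>y. fourier k y * cis (y \<bullet> x) * gauss (\<epsilon> *\<^sub>R y) \<partial>lborel) = (\<integral>y. \<integral>z. h y z \<partial>lborel \<partial>lborel)"
    unfolding h_def fourier_alt by simp
  also have "\<dots> = (\<integral>z. \<integral>y. h y z \<partial>lborel \<partial>lborel)"
    by (rule lborel_Fubini[OF _ fin]) measurable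
  also have "\<dots> = (\<integral>z. k z * gauss_kernel \<epsilon> (x - z) \<partial>lborel)"
  proof (rule Bochner_Integration.integral_cong[OF refl])
    fix z
    have "h y z = k z * fourier_const * (gauss (\<epsilon> *\<^sub>R y) * cis (y \<bullet> (x - z)))" for y
    proof -
      have "cis (y \<bullet> (x - z)) = cis (- (z \<bullet> y)) * cis (y \<bullet> x)"
        by (simp add: cis_mult inner_diff_right inner_commute)
      then show ?thesis by (simp add: h_def mult_ac)
    qed
    then show "(\<integral>y. h y z \<partial>lborel) = k z * gauss_kernel \<epsilon> (x - z)"
      using gauss_transform_scale[OF assms(2), of "x - z"] by (simp add: mult.assoc)
  qed
  finally show ?thesis .
qed

text \<open>Limit \<epsilon> -> 0 of the regularized formula. The frequency side is dominated by
  \<open>norm (fourier k y)\<close>. On the other side the kernel is rescaled to a fixed Gaussian: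
  continuity of k gives the pointwise limit and boundedness the majorant
  \<open>B * gauss z\<close>.\<close>

theorem fourier_inversion:
  assumes k: "integrable lborel k" and fk: "integrable lborel (fourier k)"
    and cont: "continuous_on UNIV k" and bdd: "\<And>x. norm (k x) \<le> B"
  shows "fourier (fourier k) (- x) = k x"
proof -
  note [measurable] = borel_measurable_integrable[OF k, simplified] borel_measurable_integrable[OF fk, simplified]
  define e where "e n = 1 / real (Suc n)" for n
  have e0: "e \<longlonglongrightarrow> 0" unfolding e_def by real_asymp
  have epos: "0 < e n" for n by (simp add: e_def)
  have "(\<lambda>n. \<integral>y. fourier k y * cis (y \<bullet> x) * gauss (e n *\<^sub>R y) \<partial>lborel)
      \<longlonglongrightarrow> (\<integral>y. fourier k y * cis (y \<bullet> x) * of_real 1 \<partial>lborel)"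
  proof (rule integral_dominated_convergence[where w = "\<lambda>y. norm (fourier k y)"])
    have "continuous_on UNIV gauss"
      unfolding gauss_def by (intro continuous_intros) auto
    then have "isCont gauss 0" by (simp add: continuous_on_eq_continuous_at)
    have "(\<lambda>n. gauss (e n *\<^sub>R y)) \<longlonglongrightarrow> gauss 0" for y
      by (rule isCont_tendsto_compose[OF \<open>isCont gauss 0\<close>]) (use tendsto_scaleR[OF e0 tendsto_const[of y]] in simp)
    then have "(\<lambda>n. gauss (e n *\<^sub>R y)) \<longlonglongrightarrow> 1" for y by (simp add: gauss_def)
    then show "AE y in lborel. (\<lambda>n. fourier k y * cis (y \<bullet> x) * gauss (e n *\<^sub>R y)) \<longlonglongrightarrow> fourier k y * cis (y \<bullet> x) * of_real 1"
      by (intro always_eventually allI tendsto_mult tendsto_const tendsto_of_real)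
    show "AE y in lborel. norm (fourier k y * cis (y \<bullet> x) * gauss (e n *\<^sub>R y)) \<le> norm (fourier k y)" for n
      by (intro always_eventually allI) (simp add: norm_mult gauss_le_1 mult_left_le)
    show "integrable lborel (\<lambda>y. norm (fourier k y))" using fk by simp
  qed auto
  moreover have "(\<integral>y. fourier k y * cis (y \<bullet> x) * gauss (e n *\<^sub>R y) \<partial>lborel) = (\<integral>z. k (x + e n *\<^sub>R z) * gauss z \<partial>lborel)" for n
  proof -
    have "(\<integral>z. k z * gauss_kernel (e n) (x - z) \<partial>lborel)
        = (e n ^ 3) *\<^sub>R (\<integral>z. k (x + e n *\<^sub>R z) * gauss_kernel (e n) (x - (x + e n *\<^sub>R z)) \<partial>lborel)"
      using integral_lborel_affine[of "\<lambda>z. k z * gauss_kernel (e n) (x - z)" "e n" x] epos[of n] by simp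
    also have "\<dots> = (\<integral>z. k (x + e n *\<^sub>R z) * gauss z \<partial>lborel)"
      using epos[of n] by (simp add: gauss_kernel_def scaleR_conv_of_real[where 'a = complex])
    finally show ?thesis
      using fourier_gauss_regularization[OF k epos] by simp
  qed
  moreover have "(\<lambda>n. \<integral>z. k (x + e n *\<^sub>R z) * gauss z \<partial>lborel) \<longlonglongrightarrow> (\<integral>z. k x * gauss z \<partial>lborel)"
  proof (rule integral_dominated_convergence[where w = "\<lambda>z. B * gauss z"])
    have "(\<lambda>n. k (x + e n *\<^sub>R z)) \<longlonglongrightarrow> k x" for z
    proof (rule isCont_tendsto_compose[of x k])
      show "isCont k x" using cont by (simp add: continuous_on_eq_continuous_at)
      show "(\<lambda>n. x + e n *\<^sub>R z) \<longlonglongrightarrow> x"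
        using tendsto_add[OF tendsto_const[of x] tendsto_scaleR[OF e0 tendsto_const[of z]]] by simp
    qed
    then show "AE z in lborel. (\<lambda>n. k (x + e n *\<^sub>R z) * gauss z) \<longlonglongrightarrow> k x * gauss z"
      by (intro always_eventually allI tendsto_mult tendsto_const)
    show "AE z in lborel. norm (k (x + e n *\<^sub>R z) * gauss z) \<le> B * gauss z" for n
      using bdd by (intro always_eventually allI) (simp add: norm_mult mult_right_mono)
    show "integrable lborel (\<lambda>z. B * gauss z)"
      by (intro integrable_mult_right gauss_integrable)
  qed auto
  ultimately have "(\<integral>y. fourier k y * cis (y \<bullet> x) * of_real 1 \<partial>lborel) = (\<integral>z. k x * gauss z \<partial>lborel)"
    using LIMSEQ_unique by simp
  also have "\<dots> = k x * of_real (\<integral>z. gauss z \<partial>lborel)"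
    by simp
  finally have "fourier (fourier k) (- x) = k x * of_real (fourier_const * (\<integral>z. gauss z \<partial>lborel))"
    by (simp add: fourier_alt mult_ac)
  then show ?thesis by (simp add: gauss_integral)
qed

lemma schwartz_integrable: "\<phi> \<in> schwartz \<Longrightarrow> integrable lborel \<phi>"
  by (intro moments_integrable schwartz_moments)

lemma schwartz_bounded:
  assumes "\<phi> \<in> schwartz"
  shows "\<exists>B. \<forall>x. norm (\<phi> x) \<le> B"
  using schwartz_bound[OF assms, of 0 "[]"] by auto

definition inv_fourier :: "(real^3 \<Rightarrow> complex) \<Rightarrow> real^3 \<Rightarrow> complex" where
  "inv_fourier k x = fourier k (- x)"

lemma inv_fourier_alt: "inv_fourier k x = fourier_const * (\<integral>\<xi>. cis (x \<bullet> \<xi>) * k \<xi> \<partial>lborel)"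
  by (simp add: inv_fourier_def fourier_alt inner_commute)

lemma inv_fourier_measurable [measurable]:
  assumes [measurable]: "k \<in> borel_measurable borel"
  shows "inv_fourier k \<in> borel_measurable borel"
  unfolding inv_fourier_alt by measurable

lemma inv_fourier_fourier:
  assumes "\<phi> \<in> schwartz"
  shows "inv_fourier (fourier \<phi>) x = \<phi> x"
proof -
  obtain B where "\<And>x. norm (\<phi> x) \<le> B" using schwartz_bounded[OF assms] by blast
  then show ?thesis
    unfolding inv_fourier_def using assms
    by (intro fourier_inversion schwartz_integrable fourier_schwartz smooth_continuous schwartz_smooth)
qed

lemma fourier_reflect:
  assumes [measurable]: "k \<in> borel_measurable borel"
  shows "fourier (\<lambda>x. k (- x)) \<xi> = fourier k (- \<xi>)"
  unfolding fourier_alt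
  using integral_lborel_affine[of "\<lambda>x. cis (- (x \<bullet> \<xi>)) * k (- x)" "-1" 0] by simp

lemma inv_fourier_schwartz: "\<phi> \<in> schwartz \<Longrightarrow> inv_fourier \<phi> \<in> schwartz"
  using schwartz_reflect[OF fourier_schwartz, of \<phi>] by (simp add: inv_fourier_def[abs_def])

lemma fourier_inv_fourier:
  assumes "\<phi> \<in> schwartz"
  shows "fourier (inv_fourier \<phi>) x = \<phi> x"
proof -
  have [measurable]: "fourier \<phi> \<in> borel_measurable borel"
    using assms by (intro schwartz_measurable fourier_schwartz)
  have "fourier (inv_fourier \<phi>) x = fourier (fourier \<phi>) (- x)"
    unfolding inv_fourier_def[abs_def] by (rule fourier_reflect) measurable
  then show ?thesis
    using inv_fourier_fourier[OF assms] by (simp add: inv_fourier_def)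
qed

section \<open>The Plancherel inequality\<close>

lemma inv_fourier_mult_formula:
  assumes k: "integrable lborel k" and g: "integrable lborel g"
  shows "(\<integral>y. inv_fourier k y * g y \<partial>lborel) = (\<integral>\<xi>. k \<xi> * inv_fourier g \<xi> \<partial>lborel)"
proof -
  have [measurable]: "k \<in> borel_measurable borel" "g \<in> borel_measurable borel"
    using k g by auto
  define h where "h y \<xi> = fourier_const * (cis (y \<bullet> \<xi>) * k \<xi>) * g y" for y \<xi>
  have [measurable]: "(\<lambda>(y, \<xi>). h y \<xi>) \<in> borel_measurable (borel \<Otimes>\<^sub>M borel)"
    unfolding h_def by measurable
  have nh: "norm (h y z) = norm (fourier_const * g y) * norm (k z)" for y z
    using fourier_const_pos by (simp add: h_def norm_mult)
  have "(\<integral>\<^sup>+y. \<integral>\<^sup>+z. ennreal (norm (h y z)) \<partial>lborel \<partial>lborel)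
     = (\<integral>\<^sup>+y. \<integral>\<^sup>+z. ennreal (norm (fourier_const * g y)) * ennreal (norm (k z)) \<partial>lborel \<partial>lborel)"
    unfolding nh by (simp add: ennreal_mult)
  also have "\<dots> = (\<integral>\<^sup>+y. ennreal (norm (fourier_const * g y)) \<partial>lborel) * (\<integral>\<^sup>+z. ennreal (norm (k z)) \<partial>lborel)"
    by (subst nn_integral_product) auto
  also have "\<dots> < \<infinity>"
    using nn_integral_norm_finite[OF k] nn_integral_norm_finite[OF integrable_mult_right[OF g, of fourier_const]]
    by (simp add: ennreal_mult_less_top)
  finally have fin: "(\<integral>\<^sup>+y. \<integral>\<^sup>+z. ennreal (norm (h y z)) \<partial>lborel \<partial>lborel) < \<infinity>" .
  have "(\<integral>y. inv_fourier k y * g y \<partial>lborel) = (\<integral>y. \<integral>\<xi>. h y \<xi> \<partial>lborel \<partial>lborel)"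
    unfolding h_def inv_fourier_alt by simp
  also have "\<dots> = (\<integral>\<xi>. \<integral>y. h y \<xi> \<partial>lborel \<partial>lborel)"
    by (rule lborel_Fubini[OF _ fin]) measurable
  also have "\<dots> = (\<integral>\<xi>. k \<xi> * inv_fourier g \<xi> \<partial>lborel)"
  proof (rule Bochner_Integration.integral_cong[OF refl])
    fix \<xi>
    have "(\<integral>y. h y \<xi> \<partial>lborel) = (\<integral>y. (k \<xi> * fourier_const) * (cis (\<xi> \<bullet> y) * g y) \<partial>lborel)"
      by (simp add: h_def mult_ac inner_commute)
    then show "(\<integral>y. h y \<xi> \<partial>lborel) = k \<xi> * inv_fourier g \<xi>"
      unfolding inv_fourier_alt by (simp only: integral_mult_right_zero mult.assoc)
  qed
  finally show ?thesis .
qed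

text \<open>With a Gaussian weight the left side becomes a pairing of k with its own convolution by
  the Gaussian kernel. This is bounded by the right side for every \<epsilon>, by the inequality
  between arithmetic and geometric mean, and Fatou's lemma removes the weight. The right side may be
  infinite.\<close>

theorem Plancherel_inequality:
  assumes k: "integrable lborel k"
  shows "(\<integral>\<^sup>+y. ennreal ((norm (fourier k y))\<^sup>2) \<partial>lborel) \<le> (\<integral>\<^sup>+x. ennreal ((norm (k x))\<^sup>2) \<partial>lborel)"
proof -
  have [measurable]: "k \<in> borel_measurable borel"
    using k by auto
  define c where "c = fourier_const"
  have c0: "0 < c" by (simp add: c_def fourier_const_pos)
  define N where "N = (\<integral>\<^sup>+x. ennreal ((norm (k x))\<^sup>2) \<partial>lborel)"
  have reg: "(\<integral>\<^sup>+y. ennreal ((norm (fourier k y))\<^sup>2 * gauss (\<epsilon> *\<^sub>R y)) \<partial>lborel) \<le> N" if "0 < \<epsilon>" for \<epsilon>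
  proof -
    \<comment> \<open>Chosen so that \<open>inv_fourier k y * g y\<close> is the Gaussian-weighted
      squared modulus of \<open>fourier k\<close> at -y.\<close>
    define g where "g y = cnj (fourier k (- y)) * gauss (\<epsilon> *\<^sub>R y)" for y
    define K where "K a = (\<integral>z. k z * gauss_kernel \<epsilon> (a - z) \<partial>lborel)" for a
    obtain B where B: "\<And>y. norm (fourier k y) \<le> B"
      using norm_fourier_le[OF k] by blast
    have B0: "0 \<le> B" using B[of 0] norm_ge_zero order_trans by blast
    have [measurable]: "fourier k \<in> borel_measurable borel" by (rule fourier_measurable) measurable
    have gi: "integrable lborel g"
    proof (rule Bochner_Integration.integrable_bound[OF integrable_mult_right[OF gauss_integrable_scale[of \<epsilon>], of B]])
      show "AE y in lborel. norm (g y) \<le> norm (B * gauss (\<epsilon> *\<^sub>R y))"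
        using B B0 by (intro always_eventually allI) (simp add: g_def norm_mult mult_right_mono)
    qed (use that in \<open>auto simp: g_def[abs_def]\<close>)
    have gK: "inv_fourier g a = c * cnj (K a)" for a
    proof -
      have "(\<integral>y. cis (a \<bullet> y) * g y \<partial>lborel) = (\<integral>y. cis (a \<bullet> (- y)) * g (- y) \<partial>lborel)"
        using integral_lborel_affine[of "\<lambda>y. cis (a \<bullet> y) * g y" "-1" 0] by (simp add: g_def)
      also have "\<dots> = (\<integral>y. cnj (fourier k y * cis (y \<bullet> a) * gauss (\<epsilon> *\<^sub>R y)) \<partial>lborel)"
        by (simp add: g_def cis_cnj[symmetric] inner_commute mult_ac)
      also have "\<dots> = cnj (K a)"
        unfolding K_def fourier_gauss_regularization[OF k that, symmetric] by (rule Bochner_Integration.integral_cnj)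
      finally show ?thesis by (simp add: inv_fourier_alt c_def)
    qed
    have i: "integrable lborel (\<lambda>y. (norm (fourier k y))\<^sup>2 * gauss (\<epsilon> *\<^sub>R y))"
    proof (rule Bochner_Integration.integrable_bound[OF integrable_mult_right[OF gauss_integrable_scale[of \<epsilon>], of "B\<^sup>2"]])
      show "AE y in lborel. norm ((norm (fourier k y))\<^sup>2 * gauss (\<epsilon> *\<^sub>R y)) \<le> norm (B\<^sup>2 * gauss (\<epsilon> *\<^sub>R y))"
        using B B0 by (intro always_eventually allI) (simp add: mult_right_mono power_mono)
    qed (use that in auto)
    have "of_real (\<integral>y. (norm (fourier k y))\<^sup>2 * gauss (\<epsilon> *\<^sub>R y) \<partial>lborel)
        = (\<integral>y. fourier k y * cnj (fourier k y) * gauss (\<epsilon> *\<^sub>R y) \<partial>lborel)"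
      by (simp add: complex_norm_square[symmetric] flip: of_real_mult of_real_power)
    also have "\<dots> = (\<integral>y. inv_fourier k y * g y \<partial>lborel)"
      using integral_lborel_affine[of "\<lambda>y. fourier k y * cnj (fourier k y) * gauss (\<epsilon> *\<^sub>R y)" "-1" 0]
      by (simp add: inv_fourier_def g_def mult.assoc)
    also have "\<dots> = (\<integral>a. k a * (c * cnj (K a)) \<partial>lborel)"
      unfolding inv_fourier_mult_formula[OF k gi] gK ..
    finally have eq: "complex_of_real (\<integral>y. (norm (fourier k y))\<^sup>2 * gauss (\<epsilon> *\<^sub>R y) \<partial>lborel) = (\<integral>a. k a * (c * cnj (K a)) \<partial>lborel)" .
    have "(\<integral>\<^sup>+y. ennreal ((norm (fourier k y))\<^sup>2 * gauss (\<epsilon> *\<^sub>R y)) \<partial>lborel)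
       = ennreal (norm (complex_of_real (\<integral>y. (norm (fourier k y))\<^sup>2 * gauss (\<epsilon> *\<^sub>R y) \<partial>lborel)))"
      using i by (subst nn_integral_eq_integral) (auto intro!: arg_cong[where f = ennreal] abs_of_nonneg[symmetric] integral_nonneg)
    also have "\<dots> \<le> (\<integral>\<^sup>+a. ennreal (norm (k a * (c * cnj (K a)))) \<partial>lborel)"
      unfolding eq by (rule norm_integral_le_nn_integral)
    \<comment> \<open>The product |k(a)| |k(z)| is replaced by the mean of the squares, which
      decouples a and z. Each half is then integrated against a kernel of mass 1 / c and contributes
      N / (2c), so that the prefactor c yields exactly N.\<close>
    also have "\<dots> \<le> (\<integral>\<^sup>+a. ennreal c * (\<integral>\<^sup>+z. ennreal (((norm (k a))\<^sup>2 + (norm (k z))\<^sup>2) / 2 * gauss_kernel \<epsilon> (a - z)) \<partial>lborel) \<partial>lborel)"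
    proof (rule nn_integral_mono)
      fix a
      have "ennreal (norm (k a * (c * cnj (K a)))) = ennreal c * (ennreal (norm (k a)) * ennreal (norm (K a)))"
        using c0 by (simp add: norm_mult ennreal_mult mult_ac)
      also have "\<dots> \<le> ennreal c * (ennreal (norm (k a)) * (\<integral>\<^sup>+z. ennreal (norm (k z * gauss_kernel \<epsilon> (a - z))) \<partial>lborel))"
        unfolding K_def by (intro mult_left_mono norm_integral_le_nn_integral) auto
      also have "\<dots> = ennreal c * (\<integral>\<^sup>+z. ennreal (norm (k a)) * ennreal (norm (k z * gauss_kernel \<epsilon> (a - z))) \<partial>lborel)"
        by (subst nn_integral_cmult) auto
      also have "\<dots> \<le> ennreal c * (\<integral>\<^sup>+z. ennreal (((norm (k a))\<^sup>2 + (norm (k z))\<^sup>2) / 2 * gauss_kernel \<epsilon> (a - z)) \<partial>lborel)"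
      proof (intro mult_left_mono nn_integral_mono)
        fix z
        have "norm (k a) * norm (k z) \<le> ((norm (k a))\<^sup>2 + (norm (k z))\<^sup>2) / 2"
          using sum_squares_bound[of "norm (k a)" "norm (k z)"] by simp
        then show "ennreal (norm (k a)) * ennreal (norm (k z * gauss_kernel \<epsilon> (a - z))) \<le> ennreal (((norm (k a))\<^sup>2 + (norm (k z))\<^sup>2) / 2 * gauss_kernel \<epsilon> (a - z))"
          using that by (simp add: norm_mult ennreal_mult[symmetric] mult.assoc[symmetric] mult_right_mono ennreal_leI del: times_divide_eq_left)
      qed simp
      finally show "ennreal (norm (k a * (c * cnj (K a)))) \<le> ennreal c * (\<integral>\<^sup>+z. ennreal (((norm (k a))\<^sup>2 + (norm (k z))\<^sup>2) / 2 * gauss_kernel \<epsilon> (a - z)) \<partial>lborel)" .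
    qed
    also have "\<dots> = ennreal c * (\<integral>\<^sup>+a. \<integral>\<^sup>+z. ennreal ((norm (k a))\<^sup>2 / 2) * ennreal (gauss_kernel \<epsilon> (a - z))
         + ennreal ((norm (k z))\<^sup>2 / 2) * ennreal (gauss_kernel \<epsilon> (a - z)) \<partial>lborel \<partial>lborel)"
      using that by (subst nn_integral_cmult) (auto simp: ennreal_mult[symmetric] ennreal_plus[symmetric] add_divide_distrib distrib_right simp del: ennreal_plus)
    also have "\<dots> = ennreal c * ((\<integral>\<^sup>+a. \<integral>\<^sup>+z. ennreal ((norm (k a))\<^sup>2 / 2) * ennreal (gauss_kernel \<epsilon> (a - z)) \<partial>lborel \<partial>lborel)
        + (\<integral>\<^sup>+a. \<integral>\<^sup>+z. ennreal ((norm (k z))\<^sup>2 / 2) * ennreal (gauss_kernel \<epsilon> (a - z)) \<partial>lborel \<partial>lborel))"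
      by (simp add: nn_integral_add)
    also have "(\<integral>\<^sup>+a. \<integral>\<^sup>+z. ennreal ((norm (k z))\<^sup>2 / 2) * ennreal (gauss_kernel \<epsilon> (a - z)) \<partial>lborel \<partial>lborel)
      = (\<integral>\<^sup>+z. \<integral>\<^sup>+a. ennreal ((norm (k z))\<^sup>2 / 2) * ennreal (gauss_kernel \<epsilon> (a - z)) \<partial>lborel \<partial>lborel)"
      by (rule lborel_pair.Fubini') measurable
    also have "\<dots> = (\<integral>\<^sup>+z. ennreal ((norm (k z))\<^sup>2 / 2) * ennreal (1 / c) \<partial>lborel)"
    proof (rule nn_integral_cong)
      fix z
      have "(\<integral>\<^sup>+a. ennreal (gauss_kernel \<epsilon> (a - z)) \<partial>lborel) = ennreal (1 / c)"
        using nn_integral_lborel_translate(2)[of "\<lambda>x. ennreal (gauss_kernel \<epsilon> x)" "- z"] gauss_kernel_integral[OF that] by (simp add: c_def)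
      then show "(\<integral>\<^sup>+a. ennreal ((norm (k z))\<^sup>2 / 2) * ennreal (gauss_kernel \<epsilon> (a - z)) \<partial>lborel) = ennreal ((norm (k z))\<^sup>2 / 2) * ennreal (1 / c)"
        by (subst nn_integral_cmult) auto
    qed
    also have "(\<integral>\<^sup>+a. \<integral>\<^sup>+z. ennreal ((norm (k a))\<^sup>2 / 2) * ennreal (gauss_kernel \<epsilon> (a - z)) \<partial>lborel \<partial>lborel)
      = (\<integral>\<^sup>+z. ennreal ((norm (k z))\<^sup>2 / 2) * ennreal (1 / c) \<partial>lborel)"
    proof (rule nn_integral_cong)
      fix a
      have "(\<integral>\<^sup>+z. ennreal (gauss_kernel \<epsilon> (a - z)) \<partial>lborel) = ennreal (1 / c)"
        using nn_integral_lborel_reflect[of "\<lambda>x. ennreal (gauss_kernel \<epsilon> x)" a] gauss_kernel_integral[OF that] by (simp add: c_def)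
      then show "(\<integral>\<^sup>+z. ennreal ((norm (k a))\<^sup>2 / 2) * ennreal (gauss_kernel \<epsilon> (a - z)) \<partial>lborel) = ennreal ((norm (k a))\<^sup>2 / 2) * ennreal (1 / c)"
        by (subst nn_integral_cmult) auto
    qed
    also have "ennreal c * ((\<integral>\<^sup>+z. ennreal ((norm (k z))\<^sup>2 / 2) * ennreal (1 / c) \<partial>lborel) + (\<integral>\<^sup>+z. ennreal ((norm (k z))\<^sup>2 / 2) * ennreal (1 / c) \<partial>lborel)) = N"
    proof -
      have "(\<integral>\<^sup>+z. ennreal ((norm (k z))\<^sup>2 / 2) * ennreal (1 / c) \<partial>lborel) + (\<integral>\<^sup>+z. ennreal ((norm (k z))\<^sup>2 / 2) * ennreal (1 / c) \<partial>lborel)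
         = (\<integral>\<^sup>+z. ennreal (1 / c) * ennreal ((norm (k z))\<^sup>2) \<partial>lborel)"
        using c0 by (subst nn_integral_add[symmetric]) (auto simp: ennreal_mult[symmetric] ennreal_plus[symmetric] simp del: ennreal_plus)
      also have "\<dots> = ennreal (1 / c) * N"
        unfolding N_def by (rule nn_integral_cmult) measurable
      finally have eqs: "(\<integral>\<^sup>+z. ennreal ((norm (k z))\<^sup>2 / 2) * ennreal (1 / c) \<partial>lborel) + (\<integral>\<^sup>+z. ennreal ((norm (k z))\<^sup>2 / 2) * ennreal (1 / c) \<partial>lborel) = ennreal (1 / c) * N" .
      have "ennreal c * ennreal (1 / c) = 1"
        using c0 by (simp flip: ennreal_mult)
      then show ?thesis
        unfolding eqs by (simp flip: mult.assoc)
    qed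
    finally show ?thesis .
  qed
  define e where "e n = 1 / real (Suc n)" for n
  have e0: "e \<longlonglongrightarrow> 0" unfolding e_def by real_asymp
  have epos: "0 < e n" for n by (simp add: e_def)
  have "(\<lambda>n. ennreal ((norm (fourier k y))\<^sup>2 * gauss (e n *\<^sub>R y))) \<longlonglongrightarrow> ennreal ((norm (fourier k y))\<^sup>2)" for y
  proof -
    have "continuous_on UNIV gauss"
      unfolding gauss_def by (intro continuous_intros) auto
    then have "isCont gauss 0" by (simp add: continuous_on_eq_continuous_at)
    then have "(\<lambda>n. gauss (e n *\<^sub>R y)) \<longlonglongrightarrow> gauss 0"
      by (rule isCont_tendsto_compose) (use tendsto_scaleR[OF e0 tendsto_const[of y]] in simp)
    then have "(\<lambda>n. (norm (fourier k y))\<^sup>2 * gauss (e n *\<^sub>R y)) \<longlonglongrightarrow> (norm (fourier k y))\<^sup>2 * 1"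
      by (intro tendsto_mult tendsto_const) (simp add: gauss_def)
    then show ?thesis by (simp add: tendsto_ennrealI)
  qed
  then have lim: "liminf (\<lambda>n. ennreal ((norm (fourier k y))\<^sup>2 * gauss (e n *\<^sub>R y))) = ennreal ((norm (fourier k y))\<^sup>2)" for y
    by (intro lim_imp_Liminf) auto
  have [measurable]: "fourier k \<in> borel_measurable borel" by (rule fourier_measurable) measurable
  have "(\<integral>\<^sup>+y. ennreal ((norm (fourier k y))\<^sup>2) \<partial>lborel)
     \<le> liminf (\<lambda>n. \<integral>\<^sup>+y. ennreal ((norm (fourier k y))\<^sup>2 * gauss (e n *\<^sub>R y)) \<partial>lborel)"
    unfolding lim[symmetric] by (rule nn_integral_liminf) measurable
  also have "\<dots> \<le> liminf (\<lambda>n. N)"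
    by (intro Liminf_mono always_eventually allI reg epos)
  finally show ?thesis
    by (simp add: Liminf_const N_def)
qed

lemma Plancherel_inequality_inv:
  assumes "integrable lborel k"
  shows "(\<integral>\<^sup>+y. ennreal ((norm (inv_fourier k y))\<^sup>2) \<partial>lborel) \<le> (\<integral>\<^sup>+x. ennreal ((norm (k x))\<^sup>2) \<partial>lborel)"
proof -
  have [measurable]: "k \<in> borel_measurable borel"
    using assms by auto
  have [measurable]: "fourier k \<in> borel_measurable borel" by (rule fourier_measurable) measurable
  have "(\<integral>\<^sup>+y. ennreal ((norm (inv_fourier k y))\<^sup>2) \<partial>lborel) = (\<integral>\<^sup>+y. ennreal ((norm (fourier k y))\<^sup>2) \<partial>lborel)"
    using nn_integral_lborel_reflect[of "\<lambda>y. ennreal ((norm (fourier k y))\<^sup>2)" 0] by (simp add: inv_fourier_def)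
  then show ?thesis
    using Plancherel_inequality[OF assms] by simp
qed


subsection \<open>Square integrable functions and Fourier pairs\<close>

definition l2sq :: "(real^3 \<Rightarrow> complex) \<Rightarrow> ennreal" where
  "l2sq f = (\<integral>\<^sup>+x. ennreal ((norm (f x))\<^sup>2) \<partial>lborel)"

lemma l2sq_mono:
  assumes "\<And>x. norm (f x) \<le> norm (g x)"
  shows "l2sq f \<le> l2sq g"
  unfolding l2sq_def by (intro nn_integral_mono ennreal_leI power_mono assms) auto

lemma norm_add_sq_le: "(norm (a + b :: complex))\<^sup>2 \<le> 2 * (norm a)\<^sup>2 + 2 * (norm b)\<^sup>2"
proof -
  have "(norm (a + b))\<^sup>2 \<le> (norm a + norm b)\<^sup>2"
    by (intro power_mono norm_triangle_ineq) auto
  also have "\<dots> \<le> 2 * (norm a)\<^sup>2 + 2 * (norm b)\<^sup>2"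
    using sum_squares_bound[of "norm a" "norm b"] by (simp add: power2_sum)
  finally show ?thesis .
qed

lemma l2sq_add_le:
  assumes [measurable]: "f \<in> borel_measurable borel" "g \<in> borel_measurable borel"
  shows "l2sq (\<lambda>x. f x + g x) \<le> 2 * l2sq f + 2 * l2sq g"
proof -
  have "l2sq (\<lambda>x. f x + g x) \<le> (\<integral>\<^sup>+x. 2 * ennreal ((norm (f x))\<^sup>2) + 2 * ennreal ((norm (g x))\<^sup>2) \<partial>lborel)"
    unfolding l2sq_def
  proof (rule nn_integral_mono)
    fix x
    have "ennreal ((norm (f x + g x))\<^sup>2) \<le> ennreal (2 * (norm (f x))\<^sup>2 + 2 * (norm (g x))\<^sup>2)"
      by (intro ennreal_leI norm_add_sq_le)
    then show "ennreal ((norm (f x + g x))\<^sup>2) \<le> 2 * ennreal ((norm (f x))\<^sup>2) + 2 * ennreal ((norm (g x))\<^sup>2)"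
      by (simp add: ennreal_mult)
  qed
  then show ?thesis
    by (simp add: l2sq_def nn_integral_add nn_integral_cmult)
qed

lemma l2sq_diff_le:
  assumes "f \<in> borel_measurable borel" "g \<in> borel_measurable borel"
  shows "l2sq (\<lambda>x. f x - g x) \<le> 2 * l2sq f + 2 * l2sq g"
  using l2sq_add_le[OF assms(1) borel_measurable_uminus[OF assms(2)]] by (simp add: l2sq_def)

lemma l2sq_cmult:
  assumes [measurable]: "f \<in> borel_measurable borel"
  shows "l2sq (\<lambda>x. c * f x) = ennreal ((norm c)\<^sup>2) * l2sq f"
  unfolding l2sq_def by (subst nn_integral_cmult[symmetric]) (auto simp: norm_mult power_mult_distrib ennreal_mult)

lemma l2sq_scale:
  assumes [measurable]: "f \<in> borel_measurable borel" and "0 < r"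
  shows "l2sq f = ennreal (r ^ 3) * l2sq (\<lambda>x. f (r *\<^sub>R x))"
  unfolding l2sq_def using nn_integral_lborel_affine[of "\<lambda>x. ennreal ((norm (f x))\<^sup>2)" r 0] assms(2) by simp

lemma Cauchy_Schwarz_l2sq:
  assumes [measurable]: "f \<in> borel_measurable borel" "g \<in> borel_measurable borel"
  shows "(\<integral>\<^sup>+x. ennreal (norm (f x * g x)) \<partial>lborel)\<^sup>2 \<le> l2sq f * l2sq g"
  using Cauchy_Schwarz_nn_integral[of "\<lambda>x. ennreal (norm (f x))" lborel "\<lambda>x. ennreal (norm (g x))"]
  by (simp add: l2sq_def norm_mult ennreal_mult ennreal_power)

lemma integrable_l2_mult:
  assumes [measurable]: "f \<in> borel_measurable borel" "g \<in> borel_measurable borel"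
    and "l2sq f < \<infinity>" "l2sq g < \<infinity>"
  shows "integrable lborel (\<lambda>x. f x * g x)"
proof (rule integrableI_bounded)
  have "(\<integral>\<^sup>+x. ennreal (norm (f x * g x)) \<partial>lborel)\<^sup>2 < \<infinity>"
    using Cauchy_Schwarz_l2sq[OF assms(1,2)] assms(3,4) by (simp add: ennreal_mult_less_top order_le_less_trans)
  then show "(\<integral>\<^sup>+x. ennreal (norm (f x * g x)) \<partial>lborel) < \<infinity>"
    by (auto simp: power2_eq_square ennreal_mult_less_top)
qed measurable

lemma l2sq_bounded_mult:
  assumes [measurable]: "f \<in> borel_measurable borel" and "\<And>x. norm (g x) \<le> B" "l2sq f < \<infinity>"
  shows "l2sq (\<lambda>x. g x * f x) < \<infinity>"
proof -
  have "norm (g x * f x) \<le> norm (of_real B * f x)" for x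
    using assms(2)[of x] norm_ge_zero[of "g x"] by (simp add: norm_mult mult_right_mono)
  then have "l2sq (\<lambda>x. g x * f x) \<le> l2sq (\<lambda>x. of_real B * f x)"
    by (rule l2sq_mono)
  also have "\<dots> < \<infinity>"
    using assms(3) by (subst l2sq_cmult) (auto simp: ennreal_mult_less_top)
  finally show ?thesis .
qed

lemma schwartz_l2sq:
  assumes "\<phi> \<in> schwartz"
  shows "l2sq \<phi> < \<infinity>"
proof -
  obtain B where B: "\<And>x. norm (\<phi> x) \<le> B" using schwartz_bounded[OF assms] by blast
  have "l2sq \<phi> \<le> (\<integral>\<^sup>+x. ennreal B * ennreal (norm (\<phi> x)) \<partial>lborel)"
    unfolding l2sq_def
  proof (rule nn_integral_mono)
    fix x
    have "0 \<le> B" using B[of x] norm_ge_zero order_trans by blast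
    then show "ennreal ((norm (\<phi> x))\<^sup>2) \<le> ennreal B * ennreal (norm (\<phi> x))"
      using B[of x] by (simp add: power2_eq_square mult_right_mono ennreal_leI flip: ennreal_mult)
  qed
  also have "\<dots> = ennreal B * (\<integral>\<^sup>+x. ennreal (norm (\<phi> x)) \<partial>lborel)"
    using schwartz_measurable[OF assms] by (intro nn_integral_cmult) simp
  also have "\<dots> < \<infinity>"
    using nn_integral_norm_finite[OF schwartz_integrable[OF assms]] by (simp add: ennreal_mult_less_top)
  finally show ?thesis .
qed

lemma tendsto_integral_l2:
  assumes [measurable]: "\<And>n. f n \<in> borel_measurable borel" "G \<in> borel_measurable borel" "g \<in> borel_measurable borel"
    and fin: "\<And>n. l2sq (f n) < \<infinity>" "l2sq G < \<infinity>" "l2sq g < \<infinity>"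
    and lim: "(\<lambda>n. l2sq (\<lambda>x. f n x - G x)) \<longlonglongrightarrow> 0"
  shows "(\<lambda>n. \<integral>x. f n x * g x \<partial>lborel) \<longlonglongrightarrow> (\<integral>x. G x * g x \<partial>lborel)"
proof (rule LIM_zero_cancel, rule tendsto_norm_zero_cancel)
  define d where "d n = norm ((\<integral>x. f n x * g x \<partial>lborel) - (\<integral>x. G x * g x \<partial>lborel))" for n
  have "ennreal ((d n)\<^sup>2) \<le> l2sq (\<lambda>x. f n x - G x) * l2sq g" for n
  proof -
    have "(\<integral>x. f n x * g x \<partial>lborel) - (\<integral>x. G x * g x \<partial>lborel) = (\<integral>x. (f n x - G x) * g x \<partial>lborel)"
      unfolding left_diff_distrib
      by (rule Bochner_Integration.integral_diff[symmetric]) (auto intro!: integrable_l2_mult fin)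
    then have "ennreal (d n) \<le> (\<integral>\<^sup>+x. ennreal (norm ((f n x - G x) * g x)) \<partial>lborel)"
      unfolding d_def by (simp only: norm_integral_le_nn_integral)
    then have "(ennreal (d n))\<^sup>2 \<le> (\<integral>\<^sup>+x. ennreal (norm ((f n x - G x) * g x)) \<partial>lborel)\<^sup>2"
      by (rule power_mono) simp
    also have "\<dots> \<le> l2sq (\<lambda>x. f n x - G x) * l2sq g"
      by (rule Cauchy_Schwarz_l2sq) measurable
    finally show ?thesis by (simp add: d_def ennreal_power)
  qed
  moreover have "(\<lambda>n. l2sq (\<lambda>x. f n x - G x) * l2sq g) \<longlonglongrightarrow> 0 * l2sq g"
    using ennreal_tendsto_cmult[OF fin(3)[simplified] lim] by (simp add: mult.commute)
  ultimately have "(\<lambda>n. ennreal ((d n)\<^sup>2)) \<longlonglongrightarrow> 0"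
    by (intro tendsto_sandwich[of "\<lambda>_. 0" "\<lambda>n. ennreal ((d n)\<^sup>2)" sequentially "\<lambda>n. l2sq (\<lambda>x. f n x - G x) * l2sq g" 0]) auto
  then have "(\<lambda>n. (d n)\<^sup>2) \<longlonglongrightarrow> 0"
    by (simp add: ennreal_tendsto_0_iff)
  then have "(\<lambda>n. sqrt ((d n)\<^sup>2)) \<longlonglongrightarrow> sqrt 0"
    by (rule tendsto_real_sqrt)
  then show "(\<lambda>n. norm ((\<integral>x. f n x * g x \<partial>lborel) - (\<integral>x. G x * g x \<partial>lborel))) \<longlonglongrightarrow> 0"
    by (simp add: d_def)
qed

text \<open>Riesz-Fischer completeness at a prescribed rate. The squared increments are of order
  16^-n, hence still summable after multiplication by 4^n. Almost everywhere this bounds the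
  increments themselves by a multiple of 2^-n, so the sequence converges; Fatou's lemma turns this
  into convergence in L^2.\<close>

lemma l2_complete:
  fixes f :: "nat \<Rightarrow> real^3 \<Rightarrow> complex"
  assumes [measurable]: "\<And>n. f n \<in> borel_measurable borel"
    and cauchy: "\<And>n m. l2sq (\<lambda>x. f n x - f m x) \<le> ennreal (1 / 16 ^ n + 1 / 16 ^ m)"
  shows "\<exists>F \<in> borel_measurable borel. (\<lambda>n. l2sq (\<lambda>x. f n x - F x)) \<longlonglongrightarrow> 0"
proof -
  \<comment> \<open>On the null set where the sequence diverges, \<open>lim\<close> is an
    unspecified value, which does not affect the L^2 norm.\<close>
  define F where "F x = lim (\<lambda>n. f n x)" for x
  have [measurable]: "F \<in> borel_measurable borel"
    unfolding F_def by measurable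
  let ?S = "\<lambda>x. \<Sum>n. ennreal (4 ^ n * (norm (f (Suc n) x - f n x))\<^sup>2)"
  have "(\<integral>\<^sup>+x. ?S x \<partial>lborel) = (\<Sum>n. \<integral>\<^sup>+x. ennreal (4 ^ n * (norm (f (Suc n) x - f n x))\<^sup>2) \<partial>lborel)"
    by (rule nn_integral_suminf) measurable
  also have "\<dots> \<le> (\<Sum>n. ennreal (2 * (1 / 4) ^ n))"
  proof (rule suminf_le)
    fix n
    have "(\<integral>\<^sup>+x. ennreal (4 ^ n * (norm (f (Suc n) x - f n x))\<^sup>2) \<partial>lborel) = ennreal (4 ^ n) * l2sq (\<lambda>x. f (Suc n) x - f n x)"
      unfolding l2sq_def by (subst nn_integral_cmult[symmetric]) (auto simp: ennreal_mult)
    also have "\<dots> \<le> ennreal (4 ^ n) * ennreal (1 / 16 ^ Suc n + 1 / 16 ^ n)"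
      by (intro mult_left_mono cauchy) auto
    also have "\<dots> = ennreal (4 ^ n * (1 / 16 ^ Suc n + 1 / 16 ^ n))"
      by (rule ennreal_mult[symmetric]) auto
    also have "\<dots> \<le> ennreal (2 * (1 / 4) ^ n)"
    proof (rule ennreal_leI)
      have *: "(16::real) ^ n = 4 ^ n * 4 ^ n"
        by (simp flip: power_mult_distrib)
      show "4 ^ n * (1 / 16 ^ Suc n + 1 / 16 ^ n) \<le> 2 * (1 / 4 :: real) ^ n"
        unfolding power_Suc * by (simp add: field_simps)
    qed
    finally show "(\<integral>\<^sup>+x. ennreal (4 ^ n * (norm (f (Suc n) x - f n x))\<^sup>2) \<partial>lborel) \<le> ennreal (2 * (1 / 4) ^ n)" .
  qed auto
  also have "\<dots> = ennreal (2 * (1 / (1 - 1 / 4)))"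
    by (intro suminf_ennreal_eq sums_mult geometric_sums) auto
  also have "\<dots> < \<infinity>" by simp
  finally have "(\<integral>\<^sup>+x. ?S x \<partial>lborel) \<noteq> \<infinity>" by simp
  then have "AE x in lborel. ?S x \<noteq> \<infinity>"
    by (intro nn_integral_noteq_infinite) auto
  then have conv: "AE x in lborel. (\<lambda>n. f n x) \<longlonglongrightarrow> F x"
  proof eventually_elim
    case (elim x)
    have "\<exists>B\<ge>0. z = ennreal B" if "z \<noteq> \<infinity>" for z :: ennreal
      using that by (cases z) auto
    from this[OF elim] obtain B where B: "?S x = ennreal B" "0 \<le> B"
      by (elim exE conjE)
    have "norm (f (Suc n) x - f n x) \<le> sqrt B * (1 / 2) ^ n" for n
    proof -
      have "ennreal (4 ^ n * (norm (f (Suc n) x - f n x))\<^sup>2) \<le> ennreal B"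
        unfolding B(1)[symmetric] by (rule ennreal_le_suminf)
      then have "4 ^ n * (norm (f (Suc n) x - f n x))\<^sup>2 \<le> B"
        using B(2) by (simp add: ennreal_le_iff)
      moreover have "(4::real) ^ n = (2 ^ n)\<^sup>2"
        by (simp add: power2_eq_square flip: power_mult_distrib)
      ultimately have "(2 ^ n * norm (f (Suc n) x - f n x))\<^sup>2 \<le> B"
        by (simp add: power_mult_distrib)
      then have "2 ^ n * norm (f (Suc n) x - f n x) \<le> sqrt B"
        by (rule real_le_rsqrt)
      then show ?thesis
        by (simp add: field_simps)
    qed
    moreover have "summable (\<lambda>n. sqrt B * (1 / 2) ^ n)"
      by (intro summable_mult summable_geometric) simp
    ultimately have "summable (\<lambda>n. f (Suc n) x - f n x)"
      using summable_comparison_test'[of "\<lambda>n. sqrt B * (1 / 2) ^ n" 0 "\<lambda>n. f (Suc n) x - f n x"] by blast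
    then have "convergent (\<lambda>n. \<Sum>i<n. f (Suc i) x - f i x)"
      by (simp only: summable_iff_convergent)
    then have "convergent (\<lambda>n. f n x - f 0 x)"
      by (simp only: sum_lessThan_telescope[of "\<lambda>n. f n x"])
    then have "convergent (\<lambda>n. f n x)"
      by (simp only: convergent_diff_const_right_iff)
    then show "(\<lambda>n. f n x) \<longlonglongrightarrow> F x"
      unfolding F_def by (rule convergent_LIMSEQ_iff[THEN iffD1])
  qed
  have "l2sq (\<lambda>x. f n x - F x) \<le> ennreal (2 / 16 ^ n)" for n
  proof -
    have "l2sq (\<lambda>x. f n x - F x) = (\<integral>\<^sup>+x. liminf (\<lambda>m. ennreal ((norm (f n x - f m x))\<^sup>2)) \<partial>lborel)"
      unfolding l2sq_def
      using conv
    proof (intro nn_integral_cong_AE, eventually_elim)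
      case (elim x)
      then have "(\<lambda>m. ennreal ((norm (f n x - f m x))\<^sup>2)) \<longlonglongrightarrow> ennreal ((norm (f n x - F x))\<^sup>2)"
        by (intro tendsto_ennrealI tendsto_power tendsto_norm tendsto_diff tendsto_const)
      then show ?case
        by (intro lim_imp_Liminf[symmetric]) auto
    qed
    also have "\<dots> \<le> liminf (\<lambda>m. l2sq (\<lambda>x. f n x - f m x))"
      unfolding l2sq_def by (rule nn_integral_liminf) measurable
    also have "\<dots> \<le> liminf (\<lambda>m. ennreal (2 / 16 ^ n))"
    proof (rule Liminf_mono, rule eventually_sequentiallyI[of n])
      fix m assume "n \<le> m"
      then have "(1::real) / 16 ^ m \<le> 1 / 16 ^ n"
        by (intro divide_left_mono power_increasing) auto
      then show "l2sq (\<lambda>x. f n x - f m x) \<le> ennreal (2 / 16 ^ n)"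
        by (intro order_trans[OF cauchy] ennreal_leI) (simp add: add_divide_distrib[symmetric] field_simps)
    qed
    finally show ?thesis by (simp add: Liminf_const)
  qed
  moreover have "(\<lambda>n. ennreal (2 / 16 ^ n)) \<longlonglongrightarrow> 0"
    by (subst ennreal_tendsto_0_iff) (auto intro: LIMSEQ_divide_realpow_zero)
  ultimately have "(\<lambda>n. l2sq (\<lambda>x. f n x - F x)) \<longlonglongrightarrow> 0"
    by (intro tendsto_sandwich[of "\<lambda>_. 0" "\<lambda>n. l2sq (\<lambda>x. f n x - F x)" sequentially "\<lambda>n. ennreal (2 / 16 ^ n)" 0]) auto
  then show ?thesis
    by (intro bexI[of _ F]) auto
qed

text \<open>\<open>G\<close> is the inverse Fourier transform of \<open>k \<in> L\<^sup>2\<close>, expressed through approximations of \<open>k\<close> for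
  which the transform is given by the integral.\<close>

definition fourier_pair :: "(real^3 \<Rightarrow> complex) \<Rightarrow> (real^3 \<Rightarrow> complex) \<Rightarrow> bool" where
  "fourier_pair G k \<longleftrightarrow> G \<in> borel_measurable borel \<and> k \<in> borel_measurable borel \<and> l2sq k < \<infinity> \<and>
     (\<exists>kn. (\<forall>n. moments (kn n)) \<and> (\<forall>n \<xi>. norm (kn n \<xi>) \<le> norm (k \<xi>)) \<and>
        (\<forall>\<xi>. (\<lambda>n. kn n \<xi>) \<longlonglongrightarrow> k \<xi>) \<and> (\<lambda>n. l2sq (\<lambda>x. inv_fourier (kn n) x - G x)) \<longlonglongrightarrow> 0)"

text \<open>On a ball the polynomial factor is bounded and |k| <= 1 + |k|^2, so the finite volume of
  the ball and the finite L^2 norm of k control every moment.\<close>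

lemma moments_truncate:
  assumes [measurable]: "k \<in> borel_measurable borel" and "l2sq k < \<infinity>"
  shows "moments (\<lambda>\<xi>. if norm \<xi> \<le> R then k \<xi> else 0)"
  unfolding moments_def
proof (intro conjI allI)
  show "(\<lambda>\<xi>. if norm \<xi> \<le> R then k \<xi> else 0) \<in> borel_measurable borel"
    by measurable
  fix N
  have [measurable]: "cball (0 :: real^3) R \<in> sets borel"
    by (intro borel_closed closed_cball)
  show "integrable lborel (\<lambda>\<xi>. (1 + norm \<xi>) ^ N * norm (if norm \<xi> \<le> R then k \<xi> else 0))"
  proof (rule integrableI_bounded)
    have "(\<integral>\<^sup>+\<xi>. ennreal (norm ((1 + norm \<xi>) ^ N * norm (if norm \<xi> \<le> R then k \<xi> else 0))) \<partial>lborel)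
      \<le> (\<integral>\<^sup>+\<xi>. ennreal ((1 + \<bar>R\<bar>) ^ N) * (indicator (cball 0 R) \<xi> + ennreal ((norm (k \<xi>))\<^sup>2)) \<partial>lborel)"
    proof (rule nn_integral_mono)
      fix \<xi> :: "real^3"
      show "ennreal (norm ((1 + norm \<xi>) ^ N * norm (if norm \<xi> \<le> R then k \<xi> else 0)))
        \<le> ennreal ((1 + \<bar>R\<bar>) ^ N) * (indicator (cball 0 R) \<xi> + ennreal ((norm (k \<xi>))\<^sup>2))"
      proof (cases "norm \<xi> \<le> R")
        case True
        have "a \<le> 1 + a\<^sup>2" for a :: real
        proof -
          have "0 \<le> (a - 1)\<^sup>2" "0 \<le> a\<^sup>2" by simp_all
          moreover have "(a - 1)\<^sup>2 = a\<^sup>2 - 2 * a + 1"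
            by (simp add: power2_diff)
          ultimately show ?thesis by linarith
        qed
        from this[of "norm (k \<xi>)"]
        have "(1 + norm \<xi>) ^ N * norm (k \<xi>) \<le> (1 + \<bar>R\<bar>) ^ N * (1 + (norm (k \<xi>))\<^sup>2)"
          using True by (intro mult_mono power_mono) auto
        then show ?thesis
          using True by (simp add: ennreal_leI ennreal_mult[symmetric] ennreal_plus[symmetric] ennreal_1[symmetric] del: ennreal_plus ennreal_1)
      qed simp
    qed
    also have "\<dots> = ennreal ((1 + \<bar>R\<bar>) ^ N) * (emeasure lborel (cball (0::real^3) R) + l2sq k)"
      by (subst nn_integral_cmult) (simp_all add: nn_integral_add l2sq_def)
    also have "\<dots> < \<infinity>"
      using assms(2) emeasure_lborel_cball_finite[of "0::real^3" R] by (simp add: ennreal_mult_less_top)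
    finally show "(\<integral>\<^sup>+\<xi>. ennreal (norm ((1 + norm \<xi>) ^ N * norm (if norm \<xi> \<le> R then k \<xi> else 0))) \<partial>lborel) < \<infinity>" .
  qed measurable
qed

lemma inv_fourier_diff:
  assumes "integrable lborel k" "integrable lborel g"
  shows "inv_fourier k x - inv_fourier g x = inv_fourier (\<lambda>\<xi>. k \<xi> - g \<xi>) x"
proof -
  have "(\<integral>\<xi>. cis (x \<bullet> \<xi>) * (k \<xi> - g \<xi>) \<partial>lborel) = (\<integral>\<xi>. cis (x \<bullet> \<xi>) * k \<xi> \<partial>lborel) - (\<integral>\<xi>. cis (x \<bullet> \<xi>) * g \<xi> \<partial>lborel)"
    unfolding right_diff_distrib
    by (intro Bochner_Integration.integral_diff integrable_cis_mult assms) measurable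
  then show ?thesis
    by (simp add: inv_fourier_alt right_diff_distrib)
qed

theorem fourier_pair_exists:
  assumes [measurable]: "k \<in> borel_measurable borel" and k2: "l2sq k < \<infinity>"
  shows "\<exists>G. fourier_pair G k"
proof -
  define T where "T R = (\<integral>\<^sup>+\<xi>. ennreal ((norm (k \<xi>))\<^sup>2) * indicator {\<xi>. R < norm \<xi>} \<xi> \<partial>lborel)" for R :: real
  have "(\<lambda>n. T (real n)) \<longlonglongrightarrow> (\<integral>\<^sup>+\<xi>. 0 \<partial>(lborel :: (real^3) measure))"
    unfolding T_def
  proof (rule nn_integral_dominated_convergence[where w = "\<lambda>\<xi>. ennreal ((norm (k \<xi>))\<^sup>2)"])
    show "AE \<xi> in lborel. (\<lambda>n. ennreal ((norm (k \<xi>))\<^sup>2) * indicator {\<xi>. real n < norm \<xi>} \<xi>) \<longlonglongrightarrow> 0"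
    proof (intro AE_I2 tendsto_eventually)
      fix \<xi> :: "real^3"
      obtain n0 where "norm \<xi> \<le> real n0" using real_arch_simple by blast
      then show "\<forall>\<^sub>F n in sequentially. ennreal ((norm (k \<xi>))\<^sup>2) * indicator {\<xi>. real n < norm \<xi>} \<xi> = 0"
        by (intro eventually_sequentiallyI[of n0]) (auto simp: indicator_def)
    qed
    show "(\<integral>\<^sup>+\<xi>. ennreal ((norm (k \<xi>))\<^sup>2) \<partial>lborel) < \<infinity>"
      using k2 by (simp add: l2sq_def)
  qed (auto simp: indicator_def)
  then have T0: "(\<lambda>n. T (real n)) \<longlonglongrightarrow> 0" by simp
  \<comment> \<open>The radii are selected so that the part of k beyond the n-th one has squared
    norm at most 16^-(n+1), the rate that \<open>l2_complete\<close> asks for. The condition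
    \<open>n \<le> m\<close> makes the truncations eventually equal to k at each point.\<close>
  have "\<exists>m\<ge>n. T (real m) \<le> ennreal (1 / 16 ^ Suc n)" for n
  proof -
    have "\<forall>\<^sub>F m in sequentially. T (real m) < ennreal (1 / 16 ^ Suc n)"
      by (rule order_tendstoD(2)[OF T0]) simp
    then obtain m0 where "\<And>m. m0 \<le> m \<Longrightarrow> T (real m) < ennreal (1 / 16 ^ Suc n)"
      unfolding eventually_sequentially by blast
    then show ?thesis
      by (intro exI[of _ "max n m0"]) (auto intro: less_imp_le)
  qed
  then obtain r where r: "\<And>n. n \<le> r n" "\<And>n. T (real (r n)) \<le> ennreal (1 / 16 ^ Suc n)"
    by metis
  define kn where "kn n \<xi> = (if norm \<xi> \<le> real (r n) then k \<xi> else 0)" for n \<xi>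
  have km: "moments (kn n)" for n
    unfolding kn_def by (intro moments_truncate assms)
  have [measurable]: "kn n \<in> borel_measurable borel" for n
    by (rule moments_measurable[OF km])
  have "l2sq (\<lambda>x. inv_fourier (kn n) x - inv_fourier (kn m) x) \<le> ennreal (1 / 16 ^ n + 1 / 16 ^ m)" for n m
  proof -
    have ik: "integrable lborel (kn i)" for i
      by (intro moments_integrable km)
    have "l2sq (\<lambda>x. inv_fourier (kn n) x - inv_fourier (kn m) x) \<le> l2sq (\<lambda>\<xi>. kn n \<xi> - kn m \<xi>)"
      unfolding inv_fourier_diff[OF ik ik] l2sq_def
      by (intro Plancherel_inequality_inv Bochner_Integration.integrable_diff ik)
    also have "\<dots> \<le> (\<integral>\<^sup>+\<xi>. ennreal ((norm (k \<xi>))\<^sup>2) * indicator {\<xi>. real (r n) < norm \<xi>} \<xi>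
        + ennreal ((norm (k \<xi>))\<^sup>2) * indicator {\<xi>. real (r m) < norm \<xi>} \<xi> \<partial>lborel)"
      unfolding l2sq_def by (intro nn_integral_mono) (auto simp: kn_def indicator_def)
    also have "\<dots> = T (real (r n)) + T (real (r m))"
      unfolding T_def by (intro nn_integral_add) auto
    also have "\<dots> \<le> ennreal (1 / 16 ^ Suc n) + ennreal (1 / 16 ^ Suc m)"
      by (intro add_mono r)
    also have "\<dots> = ennreal (1 / 16 ^ Suc n + 1 / 16 ^ Suc m)"
      by simp
    also have "\<dots> \<le> ennreal (1 / 16 ^ n + 1 / 16 ^ m)"
      by (intro ennreal_leI add_mono) (auto simp: field_simps)
    finally show ?thesis .
  qed
  then obtain G where G: "G \<in> borel_measurable borel" "(\<lambda>n. l2sq (\<lambda>x. inv_fourier (kn n) x - G x)) \<longlonglongrightarrow> 0"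
    using l2_complete[of "\<lambda>n. inv_fourier (kn n)"] by (auto intro: inv_fourier_measurable)
  have "(\<lambda>n. kn n \<xi>) \<longlonglongrightarrow> k \<xi>" for \<xi>
  proof (rule tendsto_eventually)
    obtain n0 where "norm \<xi> \<le> real n0" using real_arch_simple by blast
    then show "\<forall>\<^sub>F n in sequentially. kn n \<xi> = k \<xi>"
      unfolding kn_def using r(1) by (intro eventually_sequentiallyI[of n0]) (smt (verit) of_nat_le_iff)
  qed
  moreover have "norm (kn n \<xi>) \<le> norm (k \<xi>)" for n \<xi>
    by (simp add: kn_def)
  ultimately have "fourier_pair G k"
    unfolding fourier_pair_def using G km k2 by (intro conjI exI[of _ kn]) auto
  then show ?thesis by blast
qed

lemma fourier_pair_measurable [measurable_dest]:
  "fourier_pair G k \<Longrightarrow> G \<in> borel_measurable borel" "fourier_pair G k \<Longrightarrow> k \<in> borel_measurable borel"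
  by (auto simp: fourier_pair_def)

text \<open>The factor 2 stems from |a + b|^2 <= 2|a|^2 + 2|b|^2, with G split into a transform of
  an approximation and an error that vanishes in the limit.\<close>

lemma fourier_pair_l2sq:
  assumes "fourier_pair G k"
  shows "l2sq G \<le> 2 * l2sq k"
proof -
  obtain kn where kn: "\<And>n. moments (kn n)" "\<And>n \<xi>. norm (kn n \<xi>) \<le> norm (k \<xi>)"
    "(\<lambda>n. l2sq (\<lambda>x. inv_fourier (kn n) x - G x)) \<longlonglongrightarrow> 0"
    using assms unfolding fourier_pair_def by blast
  note [measurable] = fourier_pair_measurable[OF assms]
  have [measurable]: "inv_fourier (kn n) \<in> borel_measurable borel" for n
    by (intro inv_fourier_measurable moments_measurable kn)
  have "l2sq G \<le> 2 * l2sq k + 2 * l2sq (\<lambda>x. inv_fourier (kn n) x - G x)" for n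
  proof -
    have "l2sq G \<le> 2 * l2sq (inv_fourier (kn n)) + 2 * l2sq (\<lambda>x. inv_fourier (kn n) x - G x)"
      using l2sq_diff_le[of "inv_fourier (kn n)" "\<lambda>x. inv_fourier (kn n) x - G x"] by simp
    also have "l2sq (inv_fourier (kn n)) \<le> l2sq (kn n)"
      unfolding l2sq_def by (intro Plancherel_inequality_inv moments_integrable kn)
    also have "l2sq (kn n) \<le> l2sq k"
      by (intro l2sq_mono kn)
    finally show ?thesis by (simp add: mult_left_mono add_right_mono)
  qed
  moreover have "(\<lambda>n. 2 * l2sq k + 2 * l2sq (\<lambda>x. inv_fourier (kn n) x - G x)) \<longlonglongrightarrow> 2 * l2sq k + 2 * 0"
    by (intro tendsto_add tendsto_const ennreal_tendsto_cmult kn) auto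
  ultimately show ?thesis
    by (intro LIMSEQ_le_const[of _ "2 * l2sq k"]) auto
qed

lemma fourier_pair_finite:
  assumes "fourier_pair G k"
  shows "l2sq G < \<infinity>" "l2sq k < \<infinity>"
proof -
  show "l2sq k < \<infinity>" using assms by (simp add: fourier_pair_def)
  then show "l2sq G < \<infinity>"
    using fourier_pair_l2sq[OF assms] by (simp add: ennreal_mult_less_top order_le_less_trans)
qed

lemma fourier_pair_test:
  assumes "fourier_pair G k" "\<phi> \<in> schwartz"
  shows "(\<integral>x. G x * \<phi> x \<partial>lborel) = (\<integral>\<xi>. k \<xi> * inv_fourier \<phi> \<xi> \<partial>lborel)"
proof -
  obtain kn where kn: "\<And>n. moments (kn n)" "\<And>n \<xi>. norm (kn n \<xi>) \<le> norm (k \<xi>)" "\<And>\<xi>. (\<lambda>n. kn n \<xi>) \<longlonglongrightarrow> k \<xi>"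
    "(\<lambda>n. l2sq (\<lambda>x. inv_fourier (kn n) x - G x)) \<longlonglongrightarrow> 0"
    using assms unfolding fourier_pair_def by blast
  note [measurable] = fourier_pair_measurable[OF assms(1)] moments_measurable[OF kn(1)] schwartz_measurable[OF assms(2)]
  have [measurable]: "inv_fourier (kn n) \<in> borel_measurable borel" for n
    by (intro inv_fourier_measurable) measurable
  have [measurable]: "inv_fourier \<phi> \<in> borel_measurable borel"
    by (intro inv_fourier_measurable) measurable
  have "l2sq (inv_fourier (kn n)) \<le> l2sq k" for n
  proof -
    have "l2sq (inv_fourier (kn n)) \<le> l2sq (kn n)"
      unfolding l2sq_def by (intro Plancherel_inequality_inv moments_integrable kn)
    also have "\<dots> \<le> l2sq k" by (intro l2sq_mono kn)
    finally show ?thesis .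
  qed
  then have "l2sq (inv_fourier (kn n)) < \<infinity>" for n
    using fourier_pair_finite[OF assms(1)] order_le_less_trans by blast
  then have "(\<lambda>n. \<integral>x. inv_fourier (kn n) x * \<phi> x \<partial>lborel) \<longlonglongrightarrow> (\<integral>x. G x * \<phi> x \<partial>lborel)"
    by (intro tendsto_integral_l2 kn fourier_pair_finite[OF assms(1)] schwartz_l2sq[OF assms(2)]) auto
  moreover have "(\<integral>x. inv_fourier (kn n) x * \<phi> x \<partial>lborel) = (\<integral>\<xi>. kn n \<xi> * inv_fourier \<phi> \<xi> \<partial>lborel)" for n
    by (intro inv_fourier_mult_formula moments_integrable schwartz_integrable assms kn)
  moreover have "(\<lambda>n. \<integral>\<xi>. kn n \<xi> * inv_fourier \<phi> \<xi> \<partial>lborel) \<longlonglongrightarrow> (\<integral>\<xi>. k \<xi> * inv_fourier \<phi> \<xi> \<partial>lborel)"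
  proof (rule integral_dominated_convergence[where w = "\<lambda>\<xi>. norm (k \<xi> * inv_fourier \<phi> \<xi>)"])
    show "integrable lborel (\<lambda>\<xi>. norm (k \<xi> * inv_fourier \<phi> \<xi>))"
      by (intro integrable_norm integrable_l2_mult fourier_pair_finite[OF assms(1)] schwartz_l2sq inv_fourier_schwartz assms) auto
    show "AE \<xi> in lborel. (\<lambda>n. kn n \<xi> * inv_fourier \<phi> \<xi>) \<longlonglongrightarrow> k \<xi> * inv_fourier \<phi> \<xi>"
      by (intro AE_I2 tendsto_mult kn tendsto_const)
    show "AE \<xi> in lborel. norm (kn n \<xi> * inv_fourier \<phi> \<xi>) \<le> norm (k \<xi> * inv_fourier \<phi> \<xi>)" for n
      using kn(2) by (intro AE_I2) (simp add: norm_mult mult_right_mono)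
  qed auto
  ultimately show ?thesis
    using LIMSEQ_unique by simp
qed

text \<open>The pieces of the second factor live at scale 2^l, the piece of the product at scale
  2^j. This lemma moves one to the other, with r = 2^j / 2^l.\<close>

lemma fourier_pair_dilate:
  assumes "fourier_pair G k" "0 < r"
  shows "fourier_pair (\<lambda>x. G (r *\<^sub>R x)) (\<lambda>\<xi>. k ((1 / r) *\<^sub>R \<xi>) / of_real (r ^ 3))"
proof -
  obtain kn where kn: "\<And>n. moments (kn n)" "\<And>n \<xi>. norm (kn n \<xi>) \<le> norm (k \<xi>)" "\<And>\<xi>. (\<lambda>n. kn n \<xi>) \<longlonglongrightarrow> k \<xi>"
    "(\<lambda>n. l2sq (\<lambda>x. inv_fourier (kn n) x - G x)) \<longlonglongrightarrow> 0"
    using assms unfolding fourier_pair_def by blast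
  note [measurable] = fourier_pair_measurable[OF assms(1)] moments_measurable[OF kn(1)]
  have [measurable]: "inv_fourier (kn n) \<in> borel_measurable borel" for n
    by (intro inv_fourier_measurable) measurable
  define kn' where "kn' n \<xi> = kn n ((1 / r) *\<^sub>R \<xi>) / of_real (r ^ 3)" for n \<xi>
  have 1: "moments (kn' n)" for n
    unfolding moments_def
  proof (intro conjI allI)
    show "kn' n \<in> borel_measurable borel" unfolding kn'_def by measurable
    fix N
    have "integrable lborel (\<lambda>\<xi>. ((1 + r) ^ N / r ^ 3) * ((1 + norm ((1 / r) *\<^sub>R \<xi>)) ^ N * norm (kn n ((1 / r) *\<^sub>R \<xi>))))"
      using kn(1)[of n] integrable_lborel_affine_iff[of "\<lambda>\<xi>. (1 + norm \<xi>) ^ N * norm (kn n \<xi>)" "1 / r" 0] assms(2)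
      by (intro integrable_mult_right) (auto simp: moments_def)
    then show "integrable lborel (\<lambda>\<xi>. (1 + norm \<xi>) ^ N * norm (kn' n \<xi>))"
    proof (rule Bochner_Integration.integrable_bound)
      show "AE \<xi> in lborel. norm ((1 + norm \<xi>) ^ N * norm (kn' n \<xi>))
        \<le> norm (((1 + r) ^ N / r ^ 3) * ((1 + norm ((1 / r) *\<^sub>R \<xi>)) ^ N * norm (kn n ((1 / r) *\<^sub>R \<xi>))))"
      proof (rule AE_I2)
        fix \<xi> :: "real^3"
        have "1 + norm \<xi> \<le> (1 + r) * (1 + norm ((1 / r) *\<^sub>R \<xi>))"
          using assms(2) by (simp add: field_simps)
        then have "(1 + norm \<xi>) ^ N \<le> (1 + r) ^ N * (1 + norm ((1 / r) *\<^sub>R \<xi>)) ^ N"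
          by (metis power_mono power_mult_distrib add_nonneg_nonneg norm_ge_zero zero_le_one)
        then have "(1 + norm \<xi>) ^ N * norm (kn n ((1 / r) *\<^sub>R \<xi>)) \<le> (1 + r) ^ N * (1 + norm ((1 / r) *\<^sub>R \<xi>)) ^ N * norm (kn n ((1 / r) *\<^sub>R \<xi>))"
          by (intro mult_right_mono) auto
        from divide_right_mono[OF this, of "r ^ 3"]
        show "norm ((1 + norm \<xi>) ^ N * norm (kn' n \<xi>)) \<le> norm (((1 + r) ^ N / r ^ 3) * ((1 + norm ((1 / r) *\<^sub>R \<xi>)) ^ N * norm (kn n ((1 / r) *\<^sub>R \<xi>))))"
          using assms(2) by (simp add: kn'_def norm_divide norm_mult norm_power mult.assoc abs_mult)
      qed
    qed (auto simp: kn'_def)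
  qed
  have inv: "inv_fourier (kn' n) x = inv_fourier (kn n) (r *\<^sub>R x)" for n x
  proof -
    have "(\<integral>\<xi>. cis (x \<bullet> \<xi>) * kn' n \<xi> \<partial>lborel) = r ^ 3 *\<^sub>R (\<integral>\<xi>. cis (x \<bullet> (r *\<^sub>R \<xi>)) * kn' n (r *\<^sub>R \<xi>) \<partial>lborel)"
      using integral_lborel_affine[of "\<lambda>\<xi>. cis (x \<bullet> \<xi>) * kn' n \<xi>" r 0] moments_measurable[OF 1] assms(2) by simp
    also have "\<dots> = (\<integral>\<xi>. cis ((r *\<^sub>R x) \<bullet> \<xi>) * kn n \<xi> \<partial>lborel)"
      using assms(2) by (simp add: kn'_def scaleR_conv_of_real[where 'a = complex])
    finally show ?thesis by (simp add: inv_fourier_alt)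
  qed
  have sc: "ennreal (1 / r ^ 3) * (ennreal (r ^ 3) * z) = z" for z
    using assms(2) by (simp flip: mult.assoc ennreal_mult)
  have l2r: "l2sq (\<lambda>x. f (r *\<^sub>R x)) = ennreal (1 / r ^ 3) * l2sq f" if "f \<in> borel_measurable borel" for f
    unfolding l2sq_scale[OF that assms(2)] sc ..
  have "(\<lambda>n. l2sq (\<lambda>x. inv_fourier (kn' n) x - G (r *\<^sub>R x))) \<longlonglongrightarrow> ennreal (1 / r ^ 3) * 0"
  proof -
    have "l2sq (\<lambda>x. inv_fourier (kn' n) x - G (r *\<^sub>R x)) = ennreal (1 / r ^ 3) * l2sq (\<lambda>x. inv_fourier (kn n) x - G x)" for n
      unfolding inv by (rule l2r) measurable
    then show ?thesis
      using kn(4) by (simp only:) (rule ennreal_tendsto_cmult, simp_all)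
  qed
  then have 2: "(\<lambda>n. l2sq (\<lambda>x. inv_fourier (kn' n) x - G (r *\<^sub>R x))) \<longlonglongrightarrow> 0" by simp
  have "l2sq (\<lambda>\<xi>. k ((1 / r) *\<^sub>R \<xi>) / of_real (r ^ 3)) = l2sq (\<lambda>\<xi>. of_real (1 / r ^ 3) * k ((1 / r) *\<^sub>R \<xi>))"
    by (simp add: l2sq_def norm_mult norm_divide)
  also have "\<dots> = ennreal ((norm (complex_of_real (1 / r ^ 3)))\<^sup>2) * l2sq (\<lambda>\<xi>. k ((1 / r) *\<^sub>R \<xi>))"
    by (rule l2sq_cmult) measurable
  finally have 3: "l2sq (\<lambda>\<xi>. k ((1 / r) *\<^sub>R \<xi>) / of_real (r ^ 3)) = ennreal ((norm (complex_of_real (1 / r ^ 3)))\<^sup>2) * l2sq (\<lambda>\<xi>. k ((1 / r) *\<^sub>R \<xi>))" .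
  have "l2sq k = ennreal ((1 / r) ^ 3) * l2sq (\<lambda>\<xi>. k ((1 / r) *\<^sub>R \<xi>))"
    using assms(2) by (intro l2sq_scale) auto
  then have 4: "l2sq (\<lambda>\<xi>. k ((1 / r) *\<^sub>R \<xi>)) < \<infinity>"
    using fourier_pair_finite(2)[OF assms(1)] assms(2) by (auto simp: ennreal_mult_less_top)
  have 5: "norm (kn' n \<xi>) \<le> norm (k ((1 / r) *\<^sub>R \<xi>) / of_real (r ^ 3))" for n \<xi>
    using kn(2)[of n "(1 / r) *\<^sub>R \<xi>"] assms(2) by (simp add: kn'_def norm_divide divide_right_mono)
  have 6: "(\<lambda>n. kn' n \<xi>) \<longlonglongrightarrow> k ((1 / r) *\<^sub>R \<xi>) / of_real (r ^ 3)" for \<xi>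
    unfolding kn'_def using assms(2) by (intro tendsto_divide kn tendsto_const) auto
  show ?thesis
    unfolding fourier_pair_def
  proof (intro conjI exI[of _ kn'] allI)
    show "l2sq (\<lambda>\<xi>. k ((1 / r) *\<^sub>R \<xi>) / complex_of_real (r ^ 3)) < \<infinity>"
      unfolding 3 using 4 by (simp add: ennreal_mult_less_top)
  qed (use 1 2 5 6 in auto)
qed


subsection \<open>Weighted bounds for convolutions\<close>

definition conv :: "(real^3 \<Rightarrow> complex) \<Rightarrow> (real^3 \<Rightarrow> complex) \<Rightarrow> real^3 \<Rightarrow> complex" where
  "conv h k \<zeta> = (\<integral>b. h (\<zeta> - b) * k b \<partial>lborel)"

text \<open>With values in \<open>ennreal\<close>, estimates can be stated before convergence is
  known. Where this value is infinite for measurable factors, \<open>conv\<close> is 0 by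
  convention.\<close>

definition abs_conv :: "(real^3 \<Rightarrow> complex) \<Rightarrow> (real^3 \<Rightarrow> complex) \<Rightarrow> real^3 \<Rightarrow> ennreal" where
  "abs_conv h k \<zeta> = (\<integral>\<^sup>+b. ennreal (norm (h (\<zeta> - b) * k b)) \<partial>lborel)"

definition weighted_l2sq :: "real \<Rightarrow> (real^3 \<Rightarrow> complex) \<Rightarrow> ennreal" where
  "weighted_l2sq s h = (\<integral>\<^sup>+\<xi>. ennreal (weight s \<xi> * (norm (h \<xi>))\<^sup>2) \<partial>lborel)"

lemma conv_measurable [measurable]:
  assumes [measurable]: "h \<in> borel_measurable borel" "k \<in> borel_measurable borel"
  shows "conv h k \<in> borel_measurable borel"
  unfolding conv_def by measurable

lemma abs_conv_measurable [measurable]: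
  assumes [measurable]: "h \<in> borel_measurable borel" "k \<in> borel_measurable borel"
  shows "abs_conv h k \<in> borel_measurable borel"
  unfolding abs_conv_def by measurable

lemma norm_conv_le: "ennreal (norm (conv h k \<zeta>)) \<le> abs_conv h k \<zeta>"
  unfolding conv_def abs_conv_def by (rule norm_integral_le_nn_integral)

lemma weighted_l2sq_zero: "weighted_l2sq 0 h = l2sq h"
  using weight_base_pos by (simp add: weighted_l2sq_def l2sq_def weight_def less_imp_neq[symmetric])

lemma weighted_l2sq_mono:
  assumes "s \<le> s'"
  shows "weighted_l2sq s h \<le> weighted_l2sq s' h"
  unfolding weighted_l2sq_def weight_def
  by (intro nn_integral_mono ennreal_leI mult_right_mono powr_mono assms) auto

lemma l2sq_le_weighted: "0 \<le> s \<Longrightarrow> l2sq h \<le> weighted_l2sq s h"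
  using weighted_l2sq_mono[of 0 s h] by (simp add: weighted_l2sq_zero)

lemma weighted_l2sq_conv_le:
  assumes [measurable]: "h \<in> borel_measurable borel" "k \<in> borel_measurable borel"
  shows "weighted_l2sq s (conv h k) \<le> (\<integral>\<^sup>+\<zeta>. ennreal (weight s \<zeta>) * (abs_conv h k \<zeta>)\<^sup>2 \<partial>lborel)"
  unfolding weighted_l2sq_def
proof (rule nn_integral_mono)
  fix \<zeta>
  have "ennreal ((norm (conv h k \<zeta>))\<^sup>2) \<le> (abs_conv h k \<zeta>)\<^sup>2"
    using power_mono[OF norm_conv_le[of h k \<zeta>], of 2] by (simp add: ennreal_power)
  then show "ennreal (weight s \<zeta> * (norm (conv h k \<zeta>))\<^sup>2) \<le> ennreal (weight s \<zeta>) * (abs_conv h k \<zeta>)\<^sup>2"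
    by (simp add: ennreal_mult mult_left_mono)
qed

text \<open>The part of the product where the frequency \<open>x\<close> of one factor dominates the frequency \<open>b\<close> of the
  other: the weight of the sum is absorbed by the weight of \<open>x\<close>.\<close>

lemma weight_sum_dominant:
  assumes "0 \<le> s" "s \<le> s1" "norm b \<le> norm x"
  shows "weight s (x + b) \<le> 4 powr s * (weight s1 x * (weight s2 b * weight (- (s1 + s2 - s)) b))"
proof -
  have "norm (x + b) \<le> 2 * norm x"
    using norm_triangle_ineq[of x b] assms(3) by linarith
  then have "(norm (x + b))\<^sup>2 \<le> (2 * norm x)\<^sup>2"
    by (intro power_mono) auto
  then have "1 + (norm (x + b))\<^sup>2 \<le> 4 * (1 + (norm x)\<^sup>2)"
    by (simp add: power_mult_distrib)
  then have "weight s (x + b) \<le> (4 * (1 + (norm x)\<^sup>2)) powr s"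
    unfolding weight_def using assms(1) by (intro powr_mono2) auto
  also have "\<dots> = 4 powr s * weight s x"
    unfolding weight_def by (rule powr_mult)
  also have "weight s x = weight s1 x * weight (s - s1) x"
    by (simp flip: weight_add)
  also have "weight (s - s1) x \<le> weight (s - s1) b"
    unfolding weight_def using assms(2,3) weight_base_pos[of b] by (intro powr_mono2') (auto intro: power_mono)
  also have "weight (s - s1) b = weight s2 b * weight (- (s1 + s2 - s)) b"
    by (simp flip: weight_add)
  finally show ?thesis
    by (simp add: mult_left_mono)
qed

text \<open>Whichever frequency dominates, one of the two summands on the right suffices. When
  \<open>x + b\<close> is fixed, both summands are integrable in b as soon as s1 + s2 - s >
  3/2.\<close>

lemma weight_sum_le:
  assumes "0 \<le> s" "s \<le> s1" "s \<le> s2"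
  shows "weight s (x + b) \<le> 4 powr s * (weight s1 x * weight s2 b * (weight (- (s1 + s2 - s)) b + weight (- (s1 + s2 - s)) x))"
proof (cases "norm b \<le> norm x")
  case True
  have "weight s (x + b) \<le> 4 powr s * (weight s1 x * (weight s2 b * weight (- (s1 + s2 - s)) b))"
    by (rule weight_sum_dominant[OF assms(1,2) True])
  also have "\<dots> \<le> 4 powr s * (weight s1 x * weight s2 b * (weight (- (s1 + s2 - s)) b + weight (- (s1 + s2 - s)) x))"
    unfolding mult.assoc by (intro mult_left_mono) auto
  finally show ?thesis .
next
  case False
  have "weight s (b + x) \<le> 4 powr s * (weight s2 b * (weight s1 x * weight (- (s2 + s1 - s)) x))"
    using False by (intro weight_sum_dominant assms) auto
  also have "\<dots> = 4 powr s * (weight s1 x * (weight s2 b * weight (- (s1 + s2 - s)) x))"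
    by (simp add: mult_ac add.commute)
  also have "\<dots> \<le> 4 powr s * (weight s1 x * weight s2 b * (weight (- (s1 + s2 - s)) b + weight (- (s1 + s2 - s)) x))"
    unfolding mult.assoc by (intro mult_left_mono) auto
  finally show ?thesis by (simp add: add.commute)
qed

lemma nn_integral_conv_product:
  fixes f g :: "real^3 \<Rightarrow> ennreal"
  assumes [measurable]: "f \<in> borel_measurable borel" "g \<in> borel_measurable borel"
  shows "(\<integral>\<^sup>+\<zeta>. \<integral>\<^sup>+b. f (\<zeta> - b) * g b \<partial>lborel \<partial>lborel) = (\<integral>\<^sup>+x. f x \<partial>lborel) * (\<integral>\<^sup>+b. g b \<partial>lborel)"
proof -
  have "(\<integral>\<^sup>+\<zeta>. \<integral>\<^sup>+b. f (\<zeta> - b) * g b \<partial>lborel \<partial>lborel) = (\<integral>\<^sup>+b. \<integral>\<^sup>+\<zeta>. f (\<zeta> - b) * g b \<partial>lborel \<partial>lborel)"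
    by (rule lborel_pair.Fubini'[symmetric]) measurable
  also have "\<dots> = (\<integral>\<^sup>+b. (\<integral>\<^sup>+x. f x \<partial>lborel) * g b \<partial>lborel)"
  proof (rule nn_integral_cong)
    fix b
    have "(\<integral>\<^sup>+\<zeta>. f (\<zeta> - b) * g b \<partial>lborel) = (\<integral>\<^sup>+\<zeta>. f (\<zeta> - b) \<partial>lborel) * g b"
      by (rule nn_integral_multc) measurable
    then show "(\<integral>\<^sup>+\<zeta>. f (\<zeta> - b) * g b \<partial>lborel) = (\<integral>\<^sup>+x. f x \<partial>lborel) * g b"
      using nn_integral_lborel_translate(2)[of f "- b"] by simp
  qed
  also have "\<dots> = (\<integral>\<^sup>+x. f x \<partial>lborel) * (\<integral>\<^sup>+b. g b \<partial>lborel)"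
    by (rule nn_integral_cmult) measurable
  finally show ?thesis .
qed

text \<open>By \<open>weight_sum_le\<close> the squared, weighted integrand is at most a multiple of
  H(\<zeta> - b) K(b) m(b). Cauchy-Schwarz in b isolates m, whose integral \<open>2 * I\<close> does
  not depend on \<zeta>. What remains is the convolution of H with K, and Tonelli integrates it to
  the product of the two weighted norms.\<close>

theorem abs_conv_weighted_bound:
  assumes s: "0 \<le> s" "s \<le> s1" "s \<le> s2" "s1 + s2 > s + 3 / 2"
  shows "\<exists>C\<ge>0. \<forall>h\<in>borel_measurable borel. \<forall>k\<in>borel_measurable borel.
    (\<integral>\<^sup>+\<zeta>. ennreal (weight s \<zeta>) * (abs_conv h k \<zeta>)\<^sup>2 \<partial>lborel) \<le> ennreal C * weighted_l2sq s1 h * weighted_l2sq s2 k"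
proof -
  define t where "t = s1 + s2 - s"
  have t: "3 / 2 < t" using s(4) by (simp add: t_def)
  define I where "I = enn2real (\<integral>\<^sup>+x. ennreal (weight (- t) x) \<partial>lborel)"
  have I: "(\<integral>\<^sup>+x. ennreal (weight (- t) x) \<partial>lborel) = ennreal I"
    unfolding I_def using nn_integral_weight_finite[OF t] by simp
  have I0: "0 \<le> I" by (simp add: I_def)
  have "(\<integral>\<^sup>+\<zeta>. ennreal (weight s \<zeta>) * (abs_conv h k \<zeta>)\<^sup>2 \<partial>lborel) \<le> ennreal (4 powr s * (2 * I)) * weighted_l2sq s1 h * weighted_l2sq s2 k"
    if [measurable]: "h \<in> borel_measurable borel" "k \<in> borel_measurable borel" for h k
  proof -
    define H where "H x = weight s1 x * (norm (h x))\<^sup>2" for x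
    define K where "K b = weight s2 b * (norm (k b))\<^sup>2" for b
    have [measurable]: "H \<in> borel_measurable borel" "K \<in> borel_measurable borel"
      unfolding H_def K_def by measurable
    have HK0: "0 \<le> H x" "0 \<le> K x" for x by (auto simp: H_def K_def)
    have pointwise: "ennreal (weight s \<zeta>) * (abs_conv h k \<zeta>)\<^sup>2
        \<le> ennreal (4 powr s * (2 * I)) * (\<integral>\<^sup>+b. ennreal (H (\<zeta> - b)) * ennreal (K b) \<partial>lborel)" for \<zeta>
    proof -
      define m where "m b = weight (- t) b + weight (- t) (\<zeta> - b)" for b
      have [measurable]: "m \<in> borel_measurable borel" unfolding m_def by measurable
      have m0: "0 \<le> m b" for b by (simp add: m_def)
      have mI: "(\<integral>\<^sup>+b. ennreal (m b) \<partial>lborel) = ennreal (2 * I)"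
      proof -
        have "(\<integral>\<^sup>+b. ennreal (m b) \<partial>lborel) = (\<integral>\<^sup>+b. ennreal (weight (- t) b) \<partial>lborel) + (\<integral>\<^sup>+b. ennreal (weight (- t) (\<zeta> - b)) \<partial>lborel)"
          unfolding m_def by (simp add: nn_integral_add)
        also have "\<dots> = ennreal I + ennreal I"
          using nn_integral_lborel_reflect[of "\<lambda>x. ennreal (weight (- t) x)" \<zeta>] by (simp add: I)
        finally show ?thesis using I0 by (simp flip: ennreal_plus)
      qed
      have le: "sqrt (weight s \<zeta>) * norm (h (\<zeta> - b) * k b) \<le> sqrt (4 powr s * (H (\<zeta> - b) * K b)) * sqrt (m b)" for b
      proof -
        have "weight s \<zeta> \<le> 4 powr s * (weight s1 (\<zeta> - b) * weight s2 b * m b)"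
          using weight_sum_le[OF s(1-3), of "\<zeta> - b" b] by (simp add: m_def t_def)
        then have "weight s \<zeta> * (norm (h (\<zeta> - b) * k b))\<^sup>2
            \<le> 4 powr s * (weight s1 (\<zeta> - b) * weight s2 b * m b) * (norm (h (\<zeta> - b) * k b))\<^sup>2"
          by (intro mult_right_mono) auto
        also have "\<dots> = 4 powr s * (H (\<zeta> - b) * K b) * m b"
          by (simp add: H_def K_def norm_mult power_mult_distrib mult_ac)
        finally have "sqrt (weight s \<zeta> * (norm (h (\<zeta> - b) * k b))\<^sup>2) \<le> sqrt (4 powr s * (H (\<zeta> - b) * K b) * m b)"
          by (rule real_sqrt_le_mono)
        then show ?thesis
          by (simp only: real_sqrt_mult real_sqrt_abs abs_norm_cancel)
      qed
      have "ennreal (weight s \<zeta>) * (abs_conv h k \<zeta>)\<^sup>2 = (ennreal (sqrt (weight s \<zeta>)) * abs_conv h k \<zeta>)\<^sup>2"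
        by (simp add: power_mult_distrib ennreal_power)
      also have "ennreal (sqrt (weight s \<zeta>)) * abs_conv h k \<zeta> = (\<integral>\<^sup>+b. ennreal (sqrt (weight s \<zeta>) * norm (h (\<zeta> - b) * k b)) \<partial>lborel)"
        unfolding abs_conv_def by (subst nn_integral_cmult[symmetric]) (auto simp: ennreal_mult)
      also have "\<dots>\<^sup>2 \<le> (\<integral>\<^sup>+b. ennreal (sqrt (4 powr s * (H (\<zeta> - b) * K b))) * ennreal (sqrt (m b)) \<partial>lborel)\<^sup>2"
      proof (intro power_mono nn_integral_mono)
        fix b
        have "ennreal (sqrt (weight s \<zeta>) * norm (h (\<zeta> - b) * k b)) \<le> ennreal (sqrt (4 powr s * (H (\<zeta> - b) * K b)) * sqrt (m b))"
          by (rule ennreal_leI[OF le])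
        also have "\<dots> = ennreal (sqrt (4 powr s * (H (\<zeta> - b) * K b))) * ennreal (sqrt (m b))"
          using HK0 m0 by (intro ennreal_mult) auto
        finally show "ennreal (sqrt (weight s \<zeta>) * norm (h (\<zeta> - b) * k b)) \<le> ennreal (sqrt (4 powr s * (H (\<zeta> - b) * K b))) * ennreal (sqrt (m b))" .
      qed simp
      also have "\<dots> \<le> (\<integral>\<^sup>+b. (ennreal (sqrt (4 powr s * (H (\<zeta> - b) * K b))))\<^sup>2 \<partial>lborel) * (\<integral>\<^sup>+b. (ennreal (sqrt (m b)))\<^sup>2 \<partial>lborel)"
        by (rule Cauchy_Schwarz_nn_integral) measurable
      also have "(\<integral>\<^sup>+b. (ennreal (sqrt (m b)))\<^sup>2 \<partial>lborel) = ennreal (2 * I)"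
        using m0 by (simp add: ennreal_power mI)
      also have "(\<integral>\<^sup>+b. (ennreal (sqrt (4 powr s * (H (\<zeta> - b) * K b))))\<^sup>2 \<partial>lborel)
          = ennreal (4 powr s) * (\<integral>\<^sup>+b. ennreal (H (\<zeta> - b)) * ennreal (K b) \<partial>lborel)"
      proof -
        have "(ennreal (sqrt (4 powr s * (H (\<zeta> - b) * K b))))\<^sup>2 = ennreal (4 powr s) * (ennreal (H (\<zeta> - b)) * ennreal (K b))" for b
          using HK0 by (simp add: ennreal_power ennreal_mult)
        then show ?thesis by (simp add: nn_integral_cmult)
      qed
      finally show ?thesis
        using I0 by (simp add: ennreal_mult mult_ac)
    qed
    have "(\<integral>\<^sup>+\<zeta>. ennreal (weight s \<zeta>) * (abs_conv h k \<zeta>)\<^sup>2 \<partial>lborel)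
      \<le> (\<integral>\<^sup>+\<zeta>. ennreal (4 powr s * (2 * I)) * (\<integral>\<^sup>+b. ennreal (H (\<zeta> - b)) * ennreal (K b) \<partial>lborel) \<partial>lborel)"
      by (intro nn_integral_mono pointwise)
    also have "\<dots> = ennreal (4 powr s * (2 * I)) * (\<integral>\<^sup>+\<zeta>. \<integral>\<^sup>+b. ennreal (H (\<zeta> - b)) * ennreal (K b) \<partial>lborel \<partial>lborel)"
      by (rule nn_integral_cmult) measurable
    also have "(\<integral>\<^sup>+\<zeta>. \<integral>\<^sup>+b. ennreal (H (\<zeta> - b)) * ennreal (K b) \<partial>lborel \<partial>lborel) = weighted_l2sq s1 h * weighted_l2sq s2 k"
      by (subst nn_integral_conv_product) (auto simp: weighted_l2sq_def H_def K_def)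
    finally show ?thesis by (simp add: mult.assoc)
  qed
  then show ?thesis
    using I0 by (intro exI[of _ "4 powr s * (2 * I)"]) auto
qed

text \<open>A weighted form of Young's inequality for L^1 and L^2. Splitting |e| into two square
  roots, Cauchy-Schwarz pulls out one L^1 norm of e; Peetre's inequality then moves the weight onto
  both factors, where the moments of e absorb their share. The weight s on h is preserved, and the
  constant depends only on s and e.\<close>

theorem abs_conv_moments_bound:
  assumes "0 \<le> s" and e: "moments e"
  shows "\<exists>C\<ge>0. \<forall>h\<in>borel_measurable borel.
    (\<integral>\<^sup>+\<zeta>. ennreal (weight s \<zeta>) * (abs_conv h e \<zeta>)\<^sup>2 \<partial>lborel) \<le> ennreal C * weighted_l2sq s h"
proof -
  note [measurable] = moments_measurable[OF e]
  define J where "J = (\<integral>\<^sup>+b. ennreal (weight s b * norm (e b)) \<partial>lborel)"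
  obtain N where N: "2 * s \<le> real N" using real_arch_simple by blast
  have w: "weight s b \<le> (1 + norm b) ^ N" for b
  proof -
    have "1 + (norm b)\<^sup>2 \<le> (1 + norm b)\<^sup>2"
      by (simp add: power2_sum)
    also have "\<dots> = (1 + norm b) powr 2"
      by (simp add: add_pos_nonneg)
    finally have "weight s b \<le> ((1 + norm b) powr 2) powr s"
      unfolding weight_def using assms(1) by (intro powr_mono2) auto
    also have "\<dots> = (1 + norm b) powr (2 * s)"
      by (rule powr_powr)
    also have "\<dots> \<le> (1 + norm b) powr (real N)"
      by (intro powr_mono N) simp
    also have "\<dots> = (1 + norm b) ^ N"
      by (simp add: powr_realpow add_pos_nonneg)
    finally show ?thesis .
  qed
  have "J \<le> (\<integral>\<^sup>+b. ennreal (norm ((1 + norm b) ^ N * norm (e b))) \<partial>lborel)"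
    unfolding J_def by (intro nn_integral_mono ennreal_leI) (simp add: mult_right_mono w)
  also have "\<dots> < \<infinity>"
    using e by (intro nn_integral_norm_finite) (simp add: moments_def)
  finally have J: "J < \<infinity>" .
  have e1: "(\<integral>\<^sup>+b. ennreal (norm (e b)) \<partial>lborel) \<le> J"
    unfolding J_def using weight_ge_1[OF assms(1)] by (intro nn_integral_mono ennreal_leI) (simp add: mult_left_le_one_le mult_le_cancel_right1)
  have "(\<integral>\<^sup>+\<zeta>. ennreal (weight s \<zeta>) * (abs_conv h e \<zeta>)\<^sup>2 \<partial>lborel) \<le> (ennreal (2 powr s) * J * J) * weighted_l2sq s h"
    if [measurable]: "h \<in> borel_measurable borel" for h
  proof -
    have pointwise: "ennreal (weight s \<zeta>) * (abs_conv h e \<zeta>)\<^sup>2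
      \<le> (ennreal (2 powr s) * J) * (\<integral>\<^sup>+b. ennreal (weight s (\<zeta> - b) * (norm (h (\<zeta> - b)))\<^sup>2) * ennreal (weight s b * norm (e b)) \<partial>lborel)" for \<zeta>
    proof -
      have "abs_conv h e \<zeta> = (\<integral>\<^sup>+b. ennreal (norm (h (\<zeta> - b)) * sqrt (norm (e b))) * ennreal (sqrt (norm (e b))) \<partial>lborel)"
        unfolding abs_conv_def by (intro nn_integral_cong) (simp add: norm_mult mult.assoc flip: ennreal_mult)
      also have "\<dots>\<^sup>2 \<le> (\<integral>\<^sup>+b. (ennreal (norm (h (\<zeta> - b)) * sqrt (norm (e b))))\<^sup>2 \<partial>lborel) * (\<integral>\<^sup>+b. (ennreal (sqrt (norm (e b))))\<^sup>2 \<partial>lborel)"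
        by (rule Cauchy_Schwarz_nn_integral) measurable
      also have "\<dots> \<le> (\<integral>\<^sup>+b. (ennreal (norm (h (\<zeta> - b)) * sqrt (norm (e b))))\<^sup>2 \<partial>lborel) * J"
        using e1 by (intro mult_left_mono) (auto simp: ennreal_power)
      finally have "ennreal (weight s \<zeta>) * (abs_conv h e \<zeta>)\<^sup>2
         \<le> ennreal (weight s \<zeta>) * ((\<integral>\<^sup>+b. (ennreal (norm (h (\<zeta> - b)) * sqrt (norm (e b))))\<^sup>2 \<partial>lborel) * J)"
        by (intro mult_left_mono) auto
      also have "\<dots> = J * (\<integral>\<^sup>+b. ennreal (weight s \<zeta>) * (ennreal (norm (h (\<zeta> - b)) * sqrt (norm (e b))))\<^sup>2 \<partial>lborel)"
        by (subst nn_integral_cmult) (auto simp: mult_ac)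
      also have "\<dots> \<le> J * (\<integral>\<^sup>+b. ennreal (2 powr s) * (ennreal (weight s (\<zeta> - b) * (norm (h (\<zeta> - b)))\<^sup>2) * ennreal (weight s b * norm (e b))) \<partial>lborel)"
      proof (intro mult_left_mono nn_integral_mono)
        fix b
        have "ennreal (weight s \<zeta>) * (ennreal (norm (h (\<zeta> - b)) * sqrt (norm (e b))))\<^sup>2 = ennreal (weight s \<zeta> * ((norm (h (\<zeta> - b)))\<^sup>2 * norm (e b)))"
          by (simp add: ennreal_power ennreal_mult power_mult_distrib)
        also have "\<dots> \<le> ennreal ((2 powr s * weight s (\<zeta> - b) * weight s b) * ((norm (h (\<zeta> - b)))\<^sup>2 * norm (e b)))"
          using weight_Peetre[OF assms(1), of "\<zeta> - b" b] by (intro ennreal_leI mult_right_mono) auto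
        also have "\<dots> = ennreal (2 powr s * ((weight s (\<zeta> - b) * (norm (h (\<zeta> - b)))\<^sup>2) * (weight s b * norm (e b))))"
          by (simp add: mult_ac)
        also have "\<dots> = ennreal (2 powr s) * (ennreal (weight s (\<zeta> - b) * (norm (h (\<zeta> - b)))\<^sup>2) * ennreal (weight s b * norm (e b)))"
          by (simp only: ennreal_mult mult_nonneg_nonneg weight_nonneg norm_ge_zero zero_le_power2 powr_ge_zero)
        finally show "ennreal (weight s \<zeta>) * (ennreal (norm (h (\<zeta> - b)) * sqrt (norm (e b))))\<^sup>2
          \<le> ennreal (2 powr s) * (ennreal (weight s (\<zeta> - b) * (norm (h (\<zeta> - b)))\<^sup>2) * ennreal (weight s b * norm (e b)))" .
      qed simp
      also have "\<dots> = (ennreal (2 powr s) * J) * (\<integral>\<^sup>+b. ennreal (weight s (\<zeta> - b) * (norm (h (\<zeta> - b)))\<^sup>2) * ennreal (weight s b * norm (e b)) \<partial>lborel)"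
        by (subst nn_integral_cmult) (auto simp: mult_ac)
      finally show ?thesis .
    qed
    have "(\<integral>\<^sup>+\<zeta>. ennreal (weight s \<zeta>) * (abs_conv h e \<zeta>)\<^sup>2 \<partial>lborel)
      \<le> (\<integral>\<^sup>+\<zeta>. (ennreal (2 powr s) * J) * (\<integral>\<^sup>+b. ennreal (weight s (\<zeta> - b) * (norm (h (\<zeta> - b)))\<^sup>2) * ennreal (weight s b * norm (e b)) \<partial>lborel) \<partial>lborel)"
      by (intro nn_integral_mono pointwise)
    also have "\<dots> = (ennreal (2 powr s) * J) * (\<integral>\<^sup>+\<zeta>. \<integral>\<^sup>+b. ennreal (weight s (\<zeta> - b) * (norm (h (\<zeta> - b)))\<^sup>2) * ennreal (weight s b * norm (e b)) \<partial>lborel \<partial>lborel)"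
      by (rule nn_integral_cmult) measurable
    also have "(\<integral>\<^sup>+\<zeta>. \<integral>\<^sup>+b. ennreal (weight s (\<zeta> - b) * (norm (h (\<zeta> - b)))\<^sup>2) * ennreal (weight s b * norm (e b)) \<partial>lborel \<partial>lborel)
        = weighted_l2sq s h * J"
      unfolding weighted_l2sq_def J_def
      by (rule nn_integral_conv_product[of "\<lambda>x. ennreal (weight s x * (norm (h x))\<^sup>2)" "\<lambda>b. ennreal (weight s b * norm (e b))"]) measurable
    finally show ?thesis by (simp add: mult_ac)
  qed
  moreover have "ennreal (2 powr s) * J * J = ennreal (enn2real (ennreal (2 powr s) * J * J))"
    using J by (simp add: ennreal_mult_less_top)
  ultimately show ?thesis
    by (intro exI[of _ "enn2real (ennreal (2 powr s) * J * J)"]) (auto simp del: ennreal_enn2real)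
qed


subsection \<open>The Fourier transform of a product\<close>

lemma abs_conv_test_finite:
  assumes [measurable]: "h \<in> borel_measurable borel" "k \<in> borel_measurable borel" "\<eta> \<in> borel_measurable borel"
    and "(\<integral>\<^sup>+\<zeta>. (abs_conv h k \<zeta>)\<^sup>2 \<partial>lborel) < \<infinity>" "l2sq \<eta> < \<infinity>"
  shows "(\<integral>\<^sup>+\<zeta>. abs_conv h k \<zeta> * ennreal (norm (\<eta> \<zeta>)) \<partial>lborel) < \<infinity>"
proof -
  have "(\<integral>\<^sup>+\<zeta>. abs_conv h k \<zeta> * ennreal (norm (\<eta> \<zeta>)) \<partial>lborel)\<^sup>2 \<le> (\<integral>\<^sup>+\<zeta>. (abs_conv h k \<zeta>)\<^sup>2 \<partial>lborel) * l2sq \<eta>"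
    using Cauchy_Schwarz_nn_integral[of "abs_conv h k" lborel "\<lambda>\<zeta>. ennreal (norm (\<eta> \<zeta>))"]
    by (simp add: l2sq_def ennreal_power)
  also have "\<dots> < \<infinity>"
    using assms(4,5) by (simp add: ennreal_mult_less_top)
  finally show ?thesis
    by (auto simp: power2_eq_square ennreal_mult_less_top)
qed

text \<open>Fubini, the substitution \<zeta> = \<xi> + b in the inner integral, and Fubini again.
  The assumption is absolute convergence of the double integral after the substitution, and
  translation invariance carries it over to the one before.\<close>

lemma conv_pairing:
  assumes [measurable]: "h \<in> borel_measurable borel" "k \<in> borel_measurable borel" "\<eta> \<in> borel_measurable borel"
    and fin: "(\<integral>\<^sup>+\<zeta>. abs_conv h k \<zeta> * ennreal (norm (\<eta> \<zeta>)) \<partial>lborel) < \<infinity>"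
  shows "(\<integral>\<xi>. h \<xi> * (\<integral>b. k b * \<eta> (\<xi> + b) \<partial>lborel) \<partial>lborel) = (\<integral>\<zeta>. conv h k \<zeta> * \<eta> \<zeta> \<partial>lborel)"
proof -
  have eq: "(\<integral>\<^sup>+b. ennreal (norm (h (\<zeta> - b) * k b * \<eta> \<zeta>)) \<partial>lborel) = abs_conv h k \<zeta> * ennreal (norm (\<eta> \<zeta>))" for \<zeta>
    unfolding abs_conv_def by (subst nn_integral_multc[symmetric]) (auto simp: norm_mult ennreal_mult)
  have fin1: "(\<integral>\<^sup>+\<zeta>. \<integral>\<^sup>+b. ennreal (norm (h (\<zeta> - b) * k b * \<eta> \<zeta>)) \<partial>lborel \<partial>lborel) < \<infinity>"
    unfolding eq by (rule fin)
  have "(\<integral>\<^sup>+\<zeta>. \<integral>\<^sup>+b. ennreal (norm (h (\<zeta> - b) * k b * \<eta> \<zeta>)) \<partial>lborel \<partial>lborel)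
      = (\<integral>\<^sup>+b. \<integral>\<^sup>+\<zeta>. ennreal (norm (h (\<zeta> - b) * k b * \<eta> \<zeta>)) \<partial>lborel \<partial>lborel)"
    by (rule lborel_pair.Fubini'[symmetric]) measurable
  also have "\<dots> = (\<integral>\<^sup>+b. \<integral>\<^sup>+\<xi>. ennreal (norm (h \<xi> * k b * \<eta> (\<xi> + b))) \<partial>lborel \<partial>lborel)"
  proof (rule nn_integral_cong)
    fix b
    show "(\<integral>\<^sup>+\<zeta>. ennreal (norm (h (\<zeta> - b) * k b * \<eta> \<zeta>)) \<partial>lborel) = (\<integral>\<^sup>+\<xi>. ennreal (norm (h \<xi> * k b * \<eta> (\<xi> + b))) \<partial>lborel)"
      using nn_integral_lborel_translate(2)[of "\<lambda>\<zeta>. ennreal (norm (h (\<zeta> - b) * k b * \<eta> \<zeta>))" b] by simp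
  qed
  finally have fin2: "(\<integral>\<^sup>+b. \<integral>\<^sup>+\<xi>. ennreal (norm (h \<xi> * k b * \<eta> (\<xi> + b))) \<partial>lborel \<partial>lborel) < \<infinity>"
    using fin1 by simp
  have "(\<integral>\<xi>. h \<xi> * (\<integral>b. k b * \<eta> (\<xi> + b) \<partial>lborel) \<partial>lborel) = (\<integral>\<xi>. \<integral>b. h \<xi> * k b * \<eta> (\<xi> + b) \<partial>lborel \<partial>lborel)"
    by (simp add: mult.assoc)
  also have "\<dots> = (\<integral>b. \<integral>\<xi>. h \<xi> * k b * \<eta> (\<xi> + b) \<partial>lborel \<partial>lborel)"
    by (rule lborel_Fubini[OF _ fin2, symmetric]) measurable
  also have "\<dots> = (\<integral>b. \<integral>\<zeta>. h (\<zeta> - b) * k b * \<eta> \<zeta> \<partial>lborel \<partial>lborel)"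
  proof (rule Bochner_Integration.integral_cong[OF refl])
    fix b
    show "(\<integral>\<xi>. h \<xi> * k b * \<eta> (\<xi> + b) \<partial>lborel) = (\<integral>\<zeta>. h (\<zeta> - b) * k b * \<eta> \<zeta> \<partial>lborel)"
      using integral_lborel_affine[of "\<lambda>\<zeta>. h (\<zeta> - b) * k b * \<eta> \<zeta>" 1 b] by (simp add: add.commute)
  qed
  also have "\<dots> = (\<integral>\<zeta>. \<integral>b. h (\<zeta> - b) * k b * \<eta> \<zeta> \<partial>lborel \<partial>lborel)"
    by (rule lborel_Fubini[OF _ fin1, symmetric]) measurable
  also have "\<dots> = (\<integral>\<zeta>. conv h k \<zeta> * \<eta> \<zeta> \<partial>lborel)"
    unfolding conv_def by simp
  finally show ?thesis .
qed

text \<open>\<open>h\<close> is the Fourier transform of \<open>A\<close> in the sense of distributions.\<close>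

definition weak_pair :: "(real^3 \<Rightarrow> complex) \<Rightarrow> (real^3 \<Rightarrow> complex) \<Rightarrow> bool" where
  "weak_pair A h \<longleftrightarrow> A \<in> borel_measurable borel \<and> h \<in> borel_measurable borel \<and> l2sq A < \<infinity> \<and> l2sq h < \<infinity> \<and>
     (\<forall>\<eta>\<in>schwartz. (\<integral>y. A y * fourier \<eta> y \<partial>lborel) = (\<integral>\<xi>. h \<xi> * \<eta> \<xi> \<partial>lborel))"

lemma inv_fourier_moderate: "moments e \<Longrightarrow> moderate 0 (inv_fourier e)"
  using moderate_dilate[OF fourier_moderate, of e "-1"] by (simp add: inv_fourier_def[abs_def])

text \<open>The phase of the outer transform is attached to \<open>fourier \<eta>\<close>;
  modulation there becomes translation of \<eta> by \<xi>, and the multiplication formula takes the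
  remaining transform off e.\<close>

lemma inv_fourier_mult_fourier:
  fixes e \<eta> :: "real^3 \<Rightarrow> complex"
  assumes "moments e" "\<eta> \<in> schwartz"
  shows "inv_fourier (\<lambda>y. inv_fourier e y * fourier \<eta> y) \<xi> = fourier_const * (\<integral>b. e b * \<eta> (\<xi> + b) \<partial>lborel)"
proof -
  define g where "g y = cis (\<xi> \<bullet> y) * fourier \<eta> y" for y
  have gi: "integrable lborel g"
    unfolding g_def using assms(2) by (intro integrable_cis_mult schwartz_integrable fourier_schwartz) auto
  have g: "inv_fourier g b = \<eta> (\<xi> + b)" for b
  proof -
    have "inv_fourier g b = inv_fourier (fourier \<eta>) (\<xi> + b)"
      by (simp add: inv_fourier_alt g_def inner_add_left cis_mult[symmetric] mult_ac)
    then show ?thesis by (simp add: inv_fourier_fourier[OF assms(2)])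
  qed
  have "inv_fourier (\<lambda>y. inv_fourier e y * fourier \<eta> y) \<xi> = fourier_const * (\<integral>y. inv_fourier e y * g y \<partial>lborel)"
    unfolding inv_fourier_alt[of "\<lambda>y. inv_fourier e y * fourier \<eta> y"] g_def by (simp add: mult_ac)
  also have "(\<integral>y. inv_fourier e y * g y \<partial>lborel) = (\<integral>b. e b * \<eta> (\<xi> + b) \<partial>lborel)"
    using inv_fourier_mult_formula[OF moments_integrable[OF assms(1)] gi] by (simp add: g)
  finally show ?thesis .
qed

text \<open>The multiplier is absorbed into the test function: \<open>inv_fourier e\<close> times
  \<open>fourier \<eta>\<close> is Schwartz, so the weak identity for A applies to it. Admitting
  every e with finite moments makes the lemma available for the approximations that occur in a
  Fourier pair.\<close>

lemma weak_pair_mult_test: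
  assumes A: "weak_pair A h" and e: "moments e" and \<eta>: "\<eta> \<in> schwartz"
    and fin: "(\<integral>\<^sup>+\<zeta>. (abs_conv h e \<zeta>)\<^sup>2 \<partial>lborel) < \<infinity>"
  shows "(\<integral>y. A y * inv_fourier e y * fourier \<eta> y \<partial>lborel) = (\<integral>\<zeta>. fourier_const * conv h e \<zeta> * \<eta> \<zeta> \<partial>lborel)"
proof -
  have [measurable]: "A \<in> borel_measurable borel" "h \<in> borel_measurable borel"
    using A by (auto simp: weak_pair_def)
  note [measurable] = moments_measurable[OF e] schwartz_measurable[OF \<eta>]
  define \<phi> where "\<phi> y = inv_fourier e y * fourier \<eta> y" for y
  have \<phi>: "\<phi> \<in> schwartz"
    unfolding \<phi>_def by (intro schwartz_mult[OF inv_fourier_moderate] e fourier_schwartz \<eta>)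
  have "(\<integral>y. A y * inv_fourier e y * fourier \<eta> y \<partial>lborel) = (\<integral>y. A y * fourier (inv_fourier \<phi>) y \<partial>lborel)"
    by (simp add: fourier_inv_fourier[OF \<phi>] \<phi>_def mult.assoc)
  also have "\<dots> = (\<integral>\<xi>. h \<xi> * inv_fourier \<phi> \<xi> \<partial>lborel)"
    using A inv_fourier_schwartz[OF \<phi>] by (simp add: weak_pair_def)
  also have "\<dots> = fourier_const * (\<integral>\<xi>. h \<xi> * (\<integral>b. e b * \<eta> (\<xi> + b) \<partial>lborel) \<partial>lborel)"
    unfolding \<phi>_def inv_fourier_mult_fourier[OF e \<eta>] by (subst integral_mult_right_zero[symmetric]) (simp add: mult_ac)
  also have "(\<integral>\<xi>. h \<xi> * (\<integral>b. e b * \<eta> (\<xi> + b) \<partial>lborel) \<partial>lborel) = (\<integral>\<zeta>. conv h e \<zeta> * \<eta> \<zeta> \<partial>lborel)"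
    by (intro conv_pairing abs_conv_test_finite schwartz_l2sq \<eta> fin) measurable
  finally show ?thesis by (simp add: mult.assoc)
qed

lemma abs_conv_moments_l2:
  assumes [measurable]: "h \<in> borel_measurable borel" and e: "moments e" and "l2sq h < \<infinity>"
  shows "(\<integral>\<^sup>+\<zeta>. (abs_conv h e \<zeta>)\<^sup>2 \<partial>lborel) < \<infinity>"
proof -
  obtain C where "(\<integral>\<^sup>+\<zeta>. ennreal (weight 0 \<zeta>) * (abs_conv h e \<zeta>)\<^sup>2 \<partial>lborel) \<le> ennreal C * weighted_l2sq 0 h"
    using abs_conv_moments_bound[OF order_refl e] assms(1) by blast
  moreover have "weight 0 \<zeta> = 1" for \<zeta>
    using weight_base_pos[of \<zeta>] by (simp add: weight_def)
  ultimately show ?thesis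
    using assms(3) by (simp add: weighted_l2sq_zero ennreal_mult_less_top order_le_less_trans)
qed

lemma l2sq_conv_finite:
  assumes [measurable]: "h \<in> borel_measurable borel" "k \<in> borel_measurable borel"
    and "(\<integral>\<^sup>+\<zeta>. (abs_conv h k \<zeta>)\<^sup>2 \<partial>lborel) < \<infinity>"
  shows "l2sq (\<lambda>\<zeta>. c * conv h k \<zeta>) < \<infinity>"
proof -
  have "weight 0 \<zeta> = 1" for \<zeta>
    using weight_base_pos[of \<zeta>] by (simp add: weight_def)
  then have "l2sq (conv h k) \<le> (\<integral>\<^sup>+\<zeta>. (abs_conv h k \<zeta>)\<^sup>2 \<partial>lborel)"
    using weighted_l2sq_conv_le[OF assms(1,2), of 0] by (simp add: weighted_l2sq_zero)
  then show ?thesis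
    using assms(3) by (subst l2sq_cmult) (auto simp: ennreal_mult_less_top order_le_less_trans)
qed

lemma weak_pair_mult:
  assumes A: "weak_pair A h" and e: "moments e"
  shows "weak_pair (\<lambda>y. A y * inv_fourier e y) (\<lambda>\<zeta>. fourier_const * conv h e \<zeta>)"
proof -
  have [measurable]: "A \<in> borel_measurable borel" "h \<in> borel_measurable borel"
    and fin: "l2sq A < \<infinity>" "l2sq h < \<infinity>"
    using A by (auto simp: weak_pair_def)
  note [measurable] = moments_measurable[OF e]
  have [measurable]: "inv_fourier e \<in> borel_measurable borel"
    by (rule inv_fourier_measurable) measurable
  have fin2: "(\<integral>\<^sup>+\<zeta>. (abs_conv h e \<zeta>)\<^sup>2 \<partial>lborel) < \<infinity>"
    by (intro abs_conv_moments_l2 e fin) measurable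
  obtain B where B: "\<And>y. norm (inv_fourier e y) \<le> B"
    using norm_fourier_le[OF moments_integrable[OF e]] unfolding inv_fourier_def by blast
  have "l2sq (\<lambda>y. inv_fourier e y * A y) < \<infinity>"
    by (intro l2sq_bounded_mult[where B = B] B fin) measurable
  then have "l2sq (\<lambda>y. A y * inv_fourier e y) < \<infinity>"
    by (simp add: mult.commute)
  moreover have "l2sq (\<lambda>\<zeta>. fourier_const * conv h e \<zeta>) < \<infinity>"
    by (intro l2sq_conv_finite fin2) measurable
  moreover have "(\<lambda>\<zeta>. fourier_const * conv h e \<zeta>) \<in> borel_measurable borel" "(\<lambda>y. A y * inv_fourier e y) \<in> borel_measurable borel"
    by measurable
  ultimately show ?thesis
    unfolding weak_pair_def using weak_pair_mult_test[OF A e _ fin2] by simp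
qed

text \<open>Limit of \<open>weak_pair_mult_test\<close> along the approximations of k. On the left
  the inverse transforms converge in L^2 and are paired with a fixed L^2 function; on the right
  \<open>abs_conv h k\<close> supplies a common majorant. Thus the rough function G may multiply A
  although it is no multiplier of Schwartz functions.\<close>

lemma weak_pair_mult_fourier_pair:
  assumes A: "weak_pair A h" and G: "fourier_pair G k" and \<eta>: "\<eta> \<in> schwartz"
    and fin: "(\<integral>\<^sup>+\<zeta>. (abs_conv h k \<zeta>)\<^sup>2 \<partial>lborel) < \<infinity>"
  shows "(\<integral>y. A y * G y * fourier \<eta> y \<partial>lborel) = (\<integral>\<zeta>. fourier_const * conv h k \<zeta> * \<eta> \<zeta> \<partial>lborel)"
proof -
  obtain kn where kn: "\<And>n. moments (kn n)" "\<And>n \<xi>. norm (kn n \<xi>) \<le> norm (k \<xi>)" "\<And>\<xi>. (\<lambda>n. kn n \<xi>) \<longlonglongrightarrow> k \<xi>"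
    "(\<lambda>n. l2sq (\<lambda>x. inv_fourier (kn n) x - G x)) \<longlonglongrightarrow> 0"
    using G unfolding fourier_pair_def by blast
  have [measurable]: "A \<in> borel_measurable borel" "h \<in> borel_measurable borel"
    and finA: "l2sq A < \<infinity>" "l2sq h < \<infinity>"
    using A by (auto simp: weak_pair_def)
  note [measurable] = fourier_pair_measurable[OF G] moments_measurable[OF kn(1)] schwartz_measurable[OF \<eta>]
    schwartz_measurable[OF fourier_schwartz[OF \<eta>]]
  have [measurable]: "inv_fourier (kn n) \<in> borel_measurable borel" for n
    by (intro inv_fourier_measurable) measurable
  have "l2sq (inv_fourier (kn n)) \<le> l2sq k" for n
  proof -
    have "l2sq (inv_fourier (kn n)) \<le> l2sq (kn n)"
      unfolding l2sq_def by (intro Plancherel_inequality_inv moments_integrable kn)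
    also have "\<dots> \<le> l2sq k" by (intro l2sq_mono kn)
    finally show ?thesis .
  qed
  then have fink: "l2sq (inv_fourier (kn n)) < \<infinity>" for n
    using fourier_pair_finite[OF G] order_le_less_trans by blast
  obtain B where B: "\<And>y. norm (fourier \<eta> y) \<le> B"
    using schwartz_bounded[OF fourier_schwartz[OF \<eta>]] by blast
  have "l2sq (\<lambda>y. fourier \<eta> y * A y) < \<infinity>"
    by (intro l2sq_bounded_mult[where B = B] B finA) measurable
  then have L: "(\<lambda>n. \<integral>y. inv_fourier (kn n) y * (fourier \<eta> y * A y) \<partial>lborel) \<longlonglongrightarrow> (\<integral>y. G y * (fourier \<eta> y * A y) \<partial>lborel)"
    by (intro tendsto_integral_l2 kn fink fourier_pair_finite[OF G]) auto
  have mono: "abs_conv h (kn n) \<zeta> \<le> abs_conv h k \<zeta>" for n \<zeta>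
    unfolding abs_conv_def by (intro nn_integral_mono ennreal_leI) (simp add: norm_mult mult_left_mono kn)
  have "(\<integral>\<^sup>+\<zeta>. (abs_conv h (kn n) \<zeta>)\<^sup>2 \<partial>lborel) \<le> (\<integral>\<^sup>+\<zeta>. (abs_conv h k \<zeta>)\<^sup>2 \<partial>lborel)" for n
    by (intro nn_integral_mono power_mono mono) auto
  then have finn: "(\<integral>\<^sup>+\<zeta>. (abs_conv h (kn n) \<zeta>)\<^sup>2 \<partial>lborel) < \<infinity>" for n
    using fin order_le_less_trans by blast
  have E: "(\<integral>y. inv_fourier (kn n) y * (fourier \<eta> y * A y) \<partial>lborel) = fourier_const * (\<integral>\<zeta>. conv h (kn n) \<zeta> * \<eta> \<zeta> \<partial>lborel)" for n
    using weak_pair_mult_test[OF A kn(1) \<eta> finn] by (simp add: mult_ac)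
  have fin1: "(\<integral>\<^sup>+\<zeta>. abs_conv h k \<zeta> * ennreal (norm (\<eta> \<zeta>)) \<partial>lborel) < \<infinity>"
    by (intro abs_conv_test_finite schwartz_l2sq \<eta> fin) measurable
  \<comment> \<open>The majorant below uses \<open>enn2real\<close>, which sends infinity to 0. It
    dominates only where \<open>abs_conv h k\<close> is finite, hence almost everywhere.\<close>
  have "AE \<zeta> in lborel. (abs_conv h k \<zeta>)\<^sup>2 \<noteq> \<infinity>"
    using fin by (intro nn_integral_noteq_infinite) auto
  then have ae: "AE \<zeta> in lborel. abs_conv h k \<zeta> < \<infinity>"
    by eventually_elim (auto simp: power2_eq_square ennreal_mult_eq_top_iff less_top)
  have R: "(\<lambda>n. \<integral>\<zeta>. conv h (kn n) \<zeta> * \<eta> \<zeta> \<partial>lborel) \<longlonglongrightarrow> (\<integral>\<zeta>. conv h k \<zeta> * \<eta> \<zeta> \<partial>lborel)"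
  proof (rule integral_dominated_convergence[where w = "\<lambda>\<zeta>. enn2real (abs_conv h k \<zeta> * ennreal (norm (\<eta> \<zeta>)))"])
    show "integrable lborel (\<lambda>\<zeta>. enn2real (abs_conv h k \<zeta> * ennreal (norm (\<eta> \<zeta>))))"
    proof (rule integrableI_nonneg)
      have "(\<integral>\<^sup>+\<zeta>. ennreal (enn2real (abs_conv h k \<zeta> * ennreal (norm (\<eta> \<zeta>)))) \<partial>lborel) \<le> (\<integral>\<^sup>+\<zeta>. abs_conv h k \<zeta> * ennreal (norm (\<eta> \<zeta>)) \<partial>lborel)"
      proof (rule nn_integral_mono)
        have "ennreal (enn2real z) \<le> z" for z :: ennreal
          by (cases z) auto
        then show "ennreal (enn2real (abs_conv h k \<zeta> * ennreal (norm (\<eta> \<zeta>)))) \<le> abs_conv h k \<zeta> * ennreal (norm (\<eta> \<zeta>))" for \<zeta> .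
      qed
      then show "(\<integral>\<^sup>+\<zeta>. ennreal (enn2real (abs_conv h k \<zeta> * ennreal (norm (\<eta> \<zeta>)))) \<partial>lborel) < \<infinity>"
        using fin1 by (rule order_le_less_trans)
    qed auto
    show "AE \<zeta> in lborel. (\<lambda>n. conv h (kn n) \<zeta> * \<eta> \<zeta>) \<longlonglongrightarrow> conv h k \<zeta> * \<eta> \<zeta>"
      using ae
    proof eventually_elim
      case (elim \<zeta>)
      have "(\<lambda>n. conv h (kn n) \<zeta>) \<longlonglongrightarrow> conv h k \<zeta>"
        unfolding conv_def
      proof (rule integral_dominated_convergence[where w = "\<lambda>b. norm (h (\<zeta> - b) * k b)"])
        show "integrable lborel (\<lambda>b. norm (h (\<zeta> - b) * k b))"
          using elim by (intro integrable_norm integrableI_bounded) (auto simp: abs_conv_def)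
        show "AE b in lborel. (\<lambda>n. h (\<zeta> - b) * kn n b) \<longlonglongrightarrow> h (\<zeta> - b) * k b"
          by (intro AE_I2 tendsto_mult tendsto_const kn)
        show "AE b in lborel. norm (h (\<zeta> - b) * kn n b) \<le> norm (h (\<zeta> - b) * k b)" for n
          by (intro AE_I2) (simp add: norm_mult mult_left_mono kn)
      qed auto
      then show ?case by (intro tendsto_mult tendsto_const)
    qed
    show "AE \<zeta> in lborel. norm (conv h (kn n) \<zeta> * \<eta> \<zeta>) \<le> enn2real (abs_conv h k \<zeta> * ennreal (norm (\<eta> \<zeta>)))" for n
      using ae
    proof eventually_elim
      case (elim \<zeta>)
      have "ennreal (norm (conv h (kn n) \<zeta> * \<eta> \<zeta>)) = ennreal (norm (conv h (kn n) \<zeta>)) * ennreal (norm (\<eta> \<zeta>))"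
        by (simp add: norm_mult ennreal_mult)
      also have "\<dots> \<le> abs_conv h k \<zeta> * ennreal (norm (\<eta> \<zeta>))"
        by (intro mult_right_mono order_trans[OF norm_conv_le mono]) auto
      finally have "enn2real (ennreal (norm (conv h (kn n) \<zeta> * \<eta> \<zeta>))) \<le> enn2real (abs_conv h k \<zeta> * ennreal (norm (\<eta> \<zeta>)))"
        using elim by (intro enn2real_mono) (auto simp: ennreal_mult_less_top)
      then show ?case by simp
    qed
  qed auto
  have "(\<integral>y. G y * (fourier \<eta> y * A y) \<partial>lborel) = fourier_const * (\<integral>\<zeta>. conv h k \<zeta> * \<eta> \<zeta> \<partial>lborel)"
    by (rule LIMSEQ_unique[OF L[unfolded E] tendsto_mult_left[OF R]])
  then show ?thesis
    by (simp add: mult_ac)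
qed


subsection \<open>Bessel norms\<close>

lemma bessel_norm_sq_alt:
  "bessel_norm_sq s u = (INF h\<in>{h. represented_by (fourier_dist u) h}. weighted_l2sq s h)"
  by (simp add: bessel_norm_sq_def weighted_l2sq_def weight_def)

lemma represented_by_bound:
  assumes "represented_by u h" "\<eta> \<in> schwartz"
  shows "(ennreal (norm (u \<eta>)))\<^sup>2 \<le> l2sq h * l2sq \<eta>"
proof -
  have [measurable]: "h \<in> borel_measurable borel"
    using assms(1) by (simp add: represented_by_def)
  have "ennreal (norm (u \<eta>)) \<le> (\<integral>\<^sup>+x. ennreal (norm (h x * \<eta> x)) \<partial>lborel)"
    using assms norm_integral_le_nn_integral[of lborel "\<lambda>x. h x * \<eta> x"] by (simp add: represented_by_def)
  then have "(ennreal (norm (u \<eta>)))\<^sup>2 \<le> (\<integral>\<^sup>+x. ennreal (norm (h x * \<eta> x)) \<partial>lborel)\<^sup>2"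
    by (rule power_mono) simp
  also have "\<dots> \<le> l2sq h * l2sq \<eta>"
    using schwartz_measurable[OF assms(2)] by (intro Cauchy_Schwarz_l2sq) auto
  finally show ?thesis .
qed

text \<open>If the infimum in the Bessel norm is \<open>0\<close>, then the distribution vanishes and is represented by
  \<open>h = 0\<close>; this avoids the uniqueness of \<open>h\<close>.\<close>

lemma bessel_norm_sq_attained:
  assumes "0 \<le> s" "bessel_norm_sq s u < \<infinity>"
  shows "\<exists>h. represented_by (fourier_dist u) h \<and> weighted_l2sq s h \<le> 2 * bessel_norm_sq s u"
proof (cases "bessel_norm_sq s u = 0")
  case True
  have zero: "fourier_dist u \<eta> = 0" if \<eta>: "\<eta> \<in> schwartz" for \<eta>
  proof (rule ccontr)
    assume nz: "fourier_dist u \<eta> \<noteq> 0"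
    define q where "q = enn2real (l2sq \<eta>)"
    have q: "l2sq \<eta> = ennreal q" "0 \<le> q"
      using schwartz_l2sq[OF \<eta>] by (auto simp: q_def)
    \<comment> \<open>Makes the squared value at \<eta> equal to \<epsilon> (q + 1), whereas a
      nearly vanishing h would bound it by \<epsilon> q. The added 1 also covers q = 0.\<close>
    define \<epsilon> where "\<epsilon> = (norm (fourier_dist u \<eta>))\<^sup>2 / (q + 1)"
    have \<epsilon>: "0 < \<epsilon>" using nz q(2) by (simp add: \<epsilon>_def)
    have "bessel_norm_sq s u < ennreal \<epsilon>" using True \<epsilon> by simp
    then obtain h where h: "represented_by (fourier_dist u) h" "weighted_l2sq s h < ennreal \<epsilon>"
      unfolding bessel_norm_sq_alt INF_less_iff by blast
    have "(ennreal (norm (fourier_dist u \<eta>)))\<^sup>2 \<le> l2sq h * l2sq \<eta>"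
      by (rule represented_by_bound[OF h(1) \<eta>])
    also have "\<dots> \<le> ennreal \<epsilon> * ennreal q"
      unfolding q(1) using l2sq_le_weighted[OF assms(1), of h] h(2) by (intro mult_right_mono) auto
    finally have "(norm (fourier_dist u \<eta>))\<^sup>2 \<le> \<epsilon> * q"
      using \<epsilon> q(2) by (simp add: ennreal_power ennreal_mult[symmetric])
    moreover have "(norm (fourier_dist u \<eta>))\<^sup>2 = \<epsilon> * (q + 1)"
      using q(2) by (simp add: \<epsilon>_def)
    ultimately show False
      using \<epsilon> by (simp add: distrib_left)
  qed
  then have "represented_by (fourier_dist u) (\<lambda>_. 0)"
    by (simp add: represented_by_def)
  moreover have "weighted_l2sq s (\<lambda>_. 0) = 0"
    by (simp add: weighted_l2sq_def)
  ultimately show ?thesis by (intro exI[of _ "\<lambda>_. 0"]) simp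
next
  case False
  have "b < 2 * b" if "b \<noteq> 0" "b < \<infinity>" for b :: ennreal
    using that by (cases b) (auto simp: ennreal_mult[symmetric] ennreal_less_iff simp flip: ennreal_numeral)
  then have "bessel_norm_sq s u < 2 * bessel_norm_sq s u"
    using False assms(2) by blast
  then obtain h where "represented_by (fourier_dist u) h" "weighted_l2sq s h < 2 * bessel_norm_sq s u"
    using INF_less_iff[of "weighted_l2sq s" "{h. represented_by (fourier_dist u) h}" "2 * bessel_norm_sq s u"]
    unfolding bessel_norm_sq_alt[symmetric] by blast
  then show ?thesis by (auto intro: less_imp_le)
qed


subsection \<open>Functions that are square integrable with polynomial growth\<close>

text \<open>A growth condition that survives multiplication of two functions: by Cauchy-Schwarz the
  product of two such functions is an integrable function times a polynomial weight, and therefore a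
  tempered distribution.\<close>

definition l2_growth :: "nat \<Rightarrow> (real^3 \<Rightarrow> complex) \<Rightarrow> bool" where
  "l2_growth m f \<longleftrightarrow> f \<in> borel_measurable borel \<and> l2sq (\<lambda>x. f x / of_real ((1 + norm x) ^ m)) < \<infinity>"

lemma l2_growth_measurable [measurable_dest]: "l2_growth m f \<Longrightarrow> f \<in> borel_measurable borel"
  by (simp add: l2_growth_def)

lemma schwartz_l2sq_poly:
  assumes "\<phi> \<in> schwartz"
  shows "l2sq (\<lambda>x. of_real ((1 + norm x) ^ m) * \<phi> x) < \<infinity>"
proof -
  have [measurable]: "\<phi> \<in> borel_measurable borel" using assms by (rule schwartz_measurable)
  obtain B where B: "0 \<le> B" "\<And>x. (1 + norm x) ^ (2 * m) * norm (iter_deriv [] \<phi> x) \<le> B"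
    using schwartz_bound[OF assms, of "2 * m" "[]"] by blast
  have "l2sq (\<lambda>x. of_real ((1 + norm x) ^ m) * \<phi> x) \<le> (\<integral>\<^sup>+x. ennreal B * ennreal (norm (\<phi> x)) \<partial>lborel)"
    unfolding l2sq_def
  proof (rule nn_integral_mono)
    fix x
    have "(norm (of_real ((1 + norm x) ^ m) * \<phi> x))\<^sup>2 = ((1 + norm x) ^ (2 * m) * norm (\<phi> x)) * norm (\<phi> x)"
      by (simp add: norm_mult norm_power power_mult_distrib power2_eq_square power_add mult_2 del: of_real_power of_real_add)
    also have "\<dots> \<le> B * norm (\<phi> x)"
      using B(2)[of x] by (intro mult_right_mono) auto
    finally show "ennreal ((norm (of_real ((1 + norm x) ^ m) * \<phi> x))\<^sup>2) \<le> ennreal B * ennreal (norm (\<phi> x))"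
      using B(1) by (simp add: ennreal_leI flip: ennreal_mult)
  qed
  also have "\<dots> = ennreal B * (\<integral>\<^sup>+x. ennreal (norm (\<phi> x)) \<partial>lborel)"
    by (rule nn_integral_cmult) measurable
  also have "\<dots> < \<infinity>"
    using nn_integral_norm_finite[OF schwartz_integrable[OF assms]] by (simp add: ennreal_mult_less_top)
  finally show ?thesis .
qed

lemma one_plus_norm_nonzero: "complex_of_real ((1 + norm x) ^ m) \<noteq> 0"
proof -
  have "0 < (1 + norm x) ^ m"
    by (intro zero_less_power add_pos_nonneg) auto
  then show ?thesis
    unfolding of_real_eq_0_iff by linarith
qed

lemma divide_mult_cancel: "p \<noteq> 0 \<Longrightarrow> (a / p) * (p * b) = a * b" for a b p :: complex
  by simp

lemma l2_growth_integrable: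
  assumes f: "l2_growth m f" and \<phi>: "\<phi> \<in> schwartz"
  shows "integrable lborel (\<lambda>x. f x * \<phi> x)"
proof -
  note [measurable] = l2_growth_measurable[OF f] schwartz_measurable[OF \<phi>]
  have "integrable lborel (\<lambda>x. (f x / of_real ((1 + norm x) ^ m)) * (of_real ((1 + norm x) ^ m) * \<phi> x))"
    using f schwartz_l2sq_poly[OF \<phi>, of m] by (intro integrable_l2_mult) (auto simp: l2_growth_def)
  moreover have "(f x / of_real ((1 + norm x) ^ m)) * (of_real ((1 + norm x) ^ m) * \<phi> x) = f x * \<phi> x" for x
    by (rule divide_mult_cancel[OF one_plus_norm_nonzero])
  ultimately show ?thesis by simp
qed

lemma l2_growth_product_bound:
  assumes f: "l2_growth m f" and g: "l2_growth m' g"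
  shows "\<exists>C. \<forall>\<phi>\<in>schwartz. integrable lborel (\<lambda>x. f x * g x * \<phi> x) \<and>
    norm (\<integral>x. f x * g x * \<phi> x \<partial>lborel) \<le> C * schwartz_norm (m + m') \<phi>"
proof -
  note [measurable] = l2_growth_measurable[OF f] l2_growth_measurable[OF g]
  define p where "p x = (f x / of_real ((1 + norm x) ^ m)) * (g x / of_real ((1 + norm x) ^ m'))" for x
  have [measurable]: "p \<in> borel_measurable borel"
    unfolding p_def by measurable
  have p: "integrable lborel p"
    unfolding p_def using f g by (intro integrable_l2_mult) (auto simp: l2_growth_def)
  have "integrable lborel (\<lambda>x. f x * g x * \<phi> x) \<and>
    norm (\<integral>x. f x * g x * \<phi> x \<partial>lborel) \<le> (\<integral>x. norm (p x) \<partial>lborel) * schwartz_norm (m + m') \<phi>"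
    if \<phi>: "\<phi> \<in> schwartz" for \<phi>
  proof -
    note [measurable] = schwartz_measurable[OF \<phi>]
    have le: "norm (f x * g x * \<phi> x) \<le> norm (p x) * schwartz_norm (m + m') \<phi>" for x
    proof -
      have "norm (f x * g x * \<phi> x) = norm (p x) * ((1 + norm x) ^ (m + m') * norm (\<phi> x))"
      proof -
        have "0 < 1 + norm x" by (simp add: add_pos_nonneg)
        then show ?thesis
          by (simp add: p_def norm_mult norm_divide norm_power power_add field_simps del: of_real_power of_real_add)
      qed
      also have "\<dots> \<le> norm (p x) * schwartz_norm (m + m') \<phi>"
        by (intro mult_left_mono schwartz_norm_ge \<phi>) auto
      finally show ?thesis .
    qed
    have i: "integrable lborel (\<lambda>x. norm (p x) * schwartz_norm (m + m') \<phi>)"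
      using p by auto
    have i2: "integrable lborel (\<lambda>x. f x * g x * \<phi> x)"
      using i by (rule Bochner_Integration.integrable_bound) (use le in \<open>auto intro!: AE_I2 intro: order_trans[OF _ abs_ge_self]\<close>)
    have "norm (\<integral>x. f x * g x * \<phi> x \<partial>lborel) \<le> (\<integral>x. norm (f x * g x * \<phi> x) \<partial>lborel)"
      by (rule integral_norm_bound)
    also have "\<dots> \<le> (\<integral>x. norm (p x) * schwartz_norm (m + m') \<phi> \<partial>lborel)"
      by (intro integral_mono integrable_norm i i2 le)
    finally show ?thesis using i2 by simp
  qed
  then show ?thesis by blast
qed

lemma l2_growth_compact_support:
  assumes f: "l2_growth m f" and [measurable]: "\<theta> \<in> borel_measurable borel"
    and \<theta>: "\<And>x. norm (\<theta> x) \<le> B" "\<And>x. R < norm x \<Longrightarrow> \<theta> x = 0"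
  shows "l2sq (\<lambda>x. \<theta> x * f x) < \<infinity>"
proof -
  note [measurable] = l2_growth_measurable[OF f]
  have "norm (\<theta> x * of_real ((1 + norm x) ^ m)) \<le> B * (1 + \<bar>R\<bar>) ^ m" for x
  proof (cases "R < norm x")
    case True
    have "0 \<le> B" using \<theta>(1)[of x] norm_ge_zero order_trans by blast
    then show ?thesis by (simp add: \<theta>(2)[OF True])
  next
    case False
    have "0 \<le> B" using \<theta>(1)[of x] norm_ge_zero order_trans by blast
    then show ?thesis
      using False \<theta>(1)[of x] unfolding norm_mult norm_of_real by (intro mult_mono) (auto intro!: power_mono simp: abs_of_nonneg)
  qed
  then have "l2sq (\<lambda>x. (\<theta> x * of_real ((1 + norm x) ^ m)) * (f x / of_real ((1 + norm x) ^ m))) < \<infinity>"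
    using f by (intro l2sq_bounded_mult) (auto simp: l2_growth_def)
  moreover have "(\<theta> x * of_real ((1 + norm x) ^ m)) * (f x / of_real ((1 + norm x) ^ m)) = \<theta> x * f x" for x
    using divide_mult_cancel[OF one_plus_norm_nonzero, of "f x" x m "\<theta> x"] by (simp only: mult_ac)
  ultimately show ?thesis by simp
qed


subsection \<open>Dyadic decomposition\<close>

lemma supp_I: "f x \<noteq> 0 \<Longrightarrow> x \<in> supp f"
  unfolding supp_def by (rule closure_subset[THEN subsetD]) simp

lemma dyadic_cutoffs_moderate:
  assumes "dyadic_cutoffs \<psi>"
  shows "moderate 0 (\<psi> j)"
  unfolding moderate_def
proof (intro conjI allI)
  show "smooth (\<psi> j)" using assms by (simp add: dyadic_cutoffs_def)
  fix \<beta>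
  obtain C where "\<And>j x. norm (iter_deriv \<beta> (\<psi> j) x) \<le> C * 2 powr (- real (length \<beta>) * real j)"
    using assms unfolding dyadic_cutoffs_def by blast
  then show "\<exists>C. \<forall>x. norm (iter_deriv \<beta> (\<psi> j) x) \<le> C * (1 + norm x) ^ 0"
    by (intro exI[of _ "C * 2 powr (- real (length \<beta>) * real j)"]) simp
qed

lemma dyadic_cutoffs_zero_eq_1: "dyadic_cutoffs \<psi> \<Longrightarrow> norm x \<le> 4 \<Longrightarrow> \<psi> 0 x = 1"
  by (auto simp: dyadic_cutoffs_def dyadic_shell_def)

lemma dyadic_cutoffs_support:
  assumes "dyadic_cutoffs \<psi>" "\<psi> j x \<noteq> 0"
  shows "norm x \<le> 8 * 2 ^ j" "1 \<le> j \<Longrightarrow> 2 ^ j \<le> 16 * norm x"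
proof -
  have x: "x \<in> supp (\<psi> j)" by (rule supp_I) fact
  have p: "2 powr (real j + 3) = 8 * 2 ^ j" "2 powr (real j - 4) = 2 ^ j / 16"
    by (simp_all add: powr_add powr_diff powr_realpow)
  show "norm x \<le> 8 * 2 ^ j"
  proof (cases "j = 0")
    case True
    then show ?thesis using x assms(1) by (auto simp: dyadic_cutoffs_def)
  next
    case False
    then have "1 \<le> j" by simp
    then show ?thesis using x assms(1) unfolding dyadic_cutoffs_def p[symmetric] by blast
  qed
  show "2 ^ j \<le> 16 * norm x" if "1 \<le> j"
  proof -
    have "2 powr (real j - 4) \<le> norm x"
      using x assms(1) that unfolding dyadic_cutoffs_def by blast
    then show ?thesis unfolding p by simp
  qed
qed

text \<open>The functions \<open>bump (\<psi> 0) (l \<noteq> 0) (x / 2\<^sup>l)\<close> form a smooth partition of unity subordinate to the sets on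
  which \<open>\<psi> l = 1\<close>; up to dilation there are only two of them.\<close>

definition bump :: "(real^3 \<Rightarrow> complex) \<Rightarrow> bool \<Rightarrow> real^3 \<Rightarrow> complex" where
  "bump g b y = g (2 *\<^sub>R y) - (if b then g (4 *\<^sub>R y) else 0)"

text \<open>Telescoping: the subtracted term of index l + 1 is the whole sum up to l, because 4 /
  2^(l+1) = 2 / 2^l.\<close>

lemma bump_sum: "(\<Sum>l\<le>n. bump g (l \<noteq> 0) ((1 / 2 ^ l) *\<^sub>R x)) = g (2 *\<^sub>R (1 / 2 ^ n) *\<^sub>R x)"
proof (induction n)
  case (Suc n)
  have "4 *\<^sub>R (1 / 2 ^ Suc n) *\<^sub>R x = 2 *\<^sub>R (1 / 2 ^ n) *\<^sub>R x"
    by simp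
  then show ?case
    unfolding sum.atMost_Suc Suc.IH by (simp add: bump_def)
qed (simp add: bump_def)

context
  fixes \<psi> assumes \<psi>: "dyadic_cutoffs \<psi>"
begin

lemma bump_zero_far:
  assumes "4 < norm y"
  shows "bump (\<psi> 0) b y = 0"
proof -
  have z: "\<psi> 0 x = 0" if "8 < norm x" for x
    using dyadic_cutoffs_support(1)[OF \<psi>, of 0 x] that by force
  show ?thesis
    using assms by (simp add: bump_def z)
qed

lemma bump_zero_near:
  assumes "norm y \<le> 1"
  shows "bump (\<psi> 0) True y = 0"
  using assms by (simp add: bump_def dyadic_cutoffs_zero_eq_1[OF \<psi>])

lemma bump_schwartz: "bump (\<psi> 0) b \<in> schwartz"
proof -
  have s: "\<psi> 0 \<in> schwartz"
    by (rule schwartz_compact_support[OF dyadic_cutoffs_moderate[OF \<psi>], of 8])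
       (use dyadic_cutoffs_support(1)[OF \<psi>, of 0] in force)
  have "(\<lambda>y. 1 * \<psi> 0 (2 *\<^sub>R y) + (if b then - 1 else 0) * \<psi> 0 (4 *\<^sub>R y)) \<in> schwartz"
    by (intro schwartz_lincomb schwartz_dilate s) auto
  then show ?thesis
    by (cases b) (simp_all add: bump_def[abs_def])
qed

text \<open>The dilations by 2 and 4 are matched to the shells. Since \<open>\<psi> 0\<close> is 1
  up to radius 4 and 0 beyond radius 8, the function of index l > 0 lives where 2^l < |x| <= 4 *
  2^l; this lies inside the shell on which \<open>\<psi> l\<close> is 1, the outer radii being
  equal. The last bound makes the partition locally finite with an explicit number of terms.\<close>

lemma bump_support_bounds:
  assumes "bump (\<psi> 0) (l \<noteq> 0) ((1 / 2 ^ l) *\<^sub>R x) \<noteq> 0"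
  shows "norm x \<le> 4 * 2 ^ l" "2 ^ l \<le> 1 + norm x" "\<psi> l x = 1" "l \<le> nat \<lfloor>norm x\<rfloor>"
proof -
  have a: "\<not> 4 < norm ((1 / 2 ^ l) *\<^sub>R x)"
    using bump_zero_far assms by blast
  then show 1: "norm x \<le> 4 * 2 ^ l"
    by (simp add: field_simps)
  have b: "2 ^ l < norm x" if "l \<noteq> 0"
    using assms bump_zero_near[of "(1 / 2 ^ l) *\<^sub>R x"] that by (force simp: field_simps)
  then show 2: "2 ^ l \<le> 1 + norm x"
    by (cases "l = 0") force+
  show "\<psi> l x = 1"
  proof (cases "l = 0")
    case True
    then show ?thesis using 1 dyadic_cutoffs_zero_eq_1[OF \<psi>] by simp
  next
    case False
    have "2 powr (real l - 3) \<le> 2 powr (real l)" by simp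
    also have "\<dots> \<le> norm x" using b[OF False] by (simp add: powr_realpow)
    finally have "x \<in> dyadic_shell l"
      using 1 False by (simp add: dyadic_shell_def powr_add powr_realpow)
    then show ?thesis using \<psi> by (simp add: dyadic_cutoffs_def)
  qed
  have "real l + 1 \<le> 2 ^ l"
    using Suc_le_eq[of l "2 ^ l"] less_exp[of l] by (metis of_nat_Suc of_nat_le_iff of_nat_numeral of_nat_power add.commute)
  then have "real l \<le> norm x" using 2 by linarith
  then show "l \<le> nat \<lfloor>norm x\<rfloor>"
    by (simp add: le_nat_floor)
qed

text \<open>As \<open>\<psi> l\<close> is 1 on the support of the bump, inserting it changes
  nothing, so u acts here only through its l-th piece. The rest is rescaling the test function and
  the integral by 2^l.\<close>

lemma localized_action:
  assumes u: "tempered u" and rep: "\<And>\<phi>. \<phi> \<in> schwartz \<Longrightarrow> dilate (2 ^ l) (smooth_mult (\<psi> l) u) \<phi> = (\<integral>y. F y * \<phi> y \<partial>lborel)"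
    and [measurable]: "F \<in> borel_measurable borel" and \<phi>: "\<phi> \<in> schwartz"
  shows "u (\<lambda>x. bump (\<psi> 0) (l \<noteq> 0) ((1 / 2 ^ l) *\<^sub>R x) * \<phi> x)
    = (\<integral>x. bump (\<psi> 0) (l \<noteq> 0) ((1 / 2 ^ l) *\<^sub>R x) * F ((1 / 2 ^ l) *\<^sub>R x) * \<phi> x \<partial>lborel)"
proof -
  let ?c = "bump (\<psi> 0) (l \<noteq> 0)"
  define \<theta> where "\<theta> y = ?c y * \<phi> (2 ^ l *\<^sub>R y)" for y
  have cs: "?c \<in> schwartz" by (rule bump_schwartz)
  note [measurable] = schwartz_measurable[OF cs] schwartz_measurable[OF \<phi>]
  have \<theta>: "\<theta> \<in> schwartz"
    unfolding \<theta>_def by (intro schwartz_mult[OF schwartz_moderate] schwartz_dilate cs \<phi>) auto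
  have "\<psi> l x * \<theta> ((1 / 2 ^ l) *\<^sub>R x) = ?c ((1 / 2 ^ l) *\<^sub>R x) * \<phi> x" for x
    using bump_support_bounds(3)[of l x] by (cases "?c ((1 / 2 ^ l) *\<^sub>R x) = 0") (auto simp: \<theta>_def)
  then have "of_real (1 / (2 ^ l) ^ 3) * u (\<lambda>x. ?c ((1 / 2 ^ l) *\<^sub>R x) * \<phi> x) = (\<integral>y. F y * \<theta> y \<partial>lborel)"
    using rep[OF \<theta>] by (simp add: dilate_def smooth_mult_def)
  then have "u (\<lambda>x. ?c ((1 / 2 ^ l) *\<^sub>R x) * \<phi> x) = of_real ((2 ^ l) ^ 3) * (\<integral>y. F y * \<theta> y \<partial>lborel)"
    by (simp add: field_simps)
  have meas: "(\<lambda>x. ?c ((1 / 2 ^ l) *\<^sub>R x) * F ((1 / 2 ^ l) *\<^sub>R x) * \<phi> x) \<in> borel_measurable borel"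
    by measurable
  have "(\<integral>x. ?c ((1 / 2 ^ l) *\<^sub>R x) * F ((1 / 2 ^ l) *\<^sub>R x) * \<phi> x \<partial>lborel)
      = (2 ^ l) ^ 3 *\<^sub>R (\<integral>y. ?c y * F y * \<phi> (2 ^ l *\<^sub>R y) \<partial>lborel)"
    using integral_lborel_affine[OF meas, of "2 ^ l" 0] by simp
  with \<open>u (\<lambda>x. ?c ((1 / 2 ^ l) *\<^sub>R x) * \<phi> x) = of_real ((2 ^ l) ^ 3) * (\<integral>y. F y * \<theta> y \<partial>lborel)\<close> show ?thesis
    by (simp add: \<theta>_def scaleR_conv_of_real[where 'a = complex] mult_ac)
qed

text \<open>The partial sums telescope to the action of u on a truncation of \<phi>, which tends to
  \<phi> in every Schwartz norm; continuity of u does the rest.\<close>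

lemma tempered_truncation:
  assumes u: "tempered u" and \<phi>: "\<phi> \<in> schwartz"
  shows "(\<lambda>n. \<Sum>l\<le>n. u (\<lambda>x. bump (\<psi> 0) (l \<noteq> 0) ((1 / 2 ^ l) *\<^sub>R x) * \<phi> x)) \<longlonglongrightarrow> u \<phi>"
proof -
  have lin: "u (\<lambda>x. a * f x + b * g x) = a * u f + b * u g" if "f \<in> schwartz" "g \<in> schwartz" for a b f g
    using u that by (simp add: tempered_def)
  obtain N C where bound: "\<And>\<phi>. \<phi> \<in> schwartz \<Longrightarrow> norm (u \<phi>) \<le> C * schwartz_norm N \<phi>"
    using u unfolding tempered_def by blast
  define \<rho> where "\<rho> n x = \<psi> 0 (2 *\<^sub>R (1 / 2 ^ n) *\<^sub>R x)" for n and x :: "real^3"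
  have mod2: "moderate 0 (\<lambda>x. \<psi> 0 (2 *\<^sub>R x))"
    by (intro moderate_dilate dyadic_cutoffs_moderate \<psi>)
  have \<rho>: "(\<lambda>x. \<rho> n x * \<phi> x) \<in> schwartz" for n
    unfolding \<rho>_def using moderate_dilate[OF mod2, of "1 / 2 ^ n"] by (rule schwartz_mult[OF _ \<phi>])
  have cs: "(\<lambda>x. bump (\<psi> 0) (l \<noteq> 0) ((1 / 2 ^ l) *\<^sub>R x) * \<phi> x) \<in> schwartz" for l
    by (intro schwartz_mult[OF schwartz_moderate] schwartz_dilate bump_schwartz \<phi>) auto
  have S: "(\<Sum>l\<le>n. u (\<lambda>x. bump (\<psi> 0) (l \<noteq> 0) ((1 / 2 ^ l) *\<^sub>R x) * \<phi> x)) = u (\<lambda>x. \<rho> n x * \<phi> x)" for n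
  proof (induction n)
    case 0
    show ?case by (simp add: \<rho>_def bump_def)
  next
    case (Suc n)
    have "(\<lambda>x. \<rho> (Suc n) x * \<phi> x) = (\<lambda>x. 1 * (\<rho> n x * \<phi> x) + 1 * (bump (\<psi> 0) (Suc n \<noteq> 0) ((1 / 2 ^ Suc n) *\<^sub>R x) * \<phi> x))"
    proof
      fix x
      have "\<rho> (Suc n) x = \<rho> n x + bump (\<psi> 0) (Suc n \<noteq> 0) ((1 / 2 ^ Suc n) *\<^sub>R x)"
        unfolding \<rho>_def bump_sum[symmetric] by simp
      then show "\<rho> (Suc n) x * \<phi> x = 1 * (\<rho> n x * \<phi> x) + 1 * (bump (\<psi> 0) (Suc n \<noteq> 0) ((1 / 2 ^ Suc n) *\<^sub>R x) * \<phi> x)"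
        by (simp only: distrib_right mult_1)
    qed
    then have "u (\<lambda>x. \<rho> (Suc n) x * \<phi> x) = 1 * u (\<lambda>x. \<rho> n x * \<phi> x) + 1 * u (\<lambda>x. bump (\<psi> 0) (Suc n \<noteq> 0) ((1 / 2 ^ Suc n) *\<^sub>R x) * \<phi> x)"
      by (simp only: lin[OF \<rho> cs])
    then show ?case by (simp only: sum.atMost_Suc Suc.IH mult_1)
  qed
  have "(\<lambda>n. C * schwartz_norm N (\<lambda>x. \<phi> x - \<psi> 0 (2 *\<^sub>R (1 / 2 ^ n) *\<^sub>R x) * \<phi> x)) \<longlonglongrightarrow> C * 0"
    using schwartz_norm_truncation[OF mod2 _ \<phi>, of N] by (intro tendsto_mult_left) (auto simp: dyadic_cutoffs_zero_eq_1[OF \<psi>])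
  then have L: "(\<lambda>n. C * schwartz_norm N (\<lambda>x. \<phi> x - \<rho> n x * \<phi> x)) \<longlonglongrightarrow> 0"
    by (simp add: \<rho>_def)
  have B: "norm (u (\<lambda>x. \<rho> n x * \<phi> x) - u \<phi>) \<le> C * schwartz_norm N (\<lambda>x. \<phi> x - \<rho> n x * \<phi> x)" for n
  proof -
    have "u (\<lambda>x. \<phi> x - \<rho> n x * \<phi> x) = u \<phi> - u (\<lambda>x. \<rho> n x * \<phi> x)"
      using lin[OF \<phi> \<rho>, of 1 "- 1" n] by simp
    then show ?thesis
      using bound[OF schwartz_diff[OF \<phi> \<rho>], of n] by (simp add: norm_minus_commute)
  qed
  have "(\<lambda>n. u (\<lambda>x. \<rho> n x * \<phi> x) - u \<phi>) \<longlonglongrightarrow> 0"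
    by (rule Lim_null_comparison[OF always_eventually L], rule allI, rule B)
  then show ?thesis
    unfolding S by (rule LIM_zero_cancel)
qed

end


subsection \<open>Elements of the weighted spaces are functions\<close>

lemma schwartz_represented_by_fourier:
  assumes rep: "represented_by (fourier_dist u) h" and pair: "fourier_pair F h" and \<phi>: "\<phi> \<in> schwartz"
  shows "u \<phi> = (\<integral>y. F y * \<phi> y \<partial>lborel)"
proof -
  have "fourier (inv_fourier \<phi>) = \<phi>"
    using fourier_inv_fourier[OF \<phi>] by (simp add: fun_eq_iff)
  then have "u \<phi> = fourier_dist u (inv_fourier \<phi>)"
    by (simp add: fourier_dist_def)
  also have "\<dots> = (\<integral>\<xi>. h \<xi> * inv_fourier \<phi> \<xi> \<partial>lborel)"
    using rep inv_fourier_schwartz[OF \<phi>] by (simp add: represented_by_def)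
  finally show ?thesis
    by (simp add: fourier_pair_test[OF pair \<phi>])
qed

lemma weighted_space_fourier_pieces:
  assumes "0 \<le> s" "u \<in> weighted_space \<psi> s \<delta>"
  shows "\<exists>F h. (\<forall>j. fourier_pair (F j) (h j)) \<and>
    (\<forall>j. represented_by (fourier_dist (dilate (2 ^ j) (smooth_mult (\<psi> j) u))) (h j)) \<and>
    (\<Sum>j. ennreal (2 powr ((3 / 2 + \<delta>) * 2 * real j)) * weighted_l2sq s (h j)) \<le> 2 * weighted_norm_sq \<psi> s \<delta> u"
proof -
  define D where "D j = dilate (2 ^ j) (smooth_mult (\<psi> j) u)" for j
  define a where "a j = ennreal (2 powr ((3 / 2 + \<delta>) * 2 * real j))" for j
  have W: "weighted_norm_sq \<psi> s \<delta> u = (\<Sum>j. a j * bessel_norm_sq s (D j))"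
    by (simp add: weighted_norm_sq_def D_def a_def)
  have aD: "a j * bessel_norm_sq s (D j) < \<infinity>" for j
    using assms(2) ennreal_le_suminf[of "\<lambda>j. a j * bessel_norm_sq s (D j)" j, folded W]
    by (simp add: weighted_space_def order_le_less_trans)
  have bD: "bessel_norm_sq s (D j) < \<infinity>" for j
    using aD[of j] by (auto simp: ennreal_mult_less_top a_def)
  then have "\<forall>j. \<exists>h. represented_by (fourier_dist (D j)) h \<and> weighted_l2sq s h \<le> 2 * bessel_norm_sq s (D j)"
    using bessel_norm_sq_attained[OF assms(1)] by blast
  then obtain h where h: "\<And>j. represented_by (fourier_dist (D j)) (h j)" "\<And>j. weighted_l2sq s (h j) \<le> 2 * bessel_norm_sq s (D j)"
    by metis
  have "\<exists>F. fourier_pair F (h j)" for j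
  proof (rule fourier_pair_exists)
    show "h j \<in> borel_measurable borel" using h(1) by (simp add: represented_by_def)
    have "l2sq (h j) \<le> 2 * bessel_norm_sq s (D j)"
      using l2sq_le_weighted[OF assms(1)] h(2) by (rule order_trans)
    also have "\<dots> < \<infinity>"
      using bD by (simp add: ennreal_mult_less_top)
    finally show "l2sq (h j) < \<infinity>" .
  qed
  then obtain F where F: "\<And>j. fourier_pair (F j) (h j)" by metis
  have "(\<Sum>j. a j * weighted_l2sq s (h j)) \<le> (\<Sum>j. 2 * (a j * bessel_norm_sq s (D j)))"
  proof (rule suminf_le)
    show "a j * weighted_l2sq s (h j) \<le> 2 * (a j * bessel_norm_sq s (D j))" for j
      using mult_left_mono[OF h(2)[of j], of "a j"] by (simp add: mult_ac)
  qed auto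
  also have "\<dots> = 2 * weighted_norm_sq \<psi> s \<delta> u"
    unfolding W by (rule ennreal_suminf_cmult)
  finally show ?thesis
    using F h(1) unfolding D_def a_def by blast
qed

context
  fixes \<psi> assumes \<psi>: "dyadic_cutoffs \<psi>"
begin

definition glue :: "(nat \<Rightarrow> real^3 \<Rightarrow> complex) \<Rightarrow> nat \<Rightarrow> real^3 \<Rightarrow> complex" where
  "glue F l x = bump (\<psi> 0) (l \<noteq> 0) ((1 / 2 ^ l) *\<^sub>R x) * F l ((1 / 2 ^ l) *\<^sub>R x)"

lemma glue_zero: "nat \<lfloor>norm x\<rfloor> < l \<Longrightarrow> glue F l x = 0"
  using bump_support_bounds(4)[OF \<psi>, of l x] by (force simp: glue_def)

text \<open>Stated for any t that vanishes together with \<open>glue\<close>, so that it serves both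
  the sum of the pieces and the sum of their norms.\<close>

lemma sum_glue:
  assumes "nat \<lfloor>norm x\<rfloor> \<le> n" "\<And>l. glue F l x = 0 \<Longrightarrow> t l = 0"
  shows "(\<Sum>l\<le>n. t l) = (\<Sum>l\<le>nat \<lfloor>norm x\<rfloor>. t l :: 'a::comm_monoid_add)"
proof (rule sum.mono_neutral_right)
  show "\<forall>l\<in>{..n} - {..nat \<lfloor>norm x\<rfloor>}. t l = 0"
    using assms(2) glue_zero by auto
qed (use assms(1) in auto)

lemma glue_measurable:
  assumes "F l \<in> borel_measurable borel"
  shows "glue F l \<in> borel_measurable borel"
proof -
  note [measurable] = assms schwartz_measurable[OF bump_schwartz[OF \<psi>]]
  show ?thesis unfolding glue_def by measurable
qed

text \<open>The sum of the norms of all pieces, rather than the norm of their sum, because it must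
  later dominate every partial sum. Its square integrability against a power of 1 + |x| follows from
  comparing the dyadic weights of the space with powers of 2^l, which 1 + |x| dominates on the l-th
  piece.\<close>

lemma glue_growth:
  assumes F: "\<And>j. fourier_pair (F j) (h j)" and s: "0 \<le> s"
    and fin: "(\<Sum>j. ennreal (2 powr ((3 / 2 + \<delta>) * 2 * real j)) * weighted_l2sq s (h j)) < \<infinity>"
  shows "\<exists>m. l2_growth m (\<lambda>x. of_real (\<Sum>l\<le>nat \<lfloor>norm x\<rfloor>. norm (glue F l x)))"
proof -
  define a where "a j = 2 powr ((3 / 2 + \<delta>) * 2 * real j)" for j
  have a0: "0 \<le> a j" for j by (simp add: a_def)
  have Fm [measurable]: "F j \<in> borel_measurable borel" for j
    by (rule fourier_pair_measurable(1)[OF F])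
  have [measurable]: "glue F j \<in> borel_measurable borel" for j
    by (intro glue_measurable) measurable
  define fb where "fb x = complex_of_real (\<Sum>l\<le>nat \<lfloor>norm x\<rfloor>. norm (glue F l x))" for x
  \<comment> \<open>The number of summands depends on x; measurability is obtained from the partial
    sums with a fixed number of terms, which are eventually equal to \<open>fb x\<close>.\<close>
  have [measurable]: "fb \<in> borel_measurable borel"
  proof (rule borel_measurable_LIMSEQ_metric)
    show "(\<lambda>n. complex_of_real (\<Sum>l\<le>n. norm (glue F l x))) \<longlonglongrightarrow> fb x" for x
      unfolding fb_def
      by (intro tendsto_of_real tendsto_eventually eventually_sequentiallyI[of "nat \<lfloor>norm x\<rfloor>"] sum_glue) auto
  qed measurable
  obtain M1 where M1: "\<And>y. norm (bump (\<psi> 0) True y) \<le> M1" using schwartz_bounded[OF bump_schwartz[OF \<psi>]] by blast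
  obtain M2 where M2: "\<And>y. norm (bump (\<psi> 0) False y) \<le> M2" using schwartz_bounded[OF bump_schwartz[OF \<psi>]] by blast
  define M where "M = max M1 M2"
  have M: "norm (bump (\<psi> 0) b y) \<le> M" for b y
    using M1[of y] M2[of y] by (cases b) (auto simp: M_def)
  have M0: "0 \<le> M" using M[of True 0] norm_ge_zero order_trans by blast
  \<comment> \<open>Scaling the l-th piece back costs 2^(3l), and dividing by 2^(lK) must bring this
    below the available weight 2^((3 + 2 \<delta>) l); hence K is at least -2 \<delta>.\<close>
  obtain K where K: "- 2 * \<delta> \<le> real K" using real_arch_simple by blast
  have term_le: "(norm (glue F l x))\<^sup>2 / (1 + norm x) ^ K \<le> (M\<^sup>2 / (2 ^ l) ^ K) * (norm (F l ((1 / 2 ^ l) *\<^sub>R x)))\<^sup>2" for l x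
  proof (cases "bump (\<psi> 0) (l \<noteq> 0) ((1 / 2 ^ l) *\<^sub>R x) = 0")
    case True
    then show ?thesis using M0 by (simp add: glue_def)
  next
    case False
    have "(norm (glue F l x))\<^sup>2 \<le> (M * norm (F l ((1 / 2 ^ l) *\<^sub>R x)))\<^sup>2"
      unfolding glue_def norm_mult by (intro power_mono mult_right_mono M) auto
    moreover have "(2 ^ l) ^ K \<le> (1 + norm x) ^ K"
      using bump_support_bounds(2)[OF \<psi> False] by (intro power_mono) auto
    ultimately have "(norm (glue F l x))\<^sup>2 / (1 + norm x) ^ K \<le> (M * norm (F l ((1 / 2 ^ l) *\<^sub>R x)))\<^sup>2 / (2 ^ l) ^ K"
      by (intro frac_le) auto
    then show ?thesis by (simp add: power_mult_distrib)
  qed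
  \<comment> \<open>The additional power beyond K pays for Cauchy-Schwarz over the summands, whose
    number is at most 1 + |x|.\<close>
  have ptw: "ennreal ((norm (fb x / of_real ((1 + norm x) ^ (K + 1))))\<^sup>2)
      \<le> (\<Sum>l. ennreal ((M\<^sup>2 / (2 ^ l) ^ K) * (norm (F l ((1 / 2 ^ l) *\<^sub>R x)))\<^sup>2))" for x
  proof -
    define L where "L = nat \<lfloor>norm x\<rfloor>"
    define p where "p = 1 + norm x"
    have p: "1 \<le> p" by (simp add: p_def)
    have Lp: "real (card {..L}) \<le> p"
      by (simp add: L_def p_def)
    have "norm (fb x / of_real ((1 + norm x) ^ (K + 1))) = (\<Sum>l\<le>L. norm (glue F l x)) / p ^ (K + 1)"
    proof -
      have "norm (fb x) = (\<Sum>l\<le>L. norm (glue F l x))"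
        unfolding fb_def L_def norm_of_real by (intro abs_of_nonneg sum_nonneg) auto
      moreover have "norm (complex_of_real (p ^ (K + 1))) = p ^ (K + 1)"
        unfolding norm_of_real using p by (intro abs_of_nonneg) auto
      ultimately show ?thesis unfolding norm_divide p_def[symmetric] by simp
    qed
    then have "(norm (fb x / of_real ((1 + norm x) ^ (K + 1))))\<^sup>2 = (\<Sum>l\<le>L. norm (glue F l x))\<^sup>2 / (p ^ (K + 1))\<^sup>2"
      by (simp only: power_divide)
    also have "\<dots> \<le> ((\<Sum>l\<le>L. (norm (glue F l x))\<^sup>2) * p) / (p ^ (K + 1))\<^sup>2"
    proof (rule divide_right_mono)
      have "(\<Sum>l\<le>L. norm (glue F l x))\<^sup>2 \<le> (\<Sum>l\<le>L. (norm (glue F l x))\<^sup>2) * real (card {..L})"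
        by (rule sum_squared_le_sum_of_squares)
      also have "\<dots> \<le> (\<Sum>l\<le>L. (norm (glue F l x))\<^sup>2) * p"
        by (intro mult_left_mono Lp sum_nonneg) auto
      finally show "(\<Sum>l\<le>L. norm (glue F l x))\<^sup>2 \<le> (\<Sum>l\<le>L. (norm (glue F l x))\<^sup>2) * p" .
    qed (use p in auto)
    also have "\<dots> \<le> (\<Sum>l\<le>L. (norm (glue F l x))\<^sup>2) / p ^ K"
    proof -
      have "p * p ^ K \<le> (p ^ (K + 1))\<^sup>2"
        using self_le_power[of "p ^ (K + 1)" 2] one_le_power[OF p, of "K + 1"] by simp
      then have "p / (p ^ (K + 1))\<^sup>2 \<le> 1 / p ^ K"
        using p by (simp add: divide_le_eq le_divide_eq mult.commute frac_le_eq)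
      then have "(\<Sum>l\<le>L. (norm (glue F l x))\<^sup>2) * (p / (p ^ (K + 1))\<^sup>2) \<le> (\<Sum>l\<le>L. (norm (glue F l x))\<^sup>2) * (1 / p ^ K)"
        by (intro mult_left_mono sum_nonneg) auto
      then show ?thesis by simp
    qed
    also have "\<dots> = (\<Sum>l\<le>L. (norm (glue F l x))\<^sup>2 / (1 + norm x) ^ K)"
      by (simp add: sum_divide_distrib p_def)
    also have "\<dots> \<le> (\<Sum>l\<le>L. (M\<^sup>2 / (2 ^ l) ^ K) * (norm (F l ((1 / 2 ^ l) *\<^sub>R x)))\<^sup>2)"
      by (intro sum_mono term_le)
    finally have "ennreal ((norm (fb x / of_real ((1 + norm x) ^ (K + 1))))\<^sup>2)
       \<le> ennreal (\<Sum>l\<le>L. (M\<^sup>2 / (2 ^ l) ^ K) * (norm (F l ((1 / 2 ^ l) *\<^sub>R x)))\<^sup>2)"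
      by (rule ennreal_leI)
    also have "\<dots> = (\<Sum>l\<le>L. ennreal ((M\<^sup>2 / (2 ^ l) ^ K) * (norm (F l ((1 / 2 ^ l) *\<^sub>R x)))\<^sup>2))"
      by (rule sum_ennreal[symmetric]) simp
    also have "\<dots> \<le> (\<Sum>l. ennreal ((M\<^sup>2 / (2 ^ l) ^ K) * (norm (F l ((1 / 2 ^ l) *\<^sub>R x)))\<^sup>2))"
      by (rule sum_le_suminf) auto
    finally show ?thesis .
  qed
  have intl: "(\<integral>\<^sup>+x. ennreal ((M\<^sup>2 / (2 ^ l) ^ K) * (norm (F l ((1 / 2 ^ l) *\<^sub>R x)))\<^sup>2) \<partial>lborel)
      \<le> ennreal (2 * M\<^sup>2) * (ennreal (a l) * weighted_l2sq s (h l))" for l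
  proof -
    have "(\<integral>\<^sup>+x. ennreal ((M\<^sup>2 / (2 ^ l) ^ K) * (norm (F l ((1 / 2 ^ l) *\<^sub>R x)))\<^sup>2) \<partial>lborel)
      = ennreal (M\<^sup>2 / (2 ^ l) ^ K) * l2sq (\<lambda>x. F l ((1 / 2 ^ l) *\<^sub>R x))"
    proof -
      have "ennreal ((M\<^sup>2 / (2 ^ l) ^ K) * z\<^sup>2) = ennreal (M\<^sup>2 / (2 ^ l) ^ K) * ennreal (z\<^sup>2)" for z
        by (rule ennreal_mult) auto
      then show ?thesis
        unfolding l2sq_def by (simp only:) (rule nn_integral_cmult, measurable)
    qed
    also have "l2sq (\<lambda>x. F l ((1 / 2 ^ l) *\<^sub>R x)) = ennreal ((2 ^ l) ^ 3) * l2sq (F l)"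
      using l2sq_scale[of "\<lambda>x. F l ((1 / 2 ^ l) *\<^sub>R x)" "2 ^ l"] by simp
    also have "ennreal (M\<^sup>2 / (2 ^ l) ^ K) * (ennreal ((2 ^ l) ^ 3) * l2sq (F l)) = ennreal (M\<^sup>2 * ((2 ^ l) ^ 3 / (2 ^ l) ^ K)) * l2sq (F l)"
      by (simp add: ennreal_mult[symmetric] mult.assoc[symmetric])
    also have "\<dots> \<le> ennreal (M\<^sup>2 * a l) * (2 * weighted_l2sq s (h l))"
    proof (rule mult_mono)
      have "(2 ^ l) ^ 3 / (2 ^ l) ^ K = 2 powr ((3 - real K) * real l)"
      proof -
        have "((2::real) ^ l) ^ 3 = 2 powr (3 * real l)"
          by (simp add: powr_realpow[symmetric] powr_powr mult.commute flip: power_mult)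
        moreover have "((2::real) ^ l) ^ K = 2 powr (real K * real l)"
          by (simp add: powr_realpow[symmetric] powr_powr mult.commute flip: power_mult)
        ultimately show ?thesis by (simp add: powr_diff left_diff_distrib)
      qed
      also have "\<dots> \<le> a l"
        unfolding a_def using K by (intro powr_mono mult_right_mono) (auto simp: algebra_simps)
      finally show "ennreal (M\<^sup>2 * ((2 ^ l) ^ 3 / (2 ^ l) ^ K)) \<le> ennreal (M\<^sup>2 * a l)"
        by (intro ennreal_leI mult_left_mono) auto
      have "l2sq (F l) \<le> 2 * l2sq (h l)"
        by (rule fourier_pair_l2sq[OF F])
      also have "\<dots> \<le> 2 * weighted_l2sq s (h l)"
        by (intro mult_left_mono l2sq_le_weighted s) auto
      finally show "l2sq (F l) \<le> 2 * weighted_l2sq s (h l)" .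
    qed auto
    also have "\<dots> = ennreal (2 * M\<^sup>2) * (ennreal (a l) * weighted_l2sq s (h l))"
      using a0 by (simp add: ennreal_mult mult_ac)
    finally show ?thesis .
  qed
  have "l2sq (\<lambda>x. fb x / of_real ((1 + norm x) ^ (K + 1)))
    \<le> (\<integral>\<^sup>+x. (\<Sum>l. ennreal ((M\<^sup>2 / (2 ^ l) ^ K) * (norm (F l ((1 / 2 ^ l) *\<^sub>R x)))\<^sup>2)) \<partial>lborel)"
    unfolding l2sq_def by (intro nn_integral_mono ptw)
  also have "\<dots> = (\<Sum>l. \<integral>\<^sup>+x. ennreal ((M\<^sup>2 / (2 ^ l) ^ K) * (norm (F l ((1 / 2 ^ l) *\<^sub>R x)))\<^sup>2) \<partial>lborel)"
    by (rule nn_integral_suminf) measurable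
  also have "\<dots> \<le> (\<Sum>l. ennreal (2 * M\<^sup>2) * (ennreal (a l) * weighted_l2sq s (h l)))"
    by (intro suminf_le intl) auto
  also have "\<dots> = ennreal (2 * M\<^sup>2) * (\<Sum>l. ennreal (a l) * weighted_l2sq s (h l))"
    by (rule ennreal_suminf_cmult)
  also have "\<dots> < \<infinity>"
    using fin by (simp add: ennreal_mult_less_top a_def)
  finally have "l2_growth (K + 1) fb"
    by (simp add: l2_growth_def)
  then show ?thesis unfolding fb_def by blast
qed

text \<open>The truncated action of u is a sum of integrals over pieces by
  \<open>localized_action\<close>, and the polynomially bounded majorant lets the number of pieces
  tend to infinity. The clause about x and n says that finitely many pieces give f exactly on each
  ball; the product estimate applies it to the second factor.\<close>

theorem weighted_space_representation:
  assumes s: "0 \<le> s" and u: "u \<in> weighted_space \<psi> s \<delta>"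
  shows "\<exists>f F h m. represented_by u f \<and> l2_growth m f \<and> (\<forall>j. fourier_pair (F j) (h j)) \<and>
    (\<forall>j. represented_by (fourier_dist (dilate (2 ^ j) (smooth_mult (\<psi> j) u))) (h j)) \<and>
    (\<Sum>j. ennreal (2 powr ((3 / 2 + \<delta>) * 2 * real j)) * weighted_l2sq s (h j)) \<le> 2 * weighted_norm_sq \<psi> s \<delta> u \<and>
    (\<forall>x n. norm x \<le> real n \<longrightarrow> f x = (\<Sum>l\<le>n. bump (\<psi> 0) (l \<noteq> 0) ((1 / 2 ^ l) *\<^sub>R x) * F l ((1 / 2 ^ l) *\<^sub>R x)))"
proof -
  obtain F h where F: "\<And>j. fourier_pair (F j) (h j)"
    and h: "\<And>j. represented_by (fourier_dist (dilate (2 ^ j) (smooth_mult (\<psi> j) u))) (h j)"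
    and S: "(\<Sum>j. ennreal (2 powr ((3 / 2 + \<delta>) * 2 * real j)) * weighted_l2sq s (h j)) \<le> 2 * weighted_norm_sq \<psi> s \<delta> u"
    using weighted_space_fourier_pieces[OF s u] by blast
  have tu: "tempered u" using u by (simp add: weighted_space_def)
  have "2 * weighted_norm_sq \<psi> s \<delta> u < \<infinity>"
    using u by (simp add: weighted_space_def ennreal_mult_less_top)
  then have fin: "(\<Sum>j. ennreal (2 powr ((3 / 2 + \<delta>) * 2 * real j)) * weighted_l2sq s (h j)) < \<infinity>"
    using S by (rule order_le_less_trans[rotated])
  define fb where "fb x = complex_of_real (\<Sum>l\<le>nat \<lfloor>norm x\<rfloor>. norm (glue F l x))" for x
  obtain m where m: "l2_growth m fb"
    using glue_growth[OF F s fin] unfolding fb_def by blast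
  define f where "f x = (\<Sum>l\<le>nat \<lfloor>norm x\<rfloor>. glue F l x)" for x
  note [measurable] = l2_growth_measurable[OF m]
  have Fm [measurable]: "F j \<in> borel_measurable borel" for j
    by (rule fourier_pair_measurable(1)[OF F])
  have gm [measurable]: "glue F j \<in> borel_measurable borel" for j
    by (intro glue_measurable) measurable
  have f_lim: "(\<lambda>n. \<Sum>l\<le>n. glue F l x) \<longlonglongrightarrow> f x" for x
    unfolding f_def by (intro tendsto_eventually eventually_sequentiallyI[of "nat \<lfloor>norm x\<rfloor>"] sum_glue) auto
  have [measurable]: "f \<in> borel_measurable borel"
    by (rule borel_measurable_LIMSEQ_metric[OF _ f_lim]) measurable
  have nfb: "norm (fb x) = (\<Sum>l\<le>nat \<lfloor>norm x\<rfloor>. norm (glue F l x))" for x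
    unfolding fb_def norm_of_real by (intro abs_of_nonneg sum_nonneg) auto
  have part: "norm (\<Sum>l\<le>n. glue F l x) \<le> norm (fb x)" for n x
  proof -
    have "norm (\<Sum>l\<le>n. glue F l x) \<le> (\<Sum>l\<le>n. norm (glue F l x))"
      by (rule norm_sum)
    also have "\<dots> \<le> (\<Sum>l\<le>max n (nat \<lfloor>norm x\<rfloor>). norm (glue F l x))"
      by (intro sum_mono2) auto
    also have "\<dots> = norm (fb x)"
      unfolding nfb by (rule sum_glue) auto
    finally show ?thesis .
  qed
  have gle: "norm (glue F l x) \<le> norm (fb x)" for l x
  proof -
    have "norm (glue F l x) \<le> (\<Sum>l\<le>max l (nat \<lfloor>norm x\<rfloor>). norm (glue F l x))"
      by (rule member_le_sum) auto
    also have "\<dots> = norm (fb x)"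
      unfolding nfb by (rule sum_glue) auto
    finally show ?thesis .
  qed
  have fle: "norm (f x) \<le> norm (fb x)" for x
    unfolding f_def by (rule part)
  have f_growth: "l2_growth m f"
  proof -
    have "l2sq (\<lambda>x. f x / of_real ((1 + norm x) ^ m)) \<le> l2sq (\<lambda>x. fb x / of_real ((1 + norm x) ^ m))"
      by (intro l2sq_mono) (simp only: norm_divide divide_right_mono fle norm_ge_zero)
    then show ?thesis
      using m by (auto simp: l2_growth_def intro: order_le_less_trans)
  qed
  have rep: "u \<phi> = (\<integral>x. f x * \<phi> x \<partial>lborel)" if \<phi>: "\<phi> \<in> schwartz" for \<phi>
  proof (rule LIMSEQ_unique[OF tempered_truncation[OF \<psi> tu \<phi>]])
    note [measurable] = schwartz_measurable[OF \<phi>]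
    have fbi: "integrable lborel (\<lambda>x. fb x * \<phi> x)"
      by (rule l2_growth_integrable[OF m \<phi>])
    have gi: "integrable lborel (\<lambda>x. glue F l x * \<phi> x)" for l
      using fbi by (rule Bochner_Integration.integrable_bound) (auto simp: norm_mult intro!: mult_right_mono gle)
    have "(\<Sum>l\<le>n. u (\<lambda>x. bump (\<psi> 0) (l \<noteq> 0) ((1 / 2 ^ l) *\<^sub>R x) * \<phi> x)) = (\<integral>x. (\<Sum>l\<le>n. glue F l x) * \<phi> x \<partial>lborel)" for n
    proof -
      have "(\<Sum>l\<le>n. u (\<lambda>x. bump (\<psi> 0) (l \<noteq> 0) ((1 / 2 ^ l) *\<^sub>R x) * \<phi> x)) = (\<Sum>l\<le>n. \<integral>x. glue F l x * \<phi> x \<partial>lborel)"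
        unfolding glue_def
        by (intro sum.cong refl localized_action[OF \<psi> tu _ Fm \<phi>] schwartz_represented_by_fourier[OF h F])
      also have "\<dots> = (\<integral>x. (\<Sum>l\<le>n. glue F l x * \<phi> x) \<partial>lborel)"
        by (rule Bochner_Integration.integral_sum[symmetric]) (rule gi)
      finally show ?thesis by (simp only: sum_distrib_right)
    qed
    moreover have "(\<lambda>n. \<integral>x. (\<Sum>l\<le>n. glue F l x) * \<phi> x \<partial>lborel) \<longlonglongrightarrow> (\<integral>x. f x * \<phi> x \<partial>lborel)"
    proof (rule integral_dominated_convergence[where w = "\<lambda>x. norm (fb x * \<phi> x)"])
      show "integrable lborel (\<lambda>x. norm (fb x * \<phi> x))"
        by (rule integrable_norm[OF fbi])
      show "AE x in lborel. (\<lambda>n. (\<Sum>l\<le>n. glue F l x) * \<phi> x) \<longlonglongrightarrow> f x * \<phi> x"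
        by (intro AE_I2 tendsto_mult f_lim tendsto_const)
      show "AE x in lborel. norm ((\<Sum>l\<le>n. glue F l x) * \<phi> x) \<le> norm (fb x * \<phi> x)" for n
        unfolding norm_mult by (intro AE_I2 mult_right_mono part) auto
    qed measurable
    ultimately show "(\<lambda>n. \<Sum>l\<le>n. u (\<lambda>x. bump (\<psi> 0) (l \<noteq> 0) ((1 / 2 ^ l) *\<^sub>R x) * \<phi> x)) \<longlonglongrightarrow> (\<integral>x. f x * \<phi> x \<partial>lborel)"
      by (simp only:)
  qed
  have "represented_by u f"
    unfolding represented_by_def using rep l2_growth_integrable[OF f_growth] by simp
  moreover have "f x = (\<Sum>l\<le>n. bump (\<psi> 0) (l \<noteq> 0) ((1 / 2 ^ l) *\<^sub>R x) * F l ((1 / 2 ^ l) *\<^sub>R x))" if "norm x \<le> real n" for x n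
  proof -
    have "nat \<lfloor>norm x\<rfloor> \<le> n" using that by linarith
    from sum_glue[OF this, of F "\<lambda>l. glue F l x"] show ?thesis
      unfolding f_def glue_def by simp
  qed
  ultimately show ?thesis
    using F h S f_growth by blast
qed

end


subsection \<open>The product estimate\<close>

lemma l2sq_scale_finite:
  assumes "f \<in> borel_measurable borel" "0 < r" "l2sq f < \<infinity>"
  shows "l2sq (\<lambda>x. f (r *\<^sub>R x)) < \<infinity>"
  using assms(3) l2sq_scale[OF assms(1,2)] assms(2) by (auto simp: ennreal_mult_less_top)

lemma weighted_l2sq_cmult:
  assumes [measurable]: "f \<in> borel_measurable borel"
  shows "weighted_l2sq s (\<lambda>x. c * f x) = ennreal ((norm c)\<^sup>2) * weighted_l2sq s f"
  unfolding weighted_l2sq_def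
  by (subst nn_integral_cmult[symmetric]) (auto simp: norm_mult power_mult_distrib mult_ac simp flip: ennreal_mult)

lemma weighted_l2sq_sum_le:
  assumes "finite L" and [measurable]: "\<And>l. H l \<in> borel_measurable borel"
  shows "weighted_l2sq s (\<lambda>\<zeta>. \<Sum>l\<in>L. H l \<zeta>) \<le> ennreal (real (card L)) * (\<Sum>l\<in>L. weighted_l2sq s (H l))"
proof -
  have "weighted_l2sq s (\<lambda>\<zeta>. \<Sum>l\<in>L. H l \<zeta>)
     \<le> (\<integral>\<^sup>+\<zeta>. ennreal (real (card L)) * (\<Sum>l\<in>L. ennreal (weight s \<zeta> * (norm (H l \<zeta>))\<^sup>2)) \<partial>lborel)"
    unfolding weighted_l2sq_def
  proof (rule nn_integral_mono)
    fix \<zeta>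
    have "(norm (\<Sum>l\<in>L. H l \<zeta>))\<^sup>2 \<le> (\<Sum>l\<in>L. norm (H l \<zeta>))\<^sup>2"
      by (intro power_mono norm_sum) auto
    also have "\<dots> \<le> (\<Sum>l\<in>L. (norm (H l \<zeta>))\<^sup>2) * real (card L)"
      by (rule sum_squared_le_sum_of_squares)
    finally have "weight s \<zeta> * (norm (\<Sum>l\<in>L. H l \<zeta>))\<^sup>2 \<le> weight s \<zeta> * ((\<Sum>l\<in>L. (norm (H l \<zeta>))\<^sup>2) * real (card L))"
      by (rule mult_left_mono) simp
    also have "\<dots> = real (card L) * (\<Sum>l\<in>L. weight s \<zeta> * (norm (H l \<zeta>))\<^sup>2)"
      by (simp add: sum_distrib_left mult_ac)
    finally have "ennreal (weight s \<zeta> * (norm (\<Sum>l\<in>L. H l \<zeta>))\<^sup>2) \<le> ennreal (real (card L) * (\<Sum>l\<in>L. weight s \<zeta> * (norm (H l \<zeta>))\<^sup>2))"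
      by (rule ennreal_leI)
    also have "\<dots> = ennreal (real (card L)) * (\<Sum>l\<in>L. ennreal (weight s \<zeta> * (norm (H l \<zeta>))\<^sup>2))"
      by (subst ennreal_mult) (auto intro!: sum_nonneg simp: sum_ennreal)
    finally show "ennreal (weight s \<zeta> * (norm (\<Sum>l\<in>L. H l \<zeta>))\<^sup>2) \<le> ennreal (real (card L)) * (\<Sum>l\<in>L. ennreal (weight s \<zeta> * (norm (H l \<zeta>))\<^sup>2))" .
  qed
  also have "\<dots> = ennreal (real (card L)) * (\<Sum>l\<in>L. weighted_l2sq s (H l))"
    unfolding weighted_l2sq_def by (simp add: nn_integral_cmult nn_integral_sum del: sum_ennreal)
  finally show ?thesis .
qed

lemma weighted_l2sq_dilate:
  assumes [measurable]: "k \<in> borel_measurable borel" and "0 \<le> s" "0 < r"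
  shows "weighted_l2sq s (\<lambda>\<xi>. k ((1 / r) *\<^sub>R \<xi>) / of_real (r ^ 3)) \<le> ennreal ((1 + r\<^sup>2) powr s / r ^ 3) * weighted_l2sq s k"
proof -
  have "weighted_l2sq s (\<lambda>\<xi>. k ((1 / r) *\<^sub>R \<xi>) / of_real (r ^ 3))
      = ennreal (r ^ 3) * (\<integral>\<^sup>+\<xi>. ennreal (weight s (r *\<^sub>R \<xi>) * (norm (k \<xi> / of_real (r ^ 3)))\<^sup>2) \<partial>lborel)"
    unfolding weighted_l2sq_def
    using nn_integral_lborel_affine[of "\<lambda>\<xi>. ennreal (weight s \<xi> * (norm (k ((1 / r) *\<^sub>R \<xi>) / of_real (r ^ 3)))\<^sup>2)" r 0] assms(3) by simp
  also have "\<dots> = (\<integral>\<^sup>+\<xi>. ennreal (r ^ 3) * ennreal (weight s (r *\<^sub>R \<xi>) * (norm (k \<xi> / of_real (r ^ 3)))\<^sup>2) \<partial>lborel)"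
    by (rule nn_integral_cmult[symmetric]) measurable
  also have "\<dots> \<le> (\<integral>\<^sup>+\<xi>. ennreal ((1 + r\<^sup>2) powr s / r ^ 3) * ennreal (weight s \<xi> * (norm (k \<xi>))\<^sup>2) \<partial>lborel)"
  proof (rule nn_integral_mono)
    fix \<xi> :: "real^3"
    have "1 + (norm (r *\<^sub>R \<xi>))\<^sup>2 \<le> (1 + r\<^sup>2) * (1 + (norm \<xi>)\<^sup>2)"
      by (simp add: power_mult_distrib distrib_left distrib_right)
    then have "weight s (r *\<^sub>R \<xi>) \<le> ((1 + r\<^sup>2) * (1 + (norm \<xi>)\<^sup>2)) powr s"
      unfolding weight_def using assms(2) by (intro powr_mono2) auto
    also have "\<dots> = (1 + r\<^sup>2) powr s * weight s \<xi>"
      unfolding weight_def by (rule powr_mult)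
    finally have w: "weight s (r *\<^sub>R \<xi>) \<le> (1 + r\<^sup>2) powr s * weight s \<xi>" .
    have "r ^ 3 * (weight s (r *\<^sub>R \<xi>) * (norm (k \<xi> / of_real (r ^ 3)))\<^sup>2) = weight s (r *\<^sub>R \<xi>) * ((norm (k \<xi>))\<^sup>2 / r ^ 3)"
    proof -
      have "p * (W * (n / p)\<^sup>2) = W * (n\<^sup>2 / p)" if "0 < p" for p W n :: real
        using that by (simp add: power2_eq_square)
      moreover have "norm (k \<xi> / of_real (r ^ 3)) = norm (k \<xi>) / r ^ 3"
        using assms(3) by (simp add: norm_divide norm_power)
      ultimately show ?thesis using assms(3) by simp
    qed
    also have "\<dots> \<le> ((1 + r\<^sup>2) powr s * weight s \<xi>) * ((norm (k \<xi>))\<^sup>2 / r ^ 3)"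
      using assms(3) by (intro mult_right_mono w) auto
    also have "\<dots> = ((1 + r\<^sup>2) powr s / r ^ 3) * (weight s \<xi> * (norm (k \<xi>))\<^sup>2)"
      by simp
    finally have "ennreal (r ^ 3 * (weight s (r *\<^sub>R \<xi>) * (norm (k \<xi> / of_real (r ^ 3)))\<^sup>2)) \<le> ennreal (((1 + r\<^sup>2) powr s / r ^ 3) * (weight s \<xi> * (norm (k \<xi>))\<^sup>2))"
      by (rule ennreal_leI)
    then show "ennreal (r ^ 3) * ennreal (weight s (r *\<^sub>R \<xi>) * (norm (k \<xi> / of_real (r ^ 3)))\<^sup>2) \<le> ennreal ((1 + r\<^sup>2) powr s / r ^ 3) * ennreal (weight s \<xi> * (norm (k \<xi>))\<^sup>2)"
      using assms(3) by (subst (1 2) ennreal_mult[symmetric]) auto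
  qed
  also have "\<dots> = ennreal ((1 + r\<^sup>2) powr s / r ^ 3) * weighted_l2sq s k"
    unfolding weighted_l2sq_def by (rule nn_integral_cmult) measurable
  finally show ?thesis .
qed

text \<open>Two multiplications in a fixed order: first by the smooth \<theta>, which keeps the
  order s1 of A, then by the rough dilated G, where the loss from s1, s2 to s occurs. The constant
  collects one squared \<open>fourier_const\<close> per convolution, the moment bound
  \<open>C1\<close> for \<theta>, the dilation bound \<open>C2\<close> and the convolution bound
  \<open>C3\<close>; it depends on \<theta> and r but not on the functions being multiplied.\<close>

lemma localized_product_bound:
  assumes s: "0 \<le> s" "s \<le> s1" "s \<le> s2" "s1 + s2 > s + 3 / 2"
    and \<theta>: "\<theta> \<in> schwartz" and r: "0 < r"
  shows "\<exists>C\<ge>0. \<forall>A h G k. weak_pair A h \<longrightarrow> fourier_pair G k \<longrightarrow> weighted_l2sq s1 h < \<infinity> \<longrightarrow> weighted_l2sq s2 k < \<infinity> \<longrightarrow>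
    (\<exists>H\<in>borel_measurable borel. weighted_l2sq s H \<le> ennreal C * (weighted_l2sq s1 h * weighted_l2sq s2 k) \<and>
      (\<forall>\<eta>\<in>schwartz. (\<integral>y. A y * \<theta> (r *\<^sub>R y) * G (r *\<^sub>R y) * fourier \<eta> y \<partial>lborel) = (\<integral>\<zeta>. H \<zeta> * \<eta> \<zeta> \<partial>lborel)))"
proof -
  define c where "c = complex_of_real fourier_const"
  define \<theta>r where "\<theta>r y = \<theta> (r *\<^sub>R y)" for y
  have \<theta>r: "\<theta>r \<in> schwartz"
    unfolding \<theta>r_def using r by (intro schwartz_dilate \<theta>) auto
  define e where "e = fourier \<theta>r"
  have e: "moments e"
    unfolding e_def by (intro schwartz_moments fourier_schwartz \<theta>r)
  have inv_e: "inv_fourier e y = \<theta> (r *\<^sub>R y)" for y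
    unfolding e_def inv_fourier_fourier[OF \<theta>r] \<theta>r_def ..
  note [measurable] = moments_measurable[OF e]
  have s1: "0 \<le> s1" and s2: "0 \<le> s2" using s by auto
  obtain C1 where C1: "0 \<le> C1" "\<And>h. h \<in> borel_measurable borel \<Longrightarrow>
      (\<integral>\<^sup>+\<zeta>. ennreal (weight s1 \<zeta>) * (abs_conv h e \<zeta>)\<^sup>2 \<partial>lborel) \<le> ennreal C1 * weighted_l2sq s1 h"
    using abs_conv_moments_bound[OF s1 e] by blast
  obtain C3 where C3: "0 \<le> C3" "\<And>h k. h \<in> borel_measurable borel \<Longrightarrow> k \<in> borel_measurable borel \<Longrightarrow>
      (\<integral>\<^sup>+\<zeta>. ennreal (weight s \<zeta>) * (abs_conv h k \<zeta>)\<^sup>2 \<partial>lborel) \<le> ennreal C3 * weighted_l2sq s1 h * weighted_l2sq s2 k"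
    using abs_conv_weighted_bound[OF s] by blast
  define C2 where "C2 = (1 + r\<^sup>2) powr s2 / r ^ 3"
  have C2: "0 \<le> C2" using r by (simp add: C2_def)
  define c2 where "c2 = (norm c)\<^sup>2"
  have c2: "0 \<le> c2" by (simp add: c2_def)
  have "\<exists>H\<in>borel_measurable borel. weighted_l2sq s H \<le> ennreal (c2 * C3 * (c2 * C1) * C2) * (weighted_l2sq s1 h * weighted_l2sq s2 k) \<and>
      (\<forall>\<eta>\<in>schwartz. (\<integral>y. A y * \<theta> (r *\<^sub>R y) * G (r *\<^sub>R y) * fourier \<eta> y \<partial>lborel) = (\<integral>\<zeta>. H \<zeta> * \<eta> \<zeta> \<partial>lborel))"
    if A: "weak_pair A h" and G: "fourier_pair G k" and fh: "weighted_l2sq s1 h < \<infinity>" and fk: "weighted_l2sq s2 k < \<infinity>" for A h G k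
  proof -
    have [measurable]: "h \<in> borel_measurable borel" "k \<in> borel_measurable borel"
      using A G by (auto simp: weak_pair_def fourier_pair_def)
    define h1 where "h1 \<zeta> = c * conv h e \<zeta>" for \<zeta>
    define k1 where "k1 \<xi> = k ((1 / r) *\<^sub>R \<xi>) / of_real (r ^ 3)" for \<xi>
    define H where "H \<zeta> = c * conv h1 k1 \<zeta>" for \<zeta>
    have [measurable]: "h1 \<in> borel_measurable borel" "k1 \<in> borel_measurable borel"
      unfolding h1_def k1_def by measurable
    have [measurable]: "H \<in> borel_measurable borel"
      unfolding H_def by measurable
    have A1: "weak_pair (\<lambda>y. A y * \<theta> (r *\<^sub>R y)) h1"
      using weak_pair_mult[OF A e] unfolding inv_e h1_def c_def .
    have G1: "fourier_pair (\<lambda>y. G (r *\<^sub>R y)) k1"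
      using fourier_pair_dilate[OF G r] unfolding k1_def .
    have wh1: "weighted_l2sq s1 h1 \<le> ennreal (c2 * C1) * weighted_l2sq s1 h"
    proof -
      have "weighted_l2sq s1 h1 = ennreal c2 * weighted_l2sq s1 (conv h e)"
        unfolding h1_def c2_def by (rule weighted_l2sq_cmult) measurable
      also have "\<dots> \<le> ennreal c2 * (ennreal C1 * weighted_l2sq s1 h)"
        by (intro mult_left_mono order_trans[OF weighted_l2sq_conv_le C1(2)]) auto
      finally show ?thesis using c2 C1(1) by (simp add: ennreal_mult mult.assoc)
    qed
    have wk1: "weighted_l2sq s2 k1 \<le> ennreal C2 * weighted_l2sq s2 k"
      unfolding k1_def C2_def by (rule weighted_l2sq_dilate[OF _ s2 r]) measurable
    have bd: "(\<integral>\<^sup>+\<zeta>. ennreal (weight s \<zeta>) * (abs_conv h1 k1 \<zeta>)\<^sup>2 \<partial>lborel)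
        \<le> ennreal C3 * (ennreal (c2 * C1) * weighted_l2sq s1 h) * (ennreal C2 * weighted_l2sq s2 k)"
      by (rule order_trans[OF C3(2)]) (auto intro!: mult_mono wh1 wk1)
    also have "\<dots> < \<infinity>"
      using fh fk by (simp add: ennreal_mult_less_top)
    finally have "(\<integral>\<^sup>+\<zeta>. ennreal (weight s \<zeta>) * (abs_conv h1 k1 \<zeta>)\<^sup>2 \<partial>lborel) < \<infinity>" .
    moreover have "(\<integral>\<^sup>+\<zeta>. (abs_conv h1 k1 \<zeta>)\<^sup>2 \<partial>lborel) \<le> (\<integral>\<^sup>+\<zeta>. ennreal (weight s \<zeta>) * (abs_conv h1 k1 \<zeta>)\<^sup>2 \<partial>lborel)"
    proof (rule nn_integral_mono)
      fix \<zeta>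
      have "1 \<le> ennreal (weight s \<zeta>)"
        using weight_ge_1[OF s(1)] by (simp add: ennreal_1[symmetric] ennreal_leI del: ennreal_1)
      then show "(abs_conv h1 k1 \<zeta>)\<^sup>2 \<le> ennreal (weight s \<zeta>) * (abs_conv h1 k1 \<zeta>)\<^sup>2"
        using mult_right_mono[of 1 "ennreal (weight s \<zeta>)" "(abs_conv h1 k1 \<zeta>)\<^sup>2"] by simp
    qed
    ultimately have fin: "(\<integral>\<^sup>+\<zeta>. (abs_conv h1 k1 \<zeta>)\<^sup>2 \<partial>lborel) < \<infinity>"
      by (rule order_le_less_trans[rotated])
    have "weighted_l2sq s H = ennreal c2 * weighted_l2sq s (conv h1 k1)"
      unfolding H_def c2_def by (rule weighted_l2sq_cmult) measurable
    also have "\<dots> \<le> ennreal c2 * (ennreal C3 * (ennreal (c2 * C1) * weighted_l2sq s1 h) * (ennreal C2 * weighted_l2sq s2 k))"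
      by (intro mult_left_mono order_trans[OF weighted_l2sq_conv_le bd]) auto
    also have "\<dots> = ennreal (c2 * C3 * (c2 * C1) * C2) * (weighted_l2sq s1 h * weighted_l2sq s2 k)"
      using c2 C1(1) C2 C3(1) by (simp add: ennreal_mult mult_ac)
    finally have "weighted_l2sq s H \<le> ennreal (c2 * C3 * (c2 * C1) * C2) * (weighted_l2sq s1 h * weighted_l2sq s2 k)" .
    moreover have "(\<integral>y. A y * \<theta> (r *\<^sub>R y) * G (r *\<^sub>R y) * fourier \<eta> y \<partial>lborel) = (\<integral>\<zeta>. H \<zeta> * \<eta> \<zeta> \<partial>lborel)"
      if "\<eta> \<in> schwartz" for \<eta>
      using weak_pair_mult_fourier_pair[OF A1 G1 that fin] unfolding H_def c_def .
    ultimately show ?thesis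
      by (intro bexI[of _ H] conjI ballI) auto
  qed
  then show ?thesis
    using c2 C1(1) C2 C3(1) by (intro exI[of _ "c2 * C3 * (c2 * C1) * C2"] conjI) (auto intro!: mult_nonneg_nonneg)
qed

section \<open>Pieces of the product and neighbouring shells\<close>

lemma dilate_represented:
  assumes rep: "represented_by u f" and \<theta>: "moderate 0 \<theta>" and \<phi>: "\<phi> \<in> schwartz" and r: "0 < r"
  shows "dilate r (smooth_mult \<theta> u) \<phi> = (\<integral>y. \<theta> (r *\<^sub>R y) * f (r *\<^sub>R y) * \<phi> y \<partial>lborel)"
proof -
  have fm [measurable]: "f \<in> borel_measurable borel"
    using rep by (simp add: represented_by_def)
  have [measurable]: "\<theta> \<in> borel_measurable borel"
    using \<theta> by (intro smooth_measurable) (simp add: moderate_def)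
  note [measurable] = schwartz_measurable[OF \<phi>]
  have S: "(\<lambda>x. \<theta> x * \<phi> ((1 / r) *\<^sub>R x)) \<in> schwartz"
    using r by (intro schwartz_mult[OF \<theta>] schwartz_dilate \<phi>) auto
  have meas: "(\<lambda>x. f x * (\<theta> x * \<phi> ((1 / r) *\<^sub>R x))) \<in> borel_measurable borel"
    by measurable
  have "dilate r (smooth_mult \<theta> u) \<phi> = of_real (1 / r ^ 3) * (\<integral>x. f x * (\<theta> x * \<phi> ((1 / r) *\<^sub>R x)) \<partial>lborel)"
    using rep S by (simp add: dilate_def smooth_mult_def represented_by_def)
  also have "(\<integral>x. f x * (\<theta> x * \<phi> ((1 / r) *\<^sub>R x)) \<partial>lborel) = r ^ 3 *\<^sub>R (\<integral>y. f (r *\<^sub>R y) * (\<theta> (r *\<^sub>R y) * \<phi> y) \<partial>lborel)"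
    using integral_lborel_affine[OF meas, of r 0] r by simp
  finally show ?thesis
    using r by (simp add: scaleR_conv_of_real[where 'a = complex] mult_ac)
qed

text \<open>Indices whose bump can meet the support of \<open>\<psi> j\<close>. There 2^l <= 1 + |x|
  <= 1 + 8 * 2^j < 2^(j+4), and for j >= 1 also 2^j <= 16 |x| <= 2^(l+6). Both conditions are
  written additively to avoid truncated subtraction; at most 6 + 3 + 1 = 10 indices remain.\<close>

definition nearby :: "nat \<Rightarrow> nat set" where
  "nearby j = {l. j \<le> l + 6 \<and> l \<le> j + 3}"

lemma nearby_finite: "finite (nearby j)" "card (nearby j) \<le> 10"
proof -
  have sub: "nearby j \<subseteq> {j - 6..j + 3}"
    by (auto simp: nearby_def)
  then show "finite (nearby j)"
    by (rule finite_subset) simp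
  have "card (nearby j) \<le> card {j - 6..j + 3}"
    by (rule card_mono[OF _ sub]) simp
  then show "card (nearby j) \<le> 10" by simp
qed

text \<open>Names a constant that serves all scales j, all neighbouring l and all pairs of functions
  at once; this uniformity is what allows the later summation over j.\<close>

definition bump_product_const :: "(nat \<Rightarrow> real^3 \<Rightarrow> complex) \<Rightarrow> real \<Rightarrow> real \<Rightarrow> real \<Rightarrow> real \<Rightarrow> bool" where
  "bump_product_const \<psi> s s1 s2 C \<longleftrightarrow> 0 \<le> C \<and>
    (\<forall>A h G k j l. weak_pair A h \<longrightarrow> fourier_pair G k \<longrightarrow> weighted_l2sq s1 h < \<infinity> \<longrightarrow> weighted_l2sq s2 k < \<infinity> \<longrightarrow> l \<in> nearby j \<longrightarrow>
      (\<exists>H\<in>borel_measurable borel. weighted_l2sq s H \<le> ennreal C * (weighted_l2sq s1 h * weighted_l2sq s2 k) \<and>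
        (\<forall>\<eta>\<in>schwartz. (\<integral>y. A y * bump (\<psi> 0) (l \<noteq> 0) ((2 ^ j / 2 ^ l) *\<^sub>R y) * G ((2 ^ j / 2 ^ l) *\<^sub>R y) * fourier \<eta> y \<partial>lborel)
          = (\<integral>\<zeta>. H \<zeta> * \<eta> \<zeta> \<partial>lborel))))"

context
  fixes \<psi> assumes \<psi>: "dyadic_cutoffs \<psi>"
begin

lemma bump_nearby:
  assumes "\<psi> j x \<noteq> 0" "bump (\<psi> 0) (l \<noteq> 0) ((1 / 2 ^ l) *\<^sub>R x) \<noteq> 0"
  shows "l \<in> nearby j"
proof -
  note b = bump_support_bounds(1,2)[OF \<psi> assms(2)]
  have "(2::real) ^ l \<le> 1 + 8 * 2 ^ j"
    using b(2) dyadic_cutoffs_support(1)[OF \<psi> assms(1)] by linarith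
  also have "\<dots> < (2::real) ^ (j + 4)"
  proof -
    have "(1::real) \<le> 2 ^ j" by simp
    then have "1 + 8 * 2 ^ j < 16 * (2::real) ^ j" by linarith
    then show ?thesis by (simp add: power_add)
  qed
  finally have "l < j + 4"
    by (simp add: power_strict_increasing_iff)
  moreover have "j \<le> l + 6"
  proof (cases "j = 0")
    case False
    then have "2 ^ j \<le> 16 * norm x"
      using dyadic_cutoffs_support(2)[OF \<psi> assms(1)] by simp
    also have "\<dots> \<le> (2::real) ^ (l + 6)"
      using b(1) by (simp add: power_add)
    finally show ?thesis by simp
  qed simp
  ultimately show ?thesis by (simp add: nearby_def)
qed

text \<open>The cutoff has compact support, so polynomial growth of f already gives square
  integrability of the localized function. Only finiteness is recorded for it; all quantitative
  information sits in h.\<close>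

lemma weak_pair_localized:
  assumes rep: "represented_by u f" and f: "l2_growth m f"
    and h: "represented_by (fourier_dist (dilate (2 ^ j) (smooth_mult (\<psi> j) u))) h" and fin: "l2sq h < \<infinity>"
  shows "weak_pair (\<lambda>y. \<psi> j (2 ^ j *\<^sub>R y) * f (2 ^ j *\<^sub>R y)) h"
proof -
  note mod = dyadic_cutoffs_moderate[OF \<psi>, of j]
  have [measurable]: "\<psi> j \<in> borel_measurable borel"
    using mod by (intro smooth_measurable) (simp add: moderate_def)
  note [measurable] = l2_growth_measurable[OF f]
  obtain B where B: "\<And>x. norm (\<psi> j x) \<le> B"
    using moderate_bound[OF mod, of "[]"] by auto
  have "l2sq (\<lambda>x. \<psi> j x * f x) < \<infinity>"
  proof (rule l2_growth_compact_support[OF f])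
    show "\<psi> j x = 0" if "8 * 2 ^ j < norm x" for x
      using dyadic_cutoffs_support(1)[OF \<psi>, of j x] that by force
  qed (use B in auto)
  then have "l2sq (\<lambda>y. \<psi> j (2 ^ j *\<^sub>R y) * f (2 ^ j *\<^sub>R y)) < \<infinity>"
    by (intro l2sq_scale_finite[of "\<lambda>x. \<psi> j x * f x"]) auto
  moreover have "(\<integral>y. \<psi> j (2 ^ j *\<^sub>R y) * f (2 ^ j *\<^sub>R y) * fourier \<eta> y \<partial>lborel) = (\<integral>\<xi>. h \<xi> * \<eta> \<xi> \<partial>lborel)"
    if \<eta>: "\<eta> \<in> schwartz" for \<eta>
  proof -
    have "(\<integral>\<xi>. h \<xi> * \<eta> \<xi> \<partial>lborel) = dilate (2 ^ j) (smooth_mult (\<psi> j) u) (fourier \<eta>)"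
      using h \<eta> by (simp add: represented_by_def fourier_dist_def)
    also have "\<dots> = (\<integral>y. \<psi> j (2 ^ j *\<^sub>R y) * f (2 ^ j *\<^sub>R y) * fourier \<eta> y \<partial>lborel)"
      by (intro dilate_represented rep mod fourier_schwartz \<eta>) simp
    finally show ?thesis ..
  qed
  moreover have "h \<in> borel_measurable borel"
    using h by (simp add: represented_by_def)
  ultimately show ?thesis
    using fin unfolding weak_pair_def by auto
qed

lemma product_sum_nearby:
  assumes g: "\<forall>x n. norm x \<le> real n \<longrightarrow> g x = (\<Sum>l\<le>n. bump (\<psi> 0) (l \<noteq> 0) ((1 / 2 ^ l) *\<^sub>R x) * G l ((1 / 2 ^ l) *\<^sub>R x))"
  shows "\<psi> j x * g x = (\<Sum>l\<in>nearby j. \<psi> j x * (bump (\<psi> 0) (l \<noteq> 0) ((1 / 2 ^ l) *\<^sub>R x) * G l ((1 / 2 ^ l) *\<^sub>R x)))"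
proof (cases "\<psi> j x = 0")
  case False
  let ?t = "\<lambda>l. bump (\<psi> 0) (l \<noteq> 0) ((1 / 2 ^ l) *\<^sub>R x) * G l ((1 / 2 ^ l) *\<^sub>R x)"
  obtain n where n: "norm x \<le> real n" using real_arch_simple by blast
  have nt: "nat \<lfloor>norm x\<rfloor> \<le> n" using n by linarith
  have "g x = (\<Sum>l\<le>n. ?t l)" using g n by blast
  also have "\<dots> = (\<Sum>l\<in>{..n} \<inter> nearby j. ?t l)"
    using bump_nearby[OF False] by (intro sum.mono_neutral_right) auto
  also have "\<dots> = (\<Sum>l\<in>nearby j. ?t l)"
  proof (rule sum.mono_neutral_left)
    show "\<forall>l\<in>nearby j - {..n} \<inter> nearby j. ?t l = 0"
    proof
      fix l assume "l \<in> nearby j - {..n} \<inter> nearby j"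
      then have "n < l" by auto
      then have "bump (\<psi> 0) (l \<noteq> 0) ((1 / 2 ^ l) *\<^sub>R x) = 0"
        using bump_support_bounds(4)[OF \<psi>, of l x] nt by force
      then show "?t l = 0" by simp
    qed
  qed (auto simp: nearby_finite)
  finally show ?thesis by (simp only: sum_distrib_left)
qed simp

text \<open>Only the ratio 2^j / 2^l and the kind of bump enter the estimate. Over all j and
  neighbouring l the ratio takes ten values and there are two kinds of bump, so the sum of the
  twenty constants dominates each of them.\<close>

lemma bump_product_bound:
  assumes s: "0 \<le> s" "s \<le> s1" "s \<le> s2" "s1 + s2 > s + 3 / 2"
  shows "\<exists>C. bump_product_const \<psi> s s1 s2 C"
proof -
  define Q where "Q C b r \<longleftrightarrow> (\<forall>A h G k. weak_pair A h \<longrightarrow> fourier_pair G k \<longrightarrow> weighted_l2sq s1 h < \<infinity> \<longrightarrow> weighted_l2sq s2 k < \<infinity> \<longrightarrow>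
    (\<exists>H\<in>borel_measurable borel. weighted_l2sq s H \<le> ennreal C * (weighted_l2sq s1 h * weighted_l2sq s2 k) \<and>
      (\<forall>\<eta>\<in>schwartz. (\<integral>y. A y * bump (\<psi> 0) b (r *\<^sub>R y) * G (r *\<^sub>R y) * fourier \<eta> y \<partial>lborel) = (\<integral>\<zeta>. H \<zeta> * \<eta> \<zeta> \<partial>lborel))))"
    for C :: real and b and r :: real
  have "\<exists>C\<ge>0. Q C b (2 ^ q / 8)" for q b
    unfolding Q_def by (rule localized_product_bound[OF s bump_schwartz[OF \<psi>]]) simp
  then have "\<forall>p. \<exists>C. 0 \<le> C \<and> Q C (snd p) (2 ^ fst p / 8)"
    by blast
  then obtain D where D: "\<forall>p. 0 \<le> D p \<and> Q (D p) (snd p) (2 ^ fst p / 8)"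
    using choice[of "\<lambda>p C. 0 \<le> C \<and> Q C (snd p) (2 ^ fst p / 8)"] by blast
  define C where "C q b = D (q, b)" for q b
  have C0: "0 \<le> C q b" and C: "Q (C q b) b (2 ^ q / 8)" for q b
    using D[rule_format, of "(q, b)"] by (simp_all add: C_def)
  define B where "B = (\<Sum>q\<le>9::nat. C q True + C q False)"
  have CB: "C q b \<le> B" if "q \<le> 9" for q b
  proof -
    have "C q b \<le> C q True + C q False"
      using C0[of q True] C0[of q False] by (cases b) auto
    also have "\<dots> \<le> B"
      unfolding B_def using that C0 by (intro member_le_sum) (auto intro: add_nonneg_nonneg)
    finally show ?thesis .
  qed
  have B0: "0 \<le> B" using CB[of 0 True] C0[of 0 True] by simp
  have "\<exists>H\<in>borel_measurable borel. weighted_l2sq s H \<le> ennreal B * (weighted_l2sq s1 h * weighted_l2sq s2 k) \<and>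
      (\<forall>\<eta>\<in>schwartz. (\<integral>y. A y * bump (\<psi> 0) (l \<noteq> 0) ((2 ^ j / 2 ^ l) *\<^sub>R y) * G ((2 ^ j / 2 ^ l) *\<^sub>R y) * fourier \<eta> y \<partial>lborel) = (\<integral>\<zeta>. H \<zeta> * \<eta> \<zeta> \<partial>lborel))"
    if H: "weak_pair A h" "fourier_pair G k" "weighted_l2sq s1 h < \<infinity>" "weighted_l2sq s2 k < \<infinity>" and l: "l \<in> nearby j" for A h G k j l
  proof -
    \<comment> \<open>The shift by 3 keeps q a natural number, since l may exceed j by up to 3. It
      runs through 0..9, and the scale ratio is 2^q / 8.\<close>
    define q where "q = j + 3 - l"
    have q9: "q \<le> 9" using l by (auto simp: q_def nearby_def)
    have "q + l = j + 3" using l by (auto simp: q_def nearby_def)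
    then have "(2::real) ^ q * 2 ^ l = 2 ^ j * 8"
      by (simp add: power_add[symmetric]) (simp add: power_add)
    then have r: "(2::real) ^ j / 2 ^ l = 2 ^ q / 8"
      by (simp add: field_simps)
    obtain H where "H \<in> borel_measurable borel" "weighted_l2sq s H \<le> ennreal (C q (l \<noteq> 0)) * (weighted_l2sq s1 h * weighted_l2sq s2 k)"
      "\<forall>\<eta>\<in>schwartz. (\<integral>y. A y * bump (\<psi> 0) (l \<noteq> 0) ((2 ^ q / 8) *\<^sub>R y) * G ((2 ^ q / 8) *\<^sub>R y) * fourier \<eta> y \<partial>lborel) = (\<integral>\<zeta>. H \<zeta> * \<eta> \<zeta> \<partial>lborel)"
      using C[of q "l \<noteq> 0", unfolded Q_def, rule_format, OF H] by blast
    moreover have "ennreal (C q (l \<noteq> 0)) * (weighted_l2sq s1 h * weighted_l2sq s2 k) \<le> ennreal B * (weighted_l2sq s1 h * weighted_l2sq s2 k)"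
      by (intro mult_right_mono ennreal_leI CB q9) auto
    ultimately show ?thesis
      unfolding r by (intro bexI[of _ H] conjI) (auto intro: order_trans)
  qed
  then have "bump_product_const \<psi> s s1 s2 B"
    unfolding bump_product_const_def using B0 by (intro conjI allI impI)
  then show ?thesis ..
qed

text \<open>The cutoff stays on f while g is expanded, so every summand pairs the same h with one
  neighbouring \<open>k l\<close>. The sum of the resulting functions represents the transform of
  the whole piece, and the sum of squares costs the number of neighbours.\<close>

lemma product_piece:
  assumes s: "0 \<le> s"
    and C: "bump_product_const \<psi> s s1 s2 C"
    and A: "weak_pair (\<lambda>y. \<psi> j (2 ^ j *\<^sub>R y) * f (2 ^ j *\<^sub>R y)) h" and G: "\<And>l. fourier_pair (G l) (k l)"
    and fh: "weighted_l2sq s1 h < \<infinity>" and fk: "\<And>l. weighted_l2sq s2 (k l) < \<infinity>"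
    and g: "\<forall>x n. norm x \<le> real n \<longrightarrow> g x = (\<Sum>l\<le>n. bump (\<psi> 0) (l \<noteq> 0) ((1 / 2 ^ l) *\<^sub>R x) * G l ((1 / 2 ^ l) *\<^sub>R x))"
    and w: "represented_by w (\<lambda>x. f x * g x)"
  shows "bessel_norm_sq s (dilate (2 ^ j) (smooth_mult (\<psi> j) w))
    \<le> ennreal (10 * C) * (weighted_l2sq s1 h * (\<Sum>l\<in>nearby j. weighted_l2sq s2 (k l)))"
proof -
  define A where "A y = \<psi> j (2 ^ j *\<^sub>R y) * f (2 ^ j *\<^sub>R y)" for y
  have A': "weak_pair A h" using A unfolding A_def .
  have C0: "0 \<le> C" using C by (simp add: bump_product_const_def)
  define R where "R l H \<longleftrightarrow> weighted_l2sq s H \<le> ennreal C * (weighted_l2sq s1 h * weighted_l2sq s2 (k l)) \<and>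
      (\<forall>\<eta>\<in>schwartz. (\<integral>y. A y * bump (\<psi> 0) (l \<noteq> 0) ((2 ^ j / 2 ^ l) *\<^sub>R y) * G l ((2 ^ j / 2 ^ l) *\<^sub>R y) * fourier \<eta> y \<partial>lborel)
        = (\<integral>\<zeta>. H \<zeta> * \<eta> \<zeta> \<partial>lborel))" for l H
  have R_ex: "\<exists>H\<in>borel_measurable borel. R l H" if "l \<in> nearby j" for l
    unfolding R_def using C[unfolded bump_product_const_def, THEN conjunct2, rule_format, OF A' G fh fk that] .
  \<comment> \<open>Outside \<open>nearby j\<close> the function 0 is taken, so that the chosen
    family is measurable for every index.\<close>
  have "\<exists>H. H \<in> borel_measurable borel \<and> (l \<in> nearby j \<longrightarrow> R l H)" for l
  proof (cases "l \<in> nearby j")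
    case True
    then show ?thesis using R_ex by blast
  next
    case False
    then show ?thesis by (intro exI[of _ "\<lambda>_. 0"]) simp
  qed
  then obtain H where H: "\<And>l. H l \<in> borel_measurable borel \<and> (l \<in> nearby j \<longrightarrow> R l (H l))"
    by metis
  have Hm [measurable]: "H l \<in> borel_measurable borel" for l
    using H by blast
  have HR: "R l (H l)" if "l \<in> nearby j" for l
    using H that by blast
  note HW = HR[unfolded R_def, THEN conjunct1] and HI = HR[unfolded R_def, THEN conjunct2, rule_format]
  have H2: "l2sq (H l) < \<infinity>" if "l \<in> nearby j" for l
  proof -
    have "l2sq (H l) \<le> ennreal C * (weighted_l2sq s1 h * weighted_l2sq s2 (k l))"
      using l2sq_le_weighted[OF s] HW[OF that] by (rule order_trans)
    also have "\<dots> < \<infinity>" using fh fk[of l] by (simp add: ennreal_mult_less_top)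
    finally show ?thesis .
  qed
  define h' where "h' \<zeta> = (\<Sum>l\<in>nearby j. H l \<zeta>)" for \<zeta>
  have [measurable]: "h' \<in> borel_measurable borel" unfolding h'_def by measurable
  have Am [measurable]: "A \<in> borel_measurable borel" and A2: "l2sq A < \<infinity>"
    using A' by (auto simp: weak_pair_def)
  have Gm [measurable]: "G l \<in> borel_measurable borel" for l
    by (rule fourier_pair_measurable(1)[OF G])
  have rep: "represented_by (fourier_dist (dilate (2 ^ j) (smooth_mult (\<psi> j) w))) h'"
    unfolding represented_by_def
  proof (intro conjI ballI)
    fix \<eta> :: "real^3 \<Rightarrow> complex" assume \<eta>: "\<eta> \<in> schwartz"
    note [measurable] = schwartz_measurable[OF \<eta>] schwartz_measurable[OF fourier_schwartz[OF \<eta>]]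
    have Hi: "integrable lborel (\<lambda>\<zeta>. H l \<zeta> * \<eta> \<zeta>)" if "l \<in> nearby j" for l
      by (intro integrable_l2_mult H2 that schwartz_l2sq \<eta>) measurable
    then show "integrable lborel (\<lambda>\<zeta>. h' \<zeta> * \<eta> \<zeta>)"
      unfolding h'_def sum_distrib_right by (intro Bochner_Integration.integrable_sum)
    let ?T = "\<lambda>l y. A y * bump (\<psi> 0) (l \<noteq> 0) ((2 ^ j / 2 ^ l) *\<^sub>R y) * G l ((2 ^ j / 2 ^ l) *\<^sub>R y) * fourier \<eta> y"
    have Ti: "integrable lborel (?T l)" for l
    proof -
      define r where "r = (2::real) ^ j / 2 ^ l"
      define \<theta> where "\<theta> y = bump (\<psi> 0) (l \<noteq> 0) (r *\<^sub>R y) * fourier \<eta> y" for y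
      have r: "0 < r" by (simp add: r_def)
      have \<theta>: "\<theta> \<in> schwartz"
        unfolding \<theta>_def using r
        by (intro schwartz_mult[OF schwartz_moderate] schwartz_dilate bump_schwartz[OF \<psi>] fourier_schwartz \<eta>) auto
      note [measurable] = schwartz_measurable[OF \<theta>]
      obtain B where B: "\<And>y. norm (\<theta> y) \<le> B" using schwartz_bounded[OF \<theta>] by blast
      have "l2sq (\<lambda>y. G l (r *\<^sub>R y)) < \<infinity>"
        by (intro l2sq_scale_finite fourier_pair_finite(1)[OF G] r) measurable
      then have "l2sq (\<lambda>y. \<theta> y * G l (r *\<^sub>R y)) < \<infinity>"
        by (intro l2sq_bounded_mult[where B = B] B) measurable
      then have "integrable lborel (\<lambda>y. A y * (\<theta> y * G l (r *\<^sub>R y)))"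
        by (intro integrable_l2_mult A2) measurable
      then show ?thesis
        unfolding \<theta>_def r_def by (simp add: mult_ac)
    qed
    have "fourier_dist (dilate (2 ^ j) (smooth_mult (\<psi> j) w)) \<eta>
      = (\<integral>y. \<psi> j (2 ^ j *\<^sub>R y) * (f (2 ^ j *\<^sub>R y) * g (2 ^ j *\<^sub>R y)) * fourier \<eta> y \<partial>lborel)"
      unfolding fourier_dist_def
      by (intro dilate_represented[OF w] dyadic_cutoffs_moderate[OF \<psi>] fourier_schwartz \<eta>) simp
    also have "\<dots> = (\<integral>y. (\<Sum>l\<in>nearby j. ?T l y) \<partial>lborel)"
    proof (rule Bochner_Integration.integral_cong[OF refl])
      fix y
      have "\<psi> j (2 ^ j *\<^sub>R y) * (f (2 ^ j *\<^sub>R y) * g (2 ^ j *\<^sub>R y)) * fourier \<eta> y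
        = f (2 ^ j *\<^sub>R y) * fourier \<eta> y * (\<psi> j (2 ^ j *\<^sub>R y) * g (2 ^ j *\<^sub>R y))"
        by (simp add: mult_ac)
      also have "\<dots> = (\<Sum>l\<in>nearby j. ?T l y)"
        unfolding product_sum_nearby[OF g] sum_distrib_left A_def by (intro sum.cong) (auto simp: mult_ac)
      finally show "\<psi> j (2 ^ j *\<^sub>R y) * (f (2 ^ j *\<^sub>R y) * g (2 ^ j *\<^sub>R y)) * fourier \<eta> y = (\<Sum>l\<in>nearby j. ?T l y)" .
    qed
    also have "\<dots> = (\<Sum>l\<in>nearby j. \<integral>y. ?T l y \<partial>lborel)"
      by (rule Bochner_Integration.integral_sum) (rule Ti)
    also have "\<dots> = (\<Sum>l\<in>nearby j. \<integral>\<zeta>. H l \<zeta> * \<eta> \<zeta> \<partial>lborel)"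
      by (intro sum.cong refl HI \<eta>)
    also have "\<dots> = (\<integral>\<zeta>. h' \<zeta> * \<eta> \<zeta> \<partial>lborel)"
      unfolding h'_def sum_distrib_right by (rule Bochner_Integration.integral_sum[symmetric]) (rule Hi)
    finally show "fourier_dist (dilate (2 ^ j) (smooth_mult (\<psi> j) w)) \<eta> = (\<integral>\<zeta>. h' \<zeta> * \<eta> \<zeta> \<partial>lborel)" .
  qed measurable
  \<comment> \<open>The Bessel norm is an infimum over representing functions, so exhibiting the
    single one \<open>h'\<close> bounds it from above.\<close>
  have "bessel_norm_sq s (dilate (2 ^ j) (smooth_mult (\<psi> j) w)) \<le> weighted_l2sq s h'"
    unfolding bessel_norm_sq_alt by (rule INF_lower) (simp add: rep)
  also have "\<dots> \<le> ennreal (real (card (nearby j))) * (\<Sum>l\<in>nearby j. weighted_l2sq s (H l))"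
    unfolding h'_def by (rule weighted_l2sq_sum_le[OF nearby_finite(1) Hm])
  also have "\<dots> \<le> ennreal 10 * (\<Sum>l\<in>nearby j. ennreal C * (weighted_l2sq s1 h * weighted_l2sq s2 (k l)))"
    using nearby_finite(2)[of j] by (intro mult_mono ennreal_leI sum_mono HW) (auto simp: sum_nonneg)
  also have "\<dots> = ennreal (10 * C) * (weighted_l2sq s1 h * (\<Sum>l\<in>nearby j. weighted_l2sq s2 (k l)))"
    using C0 by (simp add: sum_distrib_left[symmetric] ennreal_mult mult_ac)
  finally show ?thesis .
qed

end

text \<open>The condition on the weights says that 3/2 + \<delta> is at most the sum of 3/2 +
  \<delta>1 and 3/2 + \<delta>2. Replacing j by l in the second exponent costs 2 |3/2 + \<delta>2|
  times |j - l| <= 6, which explains the 12.\<close>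

lemma dyadic_weight_le:
  assumes "\<delta>1 + \<delta>2 \<ge> \<delta> - 3 / 2" "l \<in> nearby j"
  shows "2 powr ((3 / 2 + \<delta>) * 2 * real j)
    \<le> 2 powr (\<bar>3 / 2 + \<delta>2\<bar> * 12) * (2 powr ((3 / 2 + \<delta>1) * 2 * real j) * 2 powr ((3 / 2 + \<delta>2) * 2 * real l))"
proof -
  have "(3 / 2 + \<delta>) * 2 * real j \<le> ((3 / 2 + \<delta>1) + (3 / 2 + \<delta>2)) * 2 * real j"
    using assms(1) by (intro mult_right_mono) auto
  moreover have "(3 / 2 + \<delta>2) * 2 * (real j - real l) \<le> \<bar>3 / 2 + \<delta>2\<bar> * 12"
  proof -
    have "\<bar>real j - real l\<bar> \<le> 6"
      using assms(2) by (auto simp: nearby_def)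
    have *: "\<bar>a * 2 * d\<bar> = \<bar>a\<bar> * (2 * \<bar>d\<bar>)" for a d :: real
      by (simp add: abs_mult)
    have "(3 / 2 + \<delta>2) * 2 * (real j - real l) \<le> \<bar>(3 / 2 + \<delta>2) * 2 * (real j - real l)\<bar>"
      by (rule abs_ge_self)
    also have "\<dots> = \<bar>3 / 2 + \<delta>2\<bar> * (2 * \<bar>real j - real l\<bar>)"
      by (rule *)
    also have "\<dots> \<le> \<bar>3 / 2 + \<delta>2\<bar> * 12"
      using \<open>\<bar>real j - real l\<bar> \<le> 6\<close> by (intro mult_left_mono) auto
    finally show ?thesis .
  qed
  ultimately have "(3 / 2 + \<delta>) * 2 * real j \<le> \<bar>3 / 2 + \<delta>2\<bar> * 12 + ((3 / 2 + \<delta>1) * 2 * real j + (3 / 2 + \<delta>2) * 2 * real l)"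
    by (simp add: algebra_simps)
  then show ?thesis
    by (simp add: powr_add[symmetric])
qed

theorem proposition8p8:
  fixes \<psi> :: "nat \<Rightarrow> real^3 \<Rightarrow> complex" and s s1 s2 \<delta> \<delta>1 \<delta>2 :: real
  assumes "dyadic_cutoffs \<psi>"
    and "s \<ge> 0" and "s1 \<ge> s" and "s2 \<ge> s" and "s1 + s2 > s + 3 / 2"
    and "\<delta>1 + \<delta>2 \<ge> \<delta> - 3 / 2"
  shows "\<exists>C. \<forall>u\<in>weighted_space \<psi> s1 \<delta>1. \<forall>v\<in>weighted_space \<psi> s2 \<delta>2.
           \<exists>w. is_product u v w \<and> w \<in> weighted_space \<psi> s \<delta> \<and>
               weighted_norm \<psi> s \<delta> w \<le> C * weighted_norm \<psi> s1 \<delta>1 u * weighted_norm \<psi> s2 \<delta>2 v"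
proof -
  have s1: "0 \<le> s1" and s2: "0 \<le> s2" using assms by auto
  obtain C where C: "bump_product_const \<psi> s s1 s2 C"
    using bump_product_bound[OF assms(1-5)] by blast
  have C0: "0 \<le> C" using C by (simp add: bump_product_const_def)
  define B where "B = 2 powr (\<bar>3 / 2 + \<delta>2\<bar> * 12)"
  have B0: "0 \<le> B" by (simp add: B_def)
  \<comment> \<open>The factor 10 counts neighbouring shells in \<open>product_piece\<close>; the
    remaining 4 comes from choosing, for each of the two factors, transforms that minimize the
    Bessel norm up to a factor 2. The squared norms are estimated, so the final constant is
    \<open>sqrt C'\<close>.\<close>
  define C' where "C' = 40 * C * B"
  have C'0: "0 \<le> C'" using C0 B0 by (simp add: C'_def)
  define \<gamma> where "\<gamma> d j = ennreal (2 powr ((3 / 2 + d) * 2 * real j))" for d and j :: nat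
  have \<gamma>_le: "\<gamma> \<delta> j \<le> ennreal B * (\<gamma> \<delta>1 j * \<gamma> \<delta>2 l)" if "l \<in> nearby j" for j l
  proof -
    have "\<gamma> \<delta> j \<le> ennreal (B * (2 powr ((3 / 2 + \<delta>1) * 2 * real j) * 2 powr ((3 / 2 + \<delta>2) * 2 * real l)))"
      unfolding \<gamma>_def B_def by (intro ennreal_leI dyadic_weight_le assms that)
    also have "\<dots> = ennreal B * (\<gamma> \<delta>1 j * \<gamma> \<delta>2 l)"
      unfolding \<gamma>_def by (simp add: ennreal_mult B_def)
    finally show ?thesis .
  qed
  have "\<exists>w. is_product u v w \<and> w \<in> weighted_space \<psi> s \<delta> \<and>
      weighted_norm \<psi> s \<delta> w \<le> sqrt C' * weighted_norm \<psi> s1 \<delta>1 u * weighted_norm \<psi> s2 \<delta>2 v"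
    if u: "u \<in> weighted_space \<psi> s1 \<delta>1" and v: "v \<in> weighted_space \<psi> s2 \<delta>2" for u v
  proof -
    obtain f F h m where f: "represented_by u f" "l2_growth m f" and F: "\<And>j. fourier_pair (F j) (h j)"
      and h: "\<And>j. represented_by (fourier_dist (dilate (2 ^ j) (smooth_mult (\<psi> j) u))) (h j)"
      and Sh: "(\<Sum>j. \<gamma> \<delta>1 j * weighted_l2sq s1 (h j)) \<le> 2 * weighted_norm_sq \<psi> s1 \<delta>1 u"
      using weighted_space_representation[OF assms(1) s1 u] unfolding \<gamma>_def by blast
    obtain g G k m' where g: "represented_by v g" "l2_growth m' g" and G: "\<And>j. fourier_pair (G j) (k j)"
      and Sk: "(\<Sum>j. \<gamma> \<delta>2 j * weighted_l2sq s2 (k j)) \<le> 2 * weighted_norm_sq \<psi> s2 \<delta>2 v"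
      and gsum: "\<forall>x n. norm x \<le> real n \<longrightarrow> g x = (\<Sum>l\<le>n. bump (\<psi> 0) (l \<noteq> 0) ((1 / 2 ^ l) *\<^sub>R x) * G l ((1 / 2 ^ l) *\<^sub>R x))"
      using weighted_space_representation[OF assms(1) s2 v] unfolding \<gamma>_def by blast
    define Nu where "Nu = weighted_norm_sq \<psi> s1 \<delta>1 u"
    define Nv where "Nv = weighted_norm_sq \<psi> s2 \<delta>2 v"
    have Nu: "Nu < \<infinity>" and Nv: "Nv < \<infinity>"
      using u v by (auto simp: weighted_space_def Nu_def Nv_def)
    \<comment> \<open>A finite series of \<open>ennreal\<close> values has finite terms, and
      finiteness passes to the factor \<open>b j\<close> because the weight is a non-zero
      real.\<close>
    have term_finite: "b j < \<infinity>" if "(\<Sum>j. \<gamma> d j * b j) \<le> 2 * N" "N < \<infinity>" for d j N and b :: "nat \<Rightarrow> ennreal"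
    proof -
      have "\<gamma> d j * b j \<le> (\<Sum>j. \<gamma> d j * b j)"
        by (rule ennreal_le_suminf)
      also have "\<dots> \<le> 2 * N" by (rule that)
      also have "\<dots> < \<infinity>" using that(2) by (simp add: ennreal_mult_less_top)
      finally show ?thesis by (auto simp: ennreal_mult_less_top \<gamma>_def)
    qed
    have fh: "weighted_l2sq s1 (h j) < \<infinity>" for j
      by (rule term_finite[OF Sh[folded Nu_def] Nu])
    have fk: "weighted_l2sq s2 (k j) < \<infinity>" for j
      by (rule term_finite[OF Sk[folded Nv_def] Nv])
    define w :: functional where "w \<phi> = (\<integral>x. f x * g x * \<phi> x \<partial>lborel)" for \<phi>
    obtain K where K: "\<And>\<phi>. \<phi> \<in> schwartz \<Longrightarrow> integrable lborel (\<lambda>x. f x * g x * \<phi> x)"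
      "\<And>\<phi>. \<phi> \<in> schwartz \<Longrightarrow> norm (w \<phi>) \<le> K * schwartz_norm (m + m') \<phi>"
      using l2_growth_product_bound[OF f(2) g(2)] unfolding w_def by blast
    have [measurable]: "f \<in> borel_measurable borel" "g \<in> borel_measurable borel"
      using f(2) g(2) by (auto intro: l2_growth_measurable)
    have w: "represented_by w (\<lambda>x. f x * g x)"
      unfolding represented_by_def using K(1) by (simp add: w_def)
    have "tempered w"
      unfolding tempered_def
    proof (intro conjI ballI allI)
      fix \<phi> \<eta> :: "real^3 \<Rightarrow> complex" and a b
      assume S: "\<phi> \<in> schwartz" "\<eta> \<in> schwartz"
      have "w (\<lambda>x. a * \<phi> x + b * \<eta> x) = (\<integral>x. a * (f x * g x * \<phi> x) + b * (f x * g x * \<eta> x) \<partial>lborel)"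
        unfolding w_def by (simp add: algebra_simps)
      also have "\<dots> = a * w \<phi> + b * w \<eta>"
        unfolding w_def using K(1)[OF S(1)] K(1)[OF S(2)] by simp
      finally show "w (\<lambda>x. a * \<phi> x + b * \<eta> x) = a * w \<phi> + b * w \<eta>" .
    qed (use K(2) in blast)
    have piece: "\<gamma> \<delta> j * bessel_norm_sq s (dilate (2 ^ j) (smooth_mult (\<psi> j) w))
       \<le> ennreal (10 * C * B) * (\<Sum>l. \<gamma> \<delta>2 l * weighted_l2sq s2 (k l)) * (\<gamma> \<delta>1 j * weighted_l2sq s1 (h j))" for j
    proof -
      have hl2: "l2sq (h j) < \<infinity>"
        using fourier_pair_finite(2)[OF F] .
      have "bessel_norm_sq s (dilate (2 ^ j) (smooth_mult (\<psi> j) w))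
          \<le> ennreal (10 * C) * (weighted_l2sq s1 (h j) * (\<Sum>l\<in>nearby j. weighted_l2sq s2 (k l)))"
        by (rule product_piece[OF assms(1,2) C weak_pair_localized[OF assms(1) f h hl2] G fh fk gsum w])
      then have "\<gamma> \<delta> j * bessel_norm_sq s (dilate (2 ^ j) (smooth_mult (\<psi> j) w))
          \<le> \<gamma> \<delta> j * (ennreal (10 * C) * (weighted_l2sq s1 (h j) * (\<Sum>l\<in>nearby j. weighted_l2sq s2 (k l))))"
        by (rule mult_left_mono) simp
      also have "\<dots> = ennreal (10 * C) * (weighted_l2sq s1 (h j) * (\<Sum>l\<in>nearby j. \<gamma> \<delta> j * weighted_l2sq s2 (k l)))"
        unfolding sum_distrib_left[symmetric] by (simp only: mult_ac)
      also have "\<dots> \<le> ennreal (10 * C) * (weighted_l2sq s1 (h j) * (\<Sum>l\<in>nearby j. (ennreal B * (\<gamma> \<delta>1 j * \<gamma> \<delta>2 l)) * weighted_l2sq s2 (k l)))"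
        by (intro mult_left_mono sum_mono mult_right_mono \<gamma>_le) auto
      also have "\<dots> = ennreal (10 * C) * (weighted_l2sq s1 (h j) * (ennreal B * \<gamma> \<delta>1 j * (\<Sum>l\<in>nearby j. \<gamma> \<delta>2 l * weighted_l2sq s2 (k l))))"
        by (simp only: sum_distrib_left mult_ac)
      \<comment> \<open>Enlarging the sum over neighbours to all l removes the dependence on j; the
        second factor then leaves the sum over j as a constant.\<close>
      also have "\<dots> \<le> ennreal (10 * C) * (weighted_l2sq s1 (h j) * (ennreal B * \<gamma> \<delta>1 j * (\<Sum>l. \<gamma> \<delta>2 l * weighted_l2sq s2 (k l))))"
        by (intro mult_left_mono sum_le_suminf nearby_finite) auto
      also have "\<dots> = ennreal (10 * C * B) * (\<Sum>l. \<gamma> \<delta>2 l * weighted_l2sq s2 (k l)) * (\<gamma> \<delta>1 j * weighted_l2sq s1 (h j))"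
      proof -
        have "ennreal (10 * C * B) = ennreal (10 * C) * ennreal B"
          using C0 B0 by (intro ennreal_mult) auto
        then show ?thesis by (simp only: mult_ac)
      qed
      finally show ?thesis .
    qed
    have "weighted_norm_sq \<psi> s \<delta> w \<le> (\<Sum>j. ennreal (10 * C * B) * (\<Sum>l. \<gamma> \<delta>2 l * weighted_l2sq s2 (k l)) * (\<gamma> \<delta>1 j * weighted_l2sq s1 (h j)))"
      unfolding weighted_norm_sq_def \<gamma>_def[symmetric] by (intro suminf_le piece) auto
    also have "\<dots> = ennreal (10 * C * B) * (\<Sum>l. \<gamma> \<delta>2 l * weighted_l2sq s2 (k l)) * (\<Sum>j. \<gamma> \<delta>1 j * weighted_l2sq s1 (h j))"
      by (rule ennreal_suminf_cmult)
    also have "\<dots> \<le> ennreal (10 * C * B) * (2 * Nv) * (2 * Nu)"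
      unfolding Nu_def Nv_def by (intro mult_mono Sh Sk) auto
    also have "\<dots> = ennreal C' * (Nu * Nv)"
    proof -
      have "C' = 10 * C * B * 4" by (simp add: C'_def)
      then have "ennreal C' = ennreal (10 * C * B) * ennreal 4"
        using C0 B0 by (simp only: ennreal_mult mult_nonneg_nonneg zero_le_numeral)
      also have "ennreal 4 = 2 * 2" by simp
      finally show ?thesis by (simp only: mult_ac)
    qed
    finally have Nw: "weighted_norm_sq \<psi> s \<delta> w \<le> ennreal C' * (Nu * Nv)" .
    also have fin: "ennreal C' * (Nu * Nv) < \<infinity>"
      using Nu Nv by (simp add: ennreal_mult_less_top)
    finally have "w \<in> weighted_space \<psi> s \<delta>"
      using \<open>tempered w\<close> by (simp add: weighted_space_def)
    moreover have "is_product u v w"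
      unfolding is_product_def using f(1) g(1) w by blast
    moreover have "weighted_norm \<psi> s \<delta> w \<le> sqrt C' * weighted_norm \<psi> s1 \<delta>1 u * weighted_norm \<psi> s2 \<delta>2 v"
    proof -
      have "enn2real (weighted_norm_sq \<psi> s \<delta> w) \<le> enn2real (ennreal C' * (Nu * Nv))"
        using Nw fin by (intro enn2real_mono) auto
      also have "\<dots> = C' * enn2real Nu * enn2real Nv"
        using C'0 by (simp add: enn2real_mult)
      finally have "sqrt (enn2real (weighted_norm_sq \<psi> s \<delta> w)) \<le> sqrt (C' * enn2real Nu * enn2real Nv)"
        by (rule real_sqrt_le_mono)
      then show ?thesis
        by (simp add: weighted_norm_def real_sqrt_mult Nu_def Nv_def)
    qed
    ultimately show ?thesis by blast
  qed
  then show ?thesis by blast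
qed


end
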